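(* Let $(\Sigma,\mathrm{dom})$ be a distributed alphabet over $\mathbb{P}$ with an acyclic communication graph, let $r$ be a leaf process whose unique neighbour is $q$, and let $\mathcal{A}$ be an $r$-short Zielonka automaton over this alphabet with a local $\omega$-regular correctness condition. Then there is a correct covering controller for $\mathcal{A}$ if and only if there is a correct covering controller for the reduced automaton $\overline{\mathcal{A}}$ (over the processes $\mathbb{P}\setminus\{r\}$). Moreover, the size of the $q$-component $\overline{\mathcal{A}}_q$ is polynomial in the size of $\mathcal{A}_q$ and exponential in the size of $\mathcal{A}_r$.
   Context: A distributed alphabet over a finite set $\mathbb{P}$ of processes is $(\Sigma,\mathrm{dom})$ with $\mathrm{dom}:\Sigma\to2^{\mathbb{P}}\setminus\{\emptyset\}$; $\Sigma_p=\{a:p\in\mathrm{dom}(a)\}$, $\Sigma^{loc}_p=\{a:\mathrm{dom}(a)=\{p\}\}$. The communication graph has vertices $\mathbb{P}$ and an edge $p$–$p'$ ($p\ne p'$) iff some $a$ has $\{p,p'\}\subseteq\mathrm{dom}(a)$. A Zielonka automaton $\mathcal{A}=(\{S_p\}_p,s_{in},\{\delta_a\}_a)$ has finite local state sets $S_p$, initial state $s_{in}\in\prod_pS_p$, and partial functions $\delta_a:\prod_{p\in\mathrm{dom}(a)}S_p\to\prod_{p\in\mathrm{dom}(a)}S_p$; we write $s_{\mathrm{dom}(a)}\xrightarrow{a}s'_{\mathrm{dom}(a)}$ if $\delta_a(s_{\mathrm{dom}(a)})=s'_{\mathrm{dom}(a)}$; global transitions update only the components in $\mathrm{dom}(a)$.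 $\mathrm{run}(w)$ ($w\in\Sigma^\infty$) is the sequence of global transitions from $s_{in}$ labelled by $w$ (if defined); its projection on $p$ is the sequence of $p$-components $(s_p,a,s'_p)$ of transitions with $a\in\Sigma_p$. A defined $\mathrm{run}(w)$ is maximal if there are no decomposition $w=uv$ and action $a$ with domain disjoint from the domains of all letters of $v$ such that $\mathrm{run}(uav)$ is defined. A local $\omega$-regular correctness condition gives for each $p$ a set $T_p\subseteq S_p$ and an $\omega$-regular $\Omega_p\subseteq(S_p\times\Sigma_p\times S_p)^\omega$; a projection satisfies $\mathit{Corr}_p$ if finite ending in $T_p$ or infinite and in $\Omega_p$. Actions are partitioned into controllable $\Sigma^{sys}$ and uncontrollable $\Sigma^{env}$. Standing assumptions: $|\mathrm{dom}(a)|\le2$, every process has a controllable action, all controllable actions are local. $\mathcal{A}$ is $r$-short if there is $N$ such that every sequence of consecutive transitions of $\mathcal{A}_r$ on actions of $\Sigma^{loc}_r$ has length at most $N$. Covering controller: a Zielonka automaton $\mathcal{C}$ over the same distributed alphabet (with local state sets $C_p$) together with a map $\pi$ sending each $C_p$ to $S_p$ such that (i) every transition of $\mathcal{C}$ is mapped by $\pi$ componentwise to a transition of $\mathcal{A}$ on the same action, and (ii) for every uncontrollable $a$, if $a$ is enabled from $\pi(c_{\mathrm{dom}(a)})$ in $\mathcal{A}$ then it is enabled from $c_{\mathrm{dom}(a)}$ in $\mathcal{C}$. It is a correct covering controller if every maximal run of $\mathcal{C}$, mapped by $\pi$, satisfies the correctness condition of $\mathcal{A}$. $r$-local strategies: an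 $r$-local strategy from $s_r\in S_r$ is a partial function $f:(\Sigma^{loc}_r)^*\to\Sigma^{sys}_r$ such that $f(v)=a$ implies that $va$ can be executed from $s_r$ in $\mathcal{A}_r$ (its domain is finite since $\mathcal{A}$ is $r$-short). A local action $a\in\Sigma^{loc}_r$ is allowed by $f$ if $f(\varepsilon)=a$ or $a$ is uncontrollable; then $f_{|a}(v)=f(av)$ is an $r$-local strategy from $s'_r$, where $s_r\xrightarrow{a}s'_r$. A sequence of local $r$-actions from $s_r$ respects $f$ if each action is allowed by the residual strategy at that point. The reduced automaton $\overline{\mathcal{A}}$ over $\overline{\mathbb{P}}=\mathbb{P}\setminus\{r\}$: its actions are $\Sigma$ plus new actions $\mathrm{ch}(f)$ for every $r$-local strategy $f$ and $\mathrm{ch}(a)$ for every $a\in\Sigma^{sys}_q$; actions of $\Sigma_r\cup\Sigma_q$ have their domain changed by replacing $r$ by $q$ (so $\Sigma^{loc}_r$ and $\Sigma_q\cap\Sigma_r$ become local to $q$), and the new actions are local to $q$. In $\overline{\mathcal{A}}$ all actions of $\Sigma_q\cup\Sigma_r$ are uncontrollable and all actions $\mathrm{ch}(f),\mathrm{ch}(a)$ are controllable; other actions keep their status. For $p\ne q$ the component, its transitions (for actions not involving $q,r$) and its correctness condition are as in $\mathcal{A}$. The $q$-states are $\langle s_q,s_r\rangle$, $\langle s_q,s_r,f\rangle$, $\langle s_q,a,s_r,f\rangle$ with $s_q\in S_q$, $s_r\in S_r$, $f$ an $r$-local strategy from $s_r$, $a\in\Sigma^{sys}_q$; the initial $q$-state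 is $\langle(s_{in})_q,(s_{in})_r\rangle$. Transitions: (1) $\langle s_q,s_r\rangle\xrightarrow{\mathrm{ch}(f)}\langle s_q,s_r,f\rangle$; (2) $\langle s_q,s_r,f\rangle\xrightarrow{\mathrm{ch}(a)}\langle s_q,a,s_r,f\rangle$ for $a\in\Sigma^{sys}_q$; (3) $\langle s_q,a,s_r,f\rangle\xrightarrow{a}\langle s'_q,s_r,f\rangle$ if $s_q\xrightarrow{a}s'_q$ in $\mathcal{A}_q$; (4) $\langle s_q,a,s_r,f\rangle\xrightarrow{b}\langle s'_q,s_r,f\rangle$ for $b\in\Sigma^{env}\cap\Sigma^{loc}_q$ with $s_q\xrightarrow{b}s'_q$; (5) $\langle s_q,a,s_r,f\rangle\xrightarrow{b}\langle s_q,a,s'_r,f_{|b}\rangle$ for $b\in\Sigma^{loc}_r$ allowed by $f$ with $s_r\xrightarrow{b}s'_r$; (6) $\langle s_q,a,s_r,f\rangle\xrightarrow{b}\langle s'_q,s'_r\rangle$ for $b\in\Sigma_q\cap\Sigma_r$ with $(s_q,s_r)\xrightarrow{b}(s'_q,s'_r)$ in $\mathcal{A}$; (7) $(s_p,\langle s_q,a,s_r,f\rangle)\xrightarrow{b}(s'_p,\langle s'_q,s_r,f\rangle)$ for $\mathrm{dom}(b)=\{p,q\}$, $p\ne r$, $(s_p,s_q)\xrightarrow{b}(s'_p,s'_q)$ in $\mathcal{A}$. Transitions (3),(4),(6),(7) induce transitions $(s_q,b,s'_q)$ of $\mathcal{A}_q$ and (5),(6) induce transitions $(s_r,b,s'_r)$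 of $\mathcal{A}_r$. Correctness for $q$ in $\overline{\mathcal{A}}$: an infinite $q$-run is correct iff its projection on $\mathcal{A}_q$-transitions satisfies $\mathit{Corr}_q$ and either (i) its projection on $\mathcal{A}_r$-transitions is infinite and satisfies $\mathit{Corr}_r$, or (ii) that projection is finite and, for the $s_r,f$ occurring in almost all $q$-states of the run, every maximal sequence of local $r$-actions from $s_r$ respecting $f$ ends in a state of $T_r$; a finite $q$-run is correct iff it ends in a state $\langle s_q,a,s_r,f\rangle$ with $s_q\in T_q$ and $s_r\in T_r$.
   Formalization: The direction from A to the reduced automaton assumes that at each q-state some controllable q-action is disabled. The size is exponential in |A_r| plus the number of r-local runs, or in |A_r| alone when the bound N on local runs is fixed; the literal claims are false. *)

theory Defs
  imports
    "HOL-Library.FuncSet"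
    "HOL-Library.Infinite_Set"
    "HOL-Library.Omega_Words_Fun"
    "HOL-Computational_Algebra.Polynomial"
begin

section \<open>Finite and infinite words\<close>

datatype 'a iword = Fin "'a list" | Inf "'a word"

fun conc_iword :: "'a list \<Rightarrow> 'a iword \<Rightarrow> 'a iword" where
  "conc_iword u (Fin v) = Fin (u @ v)"
| "conc_iword u (Inf v) = Inf (u \<frown> v)"

fun filter_iword :: "('a \<Rightarrow> bool) \<Rightarrow> 'a iword \<Rightarrow> 'a iword" where
  "filter_iword P (Fin u) = Fin (filter P u)"
| "filter_iword P (Inf w) =
     (let I = {i. P (w i)} in
      if infinite I then Inf (\<lambda>n. w (enumerate I n))
      else Fin (map w (sorted_list_of_set I)))"

text \<open>Languages of Buechi automata over the alphabet \<open>X\<close>; every finite state set embeds in \<open>nat\<close>.\<close>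

definition omega_regular :: "'b set \<Rightarrow> 'b word set \<Rightarrow> bool" where
  "omega_regular X L \<longleftrightarrow>
     (\<exists>(Q :: nat set) I \<Delta> F. finite Q \<and> I \<subseteq> Q \<and> F \<subseteq> Q \<and> \<Delta> \<subseteq> Q \<times> X \<times> Q \<and>
        L = {w. \<exists>\<rho>. \<rho> 0 \<in> I \<and> (\<forall>i. (\<rho> i, w i, \<rho> (Suc i)) \<in> \<Delta>) \<and> (\<exists>\<^sub>\<infinity>i. \<rho> i \<in> F)})"


section \<open>Distributed alphabets\<close>

record ('p, 'a) alphabet =
  procs :: "'p set"
  acts :: "'a set"
  adom :: "'a \<Rightarrow> 'p set"
  sys :: "'a set"

definition env :: "('p, 'a) alphabet \<Rightarrow> 'a set" where
  "env D = acts D - sys D"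

definition acts_of :: "('p, 'a) alphabet \<Rightarrow> 'p \<Rightarrow> 'a set" where
  "acts_of D p = {a \<in> acts D. p \<in> adom D a}"

definition loc_acts :: "('p, 'a) alphabet \<Rightarrow> 'p \<Rightarrow> 'a set" where
  "loc_acts D p = {a \<in> acts D. adom D a = {p}}"

definition dist_alphabet :: "('p, 'a) alphabet \<Rightarrow> bool" where
  "dist_alphabet D \<longleftrightarrow> finite (procs D) \<and> finite (acts D) \<and> sys D \<subseteq> acts D \<and>
     (\<forall>a\<in>acts D. adom D a \<subseteq> procs D \<and> adom D a \<noteq> {})"

definition comm_edge :: "('p, 'a) alphabet \<Rightarrow> 'p \<Rightarrow> 'p \<Rightarrow> bool" where
  "comm_edge D p p' \<longleftrightarrow> p \<in> procs D \<and> p' \<in> procs D \<and> p \<noteq> p' \<and> (\<exists>a\<in>acts D. {p, p'} \<subseteq> adom D a)"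

definition acyclic_comm :: "('p, 'a) alphabet \<Rightarrow> bool" where
  "acyclic_comm D \<longleftrightarrow>
     \<not> (\<exists>ps. length ps \<ge> 3 \<and> distinct ps \<and>
          (\<forall>i<length ps. comm_edge D (ps ! i) (ps ! (Suc i mod length ps))))"

definition leaf_with_neighbour :: "('p, 'a) alphabet \<Rightarrow> 'p \<Rightarrow> 'p \<Rightarrow> bool" where
  "leaf_with_neighbour D r q \<longleftrightarrow> r \<in> procs D \<and> {p. comm_edge D r p} = {q}"


section \<open>Zielonka automata\<close>

text \<open>
  A tuple indexed by a set \<open>X\<close> of processes is a function that is extensional on \<open>X\<close>
  (an element of a \<open>PiE\<close>). The partial function of an action is given by its graph.
\<close>

record ('p, 'a, 's) zautomaton =
  st :: "'p \<Rightarrow> 's set"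
  init_st :: "'p \<Rightarrow> 's"
  delta :: "'a \<Rightarrow> (('p \<Rightarrow> 's) \<times> ('p \<Rightarrow> 's)) set"

definition zielonka :: "('p, 'a) alphabet \<Rightarrow> ('p, 'a, 's) zautomaton \<Rightarrow> bool" where
  "zielonka D A \<longleftrightarrow>
     (\<forall>p\<in>procs D. finite (st A p)) \<and>
     init_st A \<in> (\<Pi>\<^sub>E p\<in>procs D. st A p) \<and>
     (\<forall>a\<in>acts D. delta A a \<subseteq> (\<Pi>\<^sub>E p\<in>adom D a. st A p) \<times> (\<Pi>\<^sub>E p\<in>adom D a. st A p) \<and>
                  single_valued (delta A a))"

definition tup1 :: "'p \<Rightarrow> 's \<Rightarrow> 'p \<Rightarrow> 's" where
  "tup1 p s = (\<lambda>x\<in>{p}. s)"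

definition tup2 :: "'p \<Rightarrow> 's \<Rightarrow> 'p \<Rightarrow> 's \<Rightarrow> 'p \<Rightarrow> 's" where
  "tup2 p s p' s' = (\<lambda>x\<in>{p, p'}. if x = p then s else s')"

definition gtrans ::
    "('p, 'a) alphabet \<Rightarrow> ('p, 'a, 's) zautomaton \<Rightarrow> ('p \<Rightarrow> 's) \<Rightarrow> 'a \<Rightarrow> ('p \<Rightarrow> 's) \<Rightarrow> bool" where
  "gtrans D A s a s' \<longleftrightarrow> a \<in> acts D \<and>
     (restrict s (adom D a), restrict s' (adom D a)) \<in> delta A a \<and>
     (\<forall>p. p \<notin> adom D a \<longrightarrow> s' p = s p)"

fun gpath :: "('p, 'a) alphabet \<Rightarrow> ('p, 'a, 's) zautomaton \<Rightarrow> ('p \<Rightarrow> 's) \<Rightarrow>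
    (('p \<Rightarrow> 's) \<times> 'a \<times> ('p \<Rightarrow> 's)) list \<Rightarrow> bool" where
  "gpath D A s [] \<longleftrightarrow> True"
| "gpath D A s ((t, a, t') # \<rho>) \<longleftrightarrow> t = s \<and> gtrans D A t a t' \<and> gpath D A t' \<rho>"

fun is_gpath :: "('p, 'a) alphabet \<Rightarrow> ('p, 'a, 's) zautomaton \<Rightarrow>
    (('p \<Rightarrow> 's) \<times> 'a \<times> ('p \<Rightarrow> 's)) iword \<Rightarrow> bool" where
  "is_gpath D A (Fin \<rho>) \<longleftrightarrow> gpath D A (init_st A) \<rho>"
| "is_gpath D A (Inf \<rho>) \<longleftrightarrow> (\<forall>n. gpath D A (init_st A) (prefix n \<rho>))"

definition is_run :: "('p, 'a) alphabet \<Rightarrow> ('p, 'a, 's) zautomaton \<Rightarrow> 'a iword \<Rightarrow>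
    (('p \<Rightarrow> 's) \<times> 'a \<times> ('p \<Rightarrow> 's)) iword \<Rightarrow> bool" where
  "is_run D A w \<rho> \<longleftrightarrow> map_iword (\<lambda>(s, a, s'). a) \<rho> = w \<and> is_gpath D A \<rho>"

definition run_defined :: "('p, 'a) alphabet \<Rightarrow> ('p, 'a, 's) zautomaton \<Rightarrow> 'a iword \<Rightarrow> bool" where
  "run_defined D A w \<longleftrightarrow> (\<exists>\<rho>. is_run D A w \<rho>)"

definition maximal :: "('p, 'a) alphabet \<Rightarrow> ('p, 'a, 's) zautomaton \<Rightarrow> 'a iword \<Rightarrow> bool" where
  "maximal D A w \<longleftrightarrow> run_defined D A w \<and>
     \<not> (\<exists>u v a. w = conc_iword u v \<and> a \<in> acts D \<and>
          (\<forall>b\<in>set_iword v. adom D a \<inter> adom D b = {}) \<and>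
          run_defined D A (conc_iword u (conc_iword [a] v)))"

definition proj :: "('p, 'a) alphabet \<Rightarrow> 'p \<Rightarrow>
    (('p \<Rightarrow> 's) \<times> 'a \<times> ('p \<Rightarrow> 's)) iword \<Rightarrow> ('s \<times> 'a \<times> 's) iword" where
  "proj D p \<rho> = map_iword (\<lambda>(s, a, s'). (s p, a, s' p)) (filter_iword (\<lambda>(s, a, s'). p \<in> adom D a) \<rho>)"


section \<open>Correctness conditions and covering controllers\<close>

record ('p, 'a, 's) condition =
  fin_ok :: "'p \<Rightarrow> 's set"
  inf_ok :: "'p \<Rightarrow> ('s \<times> 'a \<times> 's) word set"

definition local_omega_regular ::
    "('p, 'a) alphabet \<Rightarrow> ('p, 'a, 's) zautomaton \<Rightarrow> ('p, 'a, 's) condition \<Rightarrow> bool" where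
  "local_omega_regular D A K \<longleftrightarrow>
     (\<forall>p\<in>procs D. fin_ok K p \<subseteq> st A p \<and>
        omega_regular (st A p \<times> acts_of D p \<times> st A p) (inf_ok K p))"

fun satisfies_corr :: "('p, 'a, 's) zautomaton \<Rightarrow> ('p, 'a, 's) condition \<Rightarrow> 'p \<Rightarrow>
    ('s \<times> 'a \<times> 's) iword \<Rightarrow> bool" where
  "satisfies_corr A K p (Fin u) \<longleftrightarrow> (if u = [] then init_st A p else snd (snd (last u))) \<in> fin_ok K p"
| "satisfies_corr A K p (Inf w) \<longleftrightarrow> w \<in> inf_ok K p"

definition covering :: "('p, 'a) alphabet \<Rightarrow> ('p, 'a, 's) zautomaton \<Rightarrow>
    ('p, 'a, 'c) zautomaton \<Rightarrow> ('p \<Rightarrow> 'c \<Rightarrow> 's) \<Rightarrow> bool" where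
  "covering D A C \<pi> \<longleftrightarrow> zielonka D C \<and>
     (\<forall>p\<in>procs D. \<pi> p \<in> st C p \<rightarrow> st A p \<and> \<pi> p (init_st C p) = init_st A p) \<and>
     (\<forall>a\<in>acts D. \<forall>(c, c')\<in>delta C a.
        ((\<lambda>p\<in>adom D a. \<pi> p (c p)), (\<lambda>p\<in>adom D a. \<pi> p (c' p))) \<in> delta A a) \<and>
     (\<forall>a\<in>env D. \<forall>c\<in>(\<Pi>\<^sub>E p\<in>adom D a. st C p).
        (\<lambda>p\<in>adom D a. \<pi> p (c p)) \<in> Domain (delta A a) \<longrightarrow> c \<in> Domain (delta C a))"

definition correct_covering :: "('p, 'a) alphabet \<Rightarrow> ('p, 'a, 's) zautomaton \<Rightarrow>
    ('p, 'a, 's) condition \<Rightarrow> ('p, 'a, 'c) zautomaton \<Rightarrow> ('p \<Rightarrow> 'c \<Rightarrow> 's) \<Rightarrow> bool" where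
  "correct_covering D A K C \<pi> \<longleftrightarrow> covering D A C \<pi> \<and>
     (\<forall>w \<rho>. maximal D C w \<and> is_run D C w \<rho> \<longrightarrow>
        (\<forall>p\<in>procs D.
           satisfies_corr A K p (map_iword (\<lambda>(c, a, c'). (\<pi> p c, a, \<pi> p c')) (proj D p \<rho>))))"

text \<open>A controller has finite local state sets, so states of type \<open>nat\<close> are no restriction.\<close>

definition controllable :: "('p, 'a) alphabet \<Rightarrow> ('p, 'a, 's) zautomaton \<Rightarrow>
    ('p, 'a, 's) condition \<Rightarrow> bool" where
  "controllable D A K \<longleftrightarrow> (\<exists>(C :: ('p, 'a, nat) zautomaton) \<pi>. correct_covering D A K C \<pi>)"


section \<open>Local strategies\<close>

fun lpath :: "('p, 'a) alphabet \<Rightarrow> ('p, 'a, 's) zautomaton \<Rightarrow> 'p \<Rightarrow> 's \<Rightarrow> 'a list \<Rightarrow> 's \<Rightarrow> bool" where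
  "lpath D A p s [] s' \<longleftrightarrow> s' = s"
| "lpath D A p s (a # u) s' \<longleftrightarrow>
     a \<in> loc_acts D p \<and> (\<exists>t. (tup1 p s, tup1 p t) \<in> delta A a \<and> lpath D A p t u s')"

definition local_runs :: "('p, 'a) alphabet \<Rightarrow> ('p, 'a, 's) zautomaton \<Rightarrow> 'p \<Rightarrow> ('s \<times> 'a list) set" where
  "local_runs D A p = {(s, u). s \<in> st A p \<and> (\<exists>s'. lpath D A p s u s')}"

definition short_by :: "nat \<Rightarrow> ('p, 'a) alphabet \<Rightarrow> ('p, 'a, 's) zautomaton \<Rightarrow> 'p \<Rightarrow> bool" where
  "short_by N D A r \<longleftrightarrow> (\<forall>(s, u)\<in>local_runs D A r. length u \<le> N)"

definition short :: "('p, 'a) alphabet \<Rightarrow> ('p, 'a, 's) zautomaton \<Rightarrow> 'p \<Rightarrow> bool" where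
  "short D A r \<longleftrightarrow> (\<exists>N. short_by N D A r)"

type_synonym 'a strategy = "'a list \<Rightarrow> 'a option"

definition local_strategy :: "('p, 'a) alphabet \<Rightarrow> ('p, 'a, 's) zautomaton \<Rightarrow> 'p \<Rightarrow> 's \<Rightarrow> 'a strategy \<Rightarrow> bool" where
  "local_strategy D A r s f \<longleftrightarrow>
     (\<forall>v a. f v = Some a \<longrightarrow>
        v \<in> lists (loc_acts D r) \<and> a \<in> sys D \<inter> acts_of D r \<and> (\<exists>s'. lpath D A r s (v @ [a]) s'))"

definition allowed :: "('p, 'a) alphabet \<Rightarrow> 'p \<Rightarrow> 'a strategy \<Rightarrow> 'a \<Rightarrow> bool" where
  "allowed D r f a \<longleftrightarrow> a \<in> loc_acts D r \<and> (f [] = Some a \<or> a \<in> env D)"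

definition residual :: "'a strategy \<Rightarrow> 'a \<Rightarrow> 'a strategy" where
  "residual f a = (\<lambda>v. f (a # v))"

fun follows :: "('p, 'a) alphabet \<Rightarrow> ('p, 'a, 's) zautomaton \<Rightarrow> 'p \<Rightarrow> 's \<Rightarrow> 'a strategy \<Rightarrow> 'a list \<Rightarrow> 's \<Rightarrow> bool" where
  "follows D A r s f [] s' \<longleftrightarrow> s' = s"
| "follows D A r s f (a # u) s' \<longleftrightarrow>
     allowed D r f a \<and>
     (\<exists>t. (tup1 r s, tup1 r t) \<in> delta A a \<and> follows D A r t (residual f a) u s')"

definition maximal_respecting ::
    "('p, 'a) alphabet \<Rightarrow> ('p, 'a, 's) zautomaton \<Rightarrow> 'p \<Rightarrow> 's \<Rightarrow> 'a strategy \<Rightarrow> 'a list \<Rightarrow> 's \<Rightarrow> bool" where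
  "maximal_respecting D A r s f u s' \<longleftrightarrow>
     follows D A r s f u s' \<and> \<not> (\<exists>a s''. follows D A r s f (u @ [a]) s'')"


section \<open>The reduced automaton\<close>

datatype 'a raction = Act (act_of: 'a) | ChF "'a strategy" | ChA 'a

text \<open>\<open>Other s\<close> is a state of a process different from \<open>q\<close>; the other three constructors are the
  three kinds of \<open>q\<close>-states.\<close>

datatype ('a, 's) rstate =
    Other 's
  | QR (q_of: 's) (r_of: 's)
  | QRF (q_of: 's) (r_of: 's) "'a strategy"
  | QARF (q_of: 's) 'a (r_of: 's) "'a strategy"

definition red_alphabet :: "('p, 'a) alphabet \<Rightarrow> ('p, 'a, 's) zautomaton \<Rightarrow> 'p \<Rightarrow> 'p \<Rightarrow>
    ('p, 'a raction) alphabet" where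
  "red_alphabet D A r q =
     \<lparr> procs = procs D - {r},
       acts = Act ` acts D \<union> ChF ` {f. \<exists>s\<in>st A r. local_strategy D A r s f}
                \<union> ChA ` (sys D \<inter> acts_of D q),
       adom = (\<lambda>x. case x of Act a \<Rightarrow> (\<lambda>p. if p = r then q else p) ` adom D a
                     | ChF f \<Rightarrow> {q} | ChA a \<Rightarrow> {q}),
       sys = Act ` (sys D - (acts_of D q \<union> acts_of D r))
               \<union> ChF ` {f. \<exists>s\<in>st A r. local_strategy D A r s f}
               \<union> ChA ` (sys D \<inter> acts_of D q) \<rparr>"

definition red_qstates :: "('p, 'a) alphabet \<Rightarrow> ('p, 'a, 's) zautomaton \<Rightarrow> 'p \<Rightarrow> 'p \<Rightarrow> ('a, 's) rstate set" where
  "red_qstates D A r q =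
     {QR sq sr | sq sr. sq \<in> st A q \<and> sr \<in> st A r} \<union>
     {QRF sq sr f | sq sr f. sq \<in> st A q \<and> sr \<in> st A r \<and> local_strategy D A r sr f} \<union>
     {QARF sq a sr f | sq a sr f. sq \<in> st A q \<and> a \<in> sys D \<inter> acts_of D q \<and>
        sr \<in> st A r \<and> local_strategy D A r sr f}"

inductive red_trans :: "('p, 'a) alphabet \<Rightarrow> ('p, 'a, 's) zautomaton \<Rightarrow> 'p \<Rightarrow> 'p \<Rightarrow> 'a raction \<Rightarrow>
    ('p \<Rightarrow> ('a, 's) rstate) \<Rightarrow> ('p \<Rightarrow> ('a, 's) rstate) \<Rightarrow> bool"
  for D A r q where
  other: "\<lbrakk>b \<in> acts D; q \<notin> adom D b; r \<notin> adom D b; (t, t') \<in> delta A b\<rbrakk> \<Longrightarrow>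
     red_trans D A r q (Act b) (\<lambda>p\<in>adom D b. Other (t p)) (\<lambda>p\<in>adom D b. Other (t' p))"
| choose_strategy: "\<lbrakk>QR sq sr \<in> red_qstates D A r q; local_strategy D A r sr f\<rbrakk> \<Longrightarrow>
     red_trans D A r q (ChF f) (tup1 q (QR sq sr)) (tup1 q (QRF sq sr f))"
| choose_action: "\<lbrakk>QRF sq sr f \<in> red_qstates D A r q; a \<in> sys D \<inter> acts_of D q\<rbrakk> \<Longrightarrow>
     red_trans D A r q (ChA a) (tup1 q (QRF sq sr f)) (tup1 q (QARF sq a sr f))"
| q_sys: "\<lbrakk>QARF sq a sr f \<in> red_qstates D A r q; (tup1 q sq, tup1 q sq') \<in> delta A a\<rbrakk> \<Longrightarrow>
     red_trans D A r q (Act a) (tup1 q (QARF sq a sr f)) (tup1 q (QRF sq' sr f))"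
| q_env: "\<lbrakk>QARF sq a sr f \<in> red_qstates D A r q; b \<in> env D \<inter> loc_acts D q;
           (tup1 q sq, tup1 q sq') \<in> delta A b\<rbrakk> \<Longrightarrow>
     red_trans D A r q (Act b) (tup1 q (QARF sq a sr f)) (tup1 q (QRF sq' sr f))"
| r_local: "\<lbrakk>QARF sq a sr f \<in> red_qstates D A r q; b \<in> loc_acts D r; allowed D r f b;
             (tup1 r sr, tup1 r sr') \<in> delta A b\<rbrakk> \<Longrightarrow>
     red_trans D A r q (Act b) (tup1 q (QARF sq a sr f)) (tup1 q (QARF sq a sr' (residual f b)))"
| q_with_r: "\<lbrakk>QARF sq a sr f \<in> red_qstates D A r q; b \<in> acts_of D q \<inter> acts_of D r;
              (tup2 q sq r sr, tup2 q sq' r sr') \<in> delta A b\<rbrakk> \<Longrightarrow>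
     red_trans D A r q (Act b) (tup1 q (QARF sq a sr f)) (tup1 q (QR sq' sr'))"
| q_with_p: "\<lbrakk>QARF sq a sr f \<in> red_qstates D A r q; b \<in> acts D; adom D b = {p, q}; p \<noteq> q; p \<noteq> r;
              (tup2 p sp q sq, tup2 p sp' q sq') \<in> delta A b\<rbrakk> \<Longrightarrow>
     red_trans D A r q (Act b) (tup2 p (Other sp) q (QARF sq a sr f))
                               (tup2 p (Other sp') q (QRF sq' sr f))"

definition red_automaton :: "('p, 'a) alphabet \<Rightarrow> ('p, 'a, 's) zautomaton \<Rightarrow> 'p \<Rightarrow> 'p \<Rightarrow>
    ('p, 'a raction, ('a, 's) rstate) zautomaton" where
  "red_automaton D A r q =
     \<lparr> st = (\<lambda>p. if p = q then red_qstates D A r q else Other ` st A p),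
       init_st = (\<lambda>p\<in>procs D - {r}. if p = q then QR (init_st A q) (init_st A r) else Other (init_st A p)),
       delta = (\<lambda>x. {(t, t'). red_trans D A r q x t t'}) \<rparr>"

text \<open>
  The projections of a \<open>q\<close>-run on transitions of the original processes \<open>q\<close> and \<open>r\<close>: a transition
  of the reduced automaton induces one of \<open>p\<close> iff \<open>p\<close> is in the original domain of its action.
\<close>

definition red_proj :: "('p, 'a) alphabet \<Rightarrow> 'p \<Rightarrow> (('a, 's) rstate \<Rightarrow> 's) \<Rightarrow>
    (('a, 's) rstate \<times> 'a raction \<times> ('a, 's) rstate) word \<Rightarrow> ('s \<times> 'a \<times> 's) iword" where
  "red_proj D p sel w =
     map_iword (\<lambda>(x, b, x'). (sel x, act_of b, sel x'))
       (filter_iword (\<lambda>(x, b, x'). \<exists>a\<in>acts_of D p. b = Act a) (Inf w))"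

definition red_qomega :: "('p, 'a) alphabet \<Rightarrow> ('p, 'a, 's) zautomaton \<Rightarrow> ('p, 'a, 's) condition \<Rightarrow>
    'p \<Rightarrow> 'p \<Rightarrow> (('a, 's) rstate \<times> 'a raction \<times> ('a, 's) rstate) word set" where
  "red_qomega D A K r q =
     {w. range w \<subseteq> red_qstates D A r q \<times> acts_of (red_alphabet D A r q) q \<times> red_qstates D A r q \<and>
         satisfies_corr A K q (red_proj D q q_of w) \<and>
         (case red_proj D r r_of w of
            Inf v \<Rightarrow> v \<in> inf_ok K r
          | Fin v \<Rightarrow> (\<exists>sr f.
              (\<forall>\<^sub>\<infinity>i. \<exists>sq. fst (w i) = QRF sq sr f \<or> (\<exists>a. fst (w i) = QARF sq a sr f)) \<and>
              (\<forall>u s'. maximal_respecting D A r sr f u s' \<longrightarrow> s' \<in> fin_ok K r)))}"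

definition red_condition :: "('p, 'a) alphabet \<Rightarrow> ('p, 'a, 's) zautomaton \<Rightarrow> ('p, 'a, 's) condition \<Rightarrow>
    'p \<Rightarrow> 'p \<Rightarrow> ('p, 'a raction, ('a, 's) rstate) condition" where
  "red_condition D A K r q =
     \<lparr> fin_ok = (\<lambda>p. if p = q
          then {QARF sq a sr f | sq a sr f. QARF sq a sr f \<in> red_qstates D A r q \<and>
                  sq \<in> fin_ok K q \<and> sr \<in> fin_ok K r}
          else Other ` fin_ok K p),
       inf_ok = (\<lambda>p. if p = q then red_qomega D A K r q
          else (\<lambda>w i. case w i of (s, a, s') \<Rightarrow> (Other s, Act a, Other s')) ` inf_ok K p) \<rparr>"


section \<open>Setting of the reduction\<close>

definition reduction_setting :: "('p, 'a) alphabet \<Rightarrow> ('p, 'a, 's) zautomaton \<Rightarrow>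
    ('p, 'a, 's) condition \<Rightarrow> 'p \<Rightarrow> 'p \<Rightarrow> bool" where
  "reduction_setting D A K r q \<longleftrightarrow>
     dist_alphabet D \<and> acyclic_comm D \<and> leaf_with_neighbour D r q \<and>
     (\<forall>a\<in>acts D. card (adom D a) \<le> 2) \<and>
     (\<forall>p\<in>procs D. \<exists>a\<in>sys D. p \<in> adom D a) \<and>
     (\<forall>a\<in>sys D. \<exists>p. adom D a = {p}) \<and>
     zielonka D A \<and> local_omega_regular D A K \<and> short D A r"

text \<open>
  In the reduced automaton \<open>q\<close> has to announce some controllable action \<open>a\<close>, which then belongs to
  the environment; a process \<open>q\<close> that wants to do nothing can only announce a disabled action.
\<close>

definition can_idle :: "('p, 'a) alphabet \<Rightarrow> ('p, 'a, 's) zautomaton \<Rightarrow> 'p \<Rightarrow> bool" where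
  "can_idle D A q \<longleftrightarrow>
     (\<forall>s\<in>st A q. \<exists>a\<in>sys D \<inter> acts_of D q. tup1 q s \<notin> Domain (delta A a))"

text \<open>
  Number of local states, of actions and of local projections of transitions of process \<open>p\<close>. It does
  not bound the number of \<open>local_runs\<close>, on which strategies are defined: different words can lead to
  the same state.
\<close>

definition comp_size :: "('p, 'a) alphabet \<Rightarrow> ('p, 'a, 's) zautomaton \<Rightarrow> 'p \<Rightarrow> nat" where
  "comp_size D A p = card (st A p) + card (acts_of D p) +
     card {(t p, a, t' p) | t a t'. a \<in> acts_of D p \<and> (t, t') \<in> delta A a}"

end

theory Submission
  imports Defs
begin

text \<open>
  Runs, finite or infinite, are handled as concatenations of infinitely many finite blocks; a block may
  be empty, so steps can be erased, inserted and delayed by working on the blocks. Maximality becomes a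
  fairness condition: an action enabled at some block boundary is later touched by a dependent action.

  A controller of the original automaton yields one of the reduced automaton in which \<open>q\<close> carries the
  states of \<open>q\<close> and \<open>r\<close> and announces what the controller would do. Erasing the announcements maps its
  runs back. If \<open>q\<close> acts for ever while \<open>r\<close> stops, the erased run need not be maximal, but inserting any
  maximal sequence of local moves of \<open>r\<close> that respects the announced strategy makes it maximal.

  Conversely, \<open>q\<close> simulates the controller of the reduced automaton as if \<open>r\<close> had not moved since their
  last synchronisation, while \<open>r\<close> follows the strategy announced then and hands over its recorded moves
  at the next one. A run with finitely many moves of \<open>q\<close> is completed by inserting the recorded moves at
  the end; if \<open>q\<close> moves for ever without \<open>r\<close>, the condition on maximal local sequences applies.
\<close>

section \<open>Infinite concatenations of finite words\<close>

text \<open>Enabledness does not transfer action by action from the given controller to the reduced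
  one. A controller may offer several controllable actions, while a strategy or an announcement
  names one; what transfers is the presence of some enabled action with the same domain, and this is
  enough because fairness looks at domains only. The announced action is uncontrollable in the
  reduced automaton, so a controller that offers \<open>q\<close> nothing has to announce an action
  that is disabled; this is the purpose of \<open>can_idle\<close>.

  A second obstacle is that moves of \<open>r\<close> are charged to \<open>q\<close> in the reduced
  automaton, so activity of the reduced \<open>q\<close> need not mean activity of the original
  \<open>q\<close>. Shortness settles this: without \<open>q\<close> only boundedly many moves of
  \<open>r\<close> and announcements are possible. Shortness also bounds the record kept by
  \<open>r\<close> in the converse construction, hence keeps its state set finite.

  In that construction \<open>q\<close> makes its announcements at once. They cannot be refused: a
  \<open>q\<close> blocked before announcing would end some maximal run in a state that is not
  accepting.\<close>

definition concats :: "(nat \<Rightarrow> 'b list) \<Rightarrow> nat \<Rightarrow> 'b list" where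
  "concats u n = concat (map u [0..<n])"

lemma concats_0 [simp]: "concats u 0 = []"
  by (simp add: concats_def)

lemma concats_Suc [simp]: "concats u (Suc n) = concats u n @ u n"
  by (simp add: concats_def)

lemma concats_le: "m \<le> n \<Longrightarrow> \<exists>v. concats u n = concats u m @ v"
  by (induction rule: dec_induct) auto

lemma concats_cong: "(\<And>i. i < n \<Longrightarrow> u i = u' i) \<Longrightarrow> concats u n = concats u' n"
  by (induction n) auto

lemma concats_map: "concats (\<lambda>i. map f (u i)) n = map f (concats u n)"
  by (induction n) auto

lemma concats_filter: "concats (\<lambda>i. filter P (u i)) n = filter P (concats u n)"
  by (induction n) auto

lemma concats_add: "concats u (m + n) = concats u m @ concats (\<lambda>i. u (i + m)) n"
  by (induction n) (auto simp: add.commute)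

lemma concats_const: "(\<And>i. i \<ge> m \<Longrightarrow> u i = []) \<Longrightarrow> m \<le> n \<Longrightarrow> concats u n = concats u m"
  by (rotate_tac 1, induction rule: dec_induct) auto

text \<open>Finite and infinite words are compared through their sets of finite prefixes. This
  avoids a case split on the two constructors wherever an operation on words acts block by
  block.\<close>

definition iprefixes :: "'b iword \<Rightarrow> 'b list set" where
  "iprefixes W = {x. \<exists>v. W = conc_iword x v}"

lemma iprefixes_Fin: "x \<in> iprefixes (Fin w) \<longleftrightarrow> (\<exists>v. w = x @ v)"
proof
  assume "x \<in> iprefixes (Fin w)"
  then obtain v where "Fin w = conc_iword x v" by (auto simp: iprefixes_def)
  then show "\<exists>v. w = x @ v" by (cases v) auto
next
  assume "\<exists>v. w = x @ v"
  then obtain v where "w = x @ v" by blast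
  then have "Fin w = conc_iword x (Fin v)" by simp
  then show "x \<in> iprefixes (Fin w)" unfolding iprefixes_def by blast
qed

lemma iprefixes_Inf: "x \<in> iprefixes (Inf w) \<longleftrightarrow> x = map w [0..<length x]"
proof
  assume "x \<in> iprefixes (Inf w)"
  then obtain v where "Inf w = conc_iword x v" by (auto simp: iprefixes_def)
  then obtain v' where "w = x \<frown> v'" by (cases v) auto
  then show "x = map w [0..<length x]" by (intro nth_equalityI) auto
next
  assume x: "x = map w [0..<length x]"
  then have "x ! n = w n" if "n < length x" for n
    using that by (metis add_0 nth_map_upt diff_zero)
  then have "w = x \<frown> (\<lambda>n. w (n + length x))"
    by (auto simp: conc_def)
  then have "Inf w = conc_iword x (Inf (\<lambda>n. w (n + length x)))" by simp
  then show "x \<in> iprefixes (Inf w)" unfolding iprefixes_def by blast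
qed

lemma iprefixes_append: "x @ y \<in> iprefixes W \<Longrightarrow> x \<in> iprefixes W"
proof -
  assume "x @ y \<in> iprefixes W"
  then obtain v where "W = conc_iword (x @ y) v" by (auto simp: iprefixes_def)
  then have "W = conc_iword x (conc_iword y v)" by (cases v) auto
  then show ?thesis by (auto simp: iprefixes_def)
qed

text \<open>A finite word is the longest of its prefixes, and the letter at position
  \<open>k\<close> of an infinite word can be read off its prefix of length
  \<open>k + 1\<close>.\<close>

lemma iprefixes_inject: assumes "iprefixes W = iprefixes W'" shows "W = W'"
proof -
  have FI: False if "iprefixes (Fin x) = iprefixes (Inf w)" for x :: "'a list" and w
  proof -
    \<comment> \<open>A prefix one letter longer than \<open>x\<close> separates the infinite word
      from \<open>Fin x\<close>.\<close>
    have "map w [0..<Suc (length x)] \<in> iprefixes (Inf w)" by (simp add: iprefixes_Inf del: upt_Suc)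
    then have "map w [0..<Suc (length x)] \<in> iprefixes (Fin x)" using that by simp
    then obtain v where "x = map w [0..<Suc (length x)] @ v" unfolding iprefixes_Fin by blast
    then have "length x = Suc (length x) + length v"
      by (metis length_append length_map length_upt minus_nat.diff_0)
    then show False by simp
  qed
  show ?thesis
  proof (cases W)
    case (Fin x)
    note F = this
    show ?thesis
    proof (cases W')
      case (Fin y)
      have "x \<in> iprefixes W" "y \<in> iprefixes W'" using F Fin by (auto simp: iprefixes_Fin)
      with assms F Fin have "x \<in> iprefixes (Fin y)" "y \<in> iprefixes (Fin x)" by auto
      then show ?thesis using F Fin by (auto simp: iprefixes_Fin)
    qed (use F FI assms in metis)
  next
    case (Inf w)
    note I = this
    show ?thesis
    proof (cases W')
      case (Inf w')
      have "w k = w' k" for k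
      proof -
        have "map w [0..<Suc k] \<in> iprefixes (Inf w)" by (simp add: iprefixes_Inf del: upt_Suc)
        with assms I Inf have "map w [0..<Suc k] = map w' [0..<Suc k]"
          by (simp add: iprefixes_Inf del: upt_Suc)
        then show ?thesis by simp
      qed
      then show ?thesis using I Inf by auto
    qed (use I FI assms in metis)
  qed
qed

text \<open>If almost all blocks are empty, some \<open>concats u n\<close> is the limit. Otherwise
  the lengths are unbounded, and the letter at position \<open>k\<close> is taken from a
  concatenation that is long enough.\<close>

lemma ex_limit: "\<exists>W. iprefixes W = {x. \<exists>n v. concats u n = x @ v}"
proof (cases "\<exists>n. \<forall>m\<ge>n. u m = []")
  case True
  then obtain n where n: "\<forall>m\<ge>n. u m = []" by blast
  have "\<exists>v. concats u n = x @ v" if "concats u m = x @ v" for m x v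
  proof (cases "m \<le> n")
    case True then show ?thesis using concats_le[of m n u] that by auto
  next
    case False then show ?thesis using concats_const[of n u m] n that by (metis nat_le_linear)
  qed
  then have "iprefixes (Fin (concats u n)) = {x. \<exists>n v. concats u n = x @ v}" by (auto simp: iprefixes_Fin)
  then show ?thesis by blast
next
  case False
  have "\<exists>n. k \<le> length (concats u n)" for k
  proof (induction k)
    case (Suc k)
    then obtain n where n: "k \<le> length (concats u n)" by blast
    from False obtain m where m: "m \<ge> n" "u m \<noteq> []" by blast
    obtain v where "concats u m = concats u n @ v" using concats_le m by blast
    then have "length (concats u (Suc m)) \<ge> length (concats u n) + 1"
      using m by (simp add: Suc_leI trans_le_add2)
    with n show ?case by (intro exI[of _ "Suc m"]) linarith
  qed simp
  then have "\<exists>g. \<forall>k. Suc k \<le> length (concats u (g k))" by (intro choice) blast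
  then obtain g where g: "\<And>k. Suc k \<le> length (concats u (g k))" by blast
  \<comment> \<open>The choice of \<open>g k\<close> does not matter: any two of the concatenations
    are comparable as prefixes, so they agree wherever both are defined.\<close>
  define w where "w k = concats u (g k) ! k" for k
  have w: "concats u n ! k = w k" if "k < length (concats u n)" for n k
  proof (cases "n \<le> g k")
    case True
    then obtain v where "concats u (g k) = concats u n @ v" using concats_le by blast
    then show ?thesis using that by (simp add: w_def nth_append)
  next
    case False
    then obtain v where "concats u n = concats u (g k) @ v" using concats_le[of "g k" n u] by auto
    then show ?thesis using g[of k] by (simp add: w_def nth_append)
  qed
  have "(\<exists>n v. concats u n = x @ v) \<longleftrightarrow> x = map w [0..<length x]" for x
  proof
    assume "\<exists>n v. concats u n = x @ v"
    then obtain n v where "concats u n = x @ v" by blast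
    then have "x ! k = w k" if "k < length x" for k using w[of k n] that by (simp add: nth_append)
    then show "x = map w [0..<length x]" by (intro nth_equalityI) auto
  next
    assume x: "x = map w [0..<length x]"
    let ?n = "g (length x)"
    have l: "length x \<le> length (concats u ?n)" using g[of "length x"] by simp
    have "take (length x) (concats u ?n) = map w [0..<length x]"
      using l w by (intro nth_equalityI) auto
    then have "concats u ?n = x @ drop (length x) (concats u ?n)"
      using x append_take_drop_id by metis
    then show "\<exists>n v. concats u n = x @ v" by blast
  qed
  then have "iprefixes (Inf w) = {x. \<exists>n v. concats u n = x @ v}" by (auto simp: iprefixes_Inf)
  then show ?thesis by blast
qed

text \<open>The choice is determined: a limit exists by \<open>ex_limit\<close> and is unique by
  \<open>iprefixes_inject\<close>.\<close>

definition iconcat :: "(nat \<Rightarrow> 'b list) \<Rightarrow> 'b iword" where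
  "iconcat u = (SOME W. iprefixes W = {x. \<exists>n v. concats u n = x @ v})"

lemma iprefixes_iconcat: "x \<in> iprefixes (iconcat u) \<longleftrightarrow> (\<exists>n v. concats u n = x @ v)"
  unfolding iconcat_def using someI_ex[OF ex_limit[of u]] by auto

lemma iconcatI: "(\<And>x. x \<in> iprefixes W \<longleftrightarrow> (\<exists>n v. concats u n = x @ v)) \<Longrightarrow> W = iconcat u"
  by (rule iprefixes_inject) (auto simp: iprefixes_iconcat)

lemma concats_in_iprefixes: "concats u n \<in> iprefixes (iconcat u)"
  by (auto simp: iprefixes_iconcat)

text \<open>Cofinality: two block sequences have the same limit when each finite stage of one is
  overtaken by a stage of the other. It serves for projections of which one lags behind the
  other.\<close>

lemma iconcat_eqI:
  assumes "\<And>n. \<exists>m v. concats u' m = concats u n @ v" "\<And>n. \<exists>m v. concats u m = concats u' n @ v"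
  shows "iconcat u = iconcat u'"
proof (rule iconcatI)
  have *: "\<exists>n v. concats u2 n = x @ v" if "concats u1 n = x @ v" "\<And>n. \<exists>m v. concats u2 m = concats u1 n @ v"
    for u1 u2 :: "nat \<Rightarrow> 'a list" and x v n
    using that(2)[of n] by (auto simp: that(1))
  show "x \<in> iprefixes (iconcat u) \<longleftrightarrow> (\<exists>n v. concats u' n = x @ v)" for x
    unfolding iprefixes_iconcat using *[of u _ x _ u'] *[of u' _ x _ u] assms by blast
qed

lemma iconcat_Fin_iff: "iconcat u = Fin x \<longleftrightarrow> (\<exists>n. concats u n = x \<and> (\<forall>m\<ge>n. u m = []))"
proof
  assume F: "iconcat u = Fin x"
  then have "x \<in> iprefixes (iconcat u)" by (simp add: iprefixes_Fin)
  then obtain n v where n: "concats u n = x @ v" by (auto simp: iprefixes_iconcat)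
  have le: "\<exists>v. x = concats u m @ v" for m
    using concats_in_iprefixes[of u m] F by (simp add: iprefixes_Fin)
  from le[of n] n have v: "concats u n = x" by auto
  have "u m = []" if "m \<ge> n" for m
  proof -
    obtain w where w: "concats u m = concats u n @ w" using concats_le \<open>m \<ge> n\<close> by blast
    obtain w' where "x = concats u (Suc m) @ w'" using le by blast
    with w v show ?thesis by auto
  qed
  with v show "\<exists>n. concats u n = x \<and> (\<forall>m\<ge>n. u m = [])" by blast
next
  assume "\<exists>n. concats u n = x \<and> (\<forall>m\<ge>n. u m = [])"
  then obtain n where n: "concats u n = x" "\<forall>m\<ge>n. u m = []" by blast
  have "\<exists>v. x = y @ v" if "concats u m = y @ v" for m y v
  proof (cases "m \<le> n")
    case True then show ?thesis using concats_le[of m n u] that n by auto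
  next
    case False then show ?thesis using concats_const[of n u m] n that by auto
  qed
  then show "iconcat u = Fin x"
    using n by (intro iconcatI[symmetric]) (auto simp: iprefixes_Fin)
qed

lemma iconcat_Inf_iff: "(\<exists>w. iconcat u = Inf w) \<longleftrightarrow> (\<forall>n. \<exists>m\<ge>n. u m \<noteq> [])"
proof -
  have "(\<exists>w. iconcat u = Inf w) \<longleftrightarrow> \<not> (\<exists>x. iconcat u = Fin x)" by (cases "iconcat u") auto
  then show ?thesis by (auto simp: iconcat_Fin_iff)
qed

lemma iprefixes_map: "iprefixes (map_iword f W) = map f ` iprefixes W"
proof (cases W)
  case (Fin w)
  then show ?thesis
    unfolding Fin image_iff Bex_def iword.map set_eq_iff iprefixes_Fin map_eq_append_conv by blast
next
  case (Inf w)
  have "x \<in> map f ` iprefixes (Inf w)" if "x = map (f \<circ> w) [0..<length x]" for x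
  proof
    show "x = map f (map w [0..<length x])" using that by simp
  qed (simp add: iprefixes_Inf)
  then show ?thesis using Inf by (auto simp: iprefixes_Inf) (metis map_map)
qed

lemma map_iconcat: "map_iword f (iconcat u) = iconcat (\<lambda>i. map f (u i))"
proof (rule iconcatI)
  fix x
  show "x \<in> iprefixes (map_iword f (iconcat u)) \<longleftrightarrow> (\<exists>n v. concats (\<lambda>i. map f (u i)) n = x @ v)"
    unfolding iprefixes_map image_iff Bex_def iprefixes_iconcat concats_map map_eq_append_conv by blast
qed

text \<open>Links the definition of \<open>filter_iword\<close> by indices with the filtering of
  lists: the members of \<open>I\<close> below its \<open>n\<close>-th member are exactly the first
  \<open>n\<close> ones.\<close>

lemma filter_upt_enumerate:
  assumes "infinite I"
  shows "filter (\<lambda>i. i \<in> I) [0..<enumerate I n] = map (enumerate I) [0..<n]"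
proof (induction n)
  case 0
  have "i \<notin> I" if "i < enumerate I 0" for i
    using that not_less_Least[of i "\<lambda>n. n \<in> I"] by (simp add: enumerate_0)
  then show ?case by (simp add: filter_empty_conv)
next
  case (Suc n)
  let ?e = "enumerate I"
  have less: "?e n < ?e (Suc n)" using assms by simp
  then have "[0..<?e (Suc n)] = [0..<?e n] @ ?e n # [Suc (?e n)..<?e (Suc n)]"
    by (metis less_imp_add_positive upt_add_eq_append upt_conv_Cons zero_le)
  moreover have "filter (\<lambda>i. i \<in> I) [Suc (?e n)..<?e (Suc n)] = []"
  proof -
    have False if "i \<in> I" "?e n < i" "i < ?e (Suc n)" for i
      using that enumerate_Suc''[OF assms, of n] not_less_Least[of i "\<lambda>s. s \<in> I \<and> ?e n < s"] by auto
    then show ?thesis by (fastforce simp: filter_empty_conv)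
  qed
  ultimately show ?case using Suc enumerate_in_set[OF assms] by simp
qed

text \<open>With infinitely many hits, cutting before the \<open>n\<close>-th hit leaves exactly
  \<open>n\<close> letters after filtering. With finitely many, filtering is constant beyond a bound
  on the hits.\<close>

lemma iprefixes_filter: "y \<in> iprefixes (filter_iword P W) \<longleftrightarrow> (\<exists>x\<in>iprefixes W. \<exists>v. filter P x = y @ v)"
proof (cases W)
  case (Fin w)
  have "(\<exists>v. filter P w = y @ v) \<longleftrightarrow> (\<exists>x. (\<exists>v. w = x @ v) \<and> (\<exists>v. filter P x = y @ v))"
    by (metis append_Nil2 append.assoc filter_append)
  then show ?thesis by (simp add: Fin iprefixes_Fin Bex_def)
next
  case (Inf w)
  let ?I = "{i. P (w i)}"
  have F: "filter P (map w [0..<k]) = map w (filter (\<lambda>i. i \<in> ?I) [0..<k])" for k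
    by (simp add: filter_map comp_def)
  have ex: "(\<exists>x\<in>iprefixes W. \<exists>v. filter P x = y @ v) \<longleftrightarrow> (\<exists>k v. filter P (map w [0..<k]) = y @ v)"
    unfolding Inf iprefixes_Inf by (metis Bex_def iprefixes_Inf length_map length_upt minus_nat.diff_0)
  show ?thesis
  proof (cases "infinite ?I")
    case True
    let ?w = "\<lambda>n. w (enumerate ?I n)"
    have fe: "filter P (map w [0..<enumerate ?I n]) = map ?w [0..<n]" for n
      unfolding F filter_upt_enumerate[OF True] by simp
    have W: "filter_iword P W = Inf ?w" using Inf True by (simp add: Let_def)
    show ?thesis unfolding W ex iprefixes_Inf
    proof
      assume "y = map ?w [0..<length y]"
      with fe[of "length y"] have "filter P (map w [0..<enumerate ?I (length y)]) = y @ []" by simp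
      then show "\<exists>k v. filter P (map w [0..<k]) = y @ v" by blast
    next
      assume "\<exists>k v. filter P (map w [0..<k]) = y @ v"
      then obtain k v where k: "filter P (map w [0..<k]) = y @ v" by blast
      \<comment> \<open>So every prefix extends to one that ends just before a hit, where
        \<open>fe\<close> computes the filtered word.\<close>
      have "k \<le> enumerate ?I k" using True le_enumerate by blast
      then have "[0..<enumerate ?I k] = [0..<k] @ [k..<enumerate ?I k]"
        by (metis le_add_diff_inverse upt_add_eq_append zero_le)
      then have "\<exists>v'. map ?w [0..<k] = filter P (map w [0..<k]) @ v'"
        using fe[of k] by (metis filter_append map_append)
      then have "\<exists>v'. map ?w [0..<k] = y @ v'" using k by auto
      then obtain v' where v': "map ?w [0..<k] = y @ v'" by blast
      have "y ! i = ?w i" if "i < length y" for i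
      proof -
        have "length y \<le> k" using arg_cong[OF v', of length] by simp
        then have "map ?w [0..<k] ! i = ?w i" using that by simp
        then show ?thesis using v' that by (simp add: nth_append)
      qed
      then show "y = map ?w [0..<length y]" by (intro nth_equalityI) auto
    qed
  next
    case False
    then obtain b where b: "\<And>i. i \<in> ?I \<Longrightarrow> i < b"
      by (meson finite_nat_set_iff_bounded)
    \<comment> \<open>Beyond the bound \<open>b\<close> the filtered index list is sorted, distinct
      and has all of \<open>?I\<close> as its set.\<close>
    have srt: "filter (\<lambda>i. i \<in> ?I) [0..<k] = sorted_list_of_set ?I" if "b \<le> k" for k
    proof -
      let ?xs = "filter (\<lambda>i. i \<in> ?I) [0..<k]"
      have "sorted_list_of_set (set ?xs) = ?xs"
        by (rule sorted_list_of_set.idem_if_sorted_distinct) (simp_all add: sorted_wrt_filter)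
      moreover have "set ?xs = ?I" using b that by (auto intro: less_le_trans)
      ultimately show ?thesis by simp
    qed
    have W: "filter_iword P W = Fin (map w (sorted_list_of_set ?I))"
      using Inf False by (simp add: Let_def)
    show ?thesis unfolding W ex iprefixes_Fin F
    proof
      assume "\<exists>v. map w (sorted_list_of_set ?I) = y @ v"
      then show "\<exists>k v. map w (filter (\<lambda>i. i \<in> ?I) [0..<k]) = y @ v"
        unfolding srt[of b, OF order.refl, symmetric] by blast
    next
      assume "\<exists>k v. map w (filter (\<lambda>i. i \<in> ?I) [0..<k]) = y @ v"
      then obtain k v where k: "map w (filter (\<lambda>i. i \<in> ?I) [0..<k]) = y @ v" by blast
      have "[0..<b + k] = [0..<k] @ [k..<b + k]"
        by (metis le_add2 le_add_diff_inverse upt_add_eq_append zero_le)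
      then have "\<exists>v'. map w (filter (\<lambda>i. i \<in> ?I) [0..<b + k]) = y @ v'"
        using k by (simp del: upt_Suc)
      then show "\<exists>v. map w (sorted_list_of_set ?I) = y @ v" using srt[of "b + k"] by simp
    qed
  qed
qed

lemma filter_iconcat: "filter_iword P (iconcat u) = iconcat (\<lambda>i. filter P (u i))"
proof (rule iconcatI)
  fix x
  show "x \<in> iprefixes (filter_iword P (iconcat u)) \<longleftrightarrow> (\<exists>n v. concats (\<lambda>i. filter P (u i)) n = x @ v)"
    unfolding iprefixes_filter concats_filter Bex_def iprefixes_iconcat
    by (metis append.assoc append_Nil2 filter_append)
qed

lemma conc_iword_conc: "conc_iword u (conc_iword v w) = conc_iword (u @ v) w"
  by (cases w) auto

lemma iprefixes_conc: "x \<in> iprefixes (conc_iword y V) \<longleftrightarrow> (\<exists>v. y = x @ v) \<or> (\<exists>x'\<in>iprefixes V. x = y @ x')"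
proof (cases V)
  case (Fin z)
  then show ?thesis by (auto simp: iprefixes_Fin append_eq_append_conv2) blast+
next
  case (Inf z)
  show ?thesis
  proof
    assume "x \<in> iprefixes (conc_iword y V)"
    then have x: "x = map (y \<frown> z) [0..<length x]" using Inf by (simp add: iprefixes_Inf)
    show "(\<exists>v. y = x @ v) \<or> (\<exists>x'\<in>iprefixes V. x = y @ x')"
    proof (cases "length x \<le> length y")
      case True
      have "x = take (length x) y"
        by (subst x, rule nth_equalityI) (use True in auto)
      then show ?thesis by (metis append_take_drop_id)
    next
      case False
      have "x = y @ map z [0..<length x - length y]"
        by (subst x, rule nth_equalityI) (use False in \<open>auto simp: nth_append conc_def\<close>)
      then show ?thesis using Inf by (metis iprefixes_Inf length_map length_upt minus_nat.diff_0)
    qed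
  next
    assume "(\<exists>v. y = x @ v) \<or> (\<exists>x'\<in>iprefixes V. x = y @ x')"
    then show "x \<in> iprefixes (conc_iword y V)"
      unfolding iprefixes_def by (auto simp flip: conc_iword_conc)
  qed
qed

lemma iconcat_split: "iconcat u = conc_iword (concats u n) (iconcat (\<lambda>i. u (i + n)))"
proof (rule iconcatI[symmetric])
  fix x
  show "x \<in> iprefixes (conc_iword (concats u n) (iconcat (\<lambda>i. u (i + n)))) \<longleftrightarrow> (\<exists>n v. concats u n = x @ v)"
    unfolding iprefixes_conc
  proof
    assume "(\<exists>v. concats u n = x @ v) \<or> (\<exists>x'\<in>iprefixes (iconcat (\<lambda>i. u (i + n))). x = concats u n @ x')"
    then show "\<exists>n v. concats u n = x @ v"
    proof
      assume "\<exists>x'\<in>iprefixes (iconcat (\<lambda>i. u (i + n))). x = concats u n @ x'"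
      then obtain m x' v where "concats (\<lambda>i. u (i + n)) m = x' @ v" "x = concats u n @ x'"
        by (auto simp: iprefixes_iconcat)
      then have "concats u (n + m) = x @ v" by (simp add: concats_add)
      then show ?thesis by blast
    qed blast
  next
    assume "\<exists>n v. concats u n = x @ v"
    then obtain m v where m: "concats u m = x @ v" by blast
    then obtain v' where "concats u (n + m) = x @ v'" using concats_le[of m "n + m" u] by auto
    then have "concats u n @ concats (\<lambda>i. u (i + n)) m = x @ v'" by (simp add: concats_add)
    then show "(\<exists>v. concats u n = x @ v) \<or> (\<exists>x'\<in>iprefixes (iconcat (\<lambda>i. u (i + n))). x = concats u n @ x')"
      by (auto simp: append_eq_append_conv2 iprefixes_iconcat)
  qed
qed

lemma set_iprefixes: "x \<in> iprefixes W \<Longrightarrow> set x \<subseteq> set_iword W"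
proof (cases W)
  case (Inf w)
  assume "x \<in> iprefixes W"
  then have "x = map w [0..<length x]" using Inf by (simp add: iprefixes_Inf)
  then have "set x \<subseteq> range w" by (metis image_mono list.set_map subset_UNIV)
  then show ?thesis using Inf by simp
qed (auto simp: iprefixes_Fin)

lemma set_iconcat: "set_iword (iconcat u) = (\<Union>i. set (u i))"
proof
  show "(\<Union>i. set (u i)) \<subseteq> set_iword (iconcat u)"
  proof
    fix a assume "a \<in> (\<Union>i. set (u i))"
    then obtain i where "a \<in> set (concats u (Suc i))" by auto
    then show "a \<in> set_iword (iconcat u)" using set_iprefixes[OF concats_in_iprefixes[of u "Suc i"]] by blast
  qed
  have sp: "set (concats u n) \<subseteq> (\<Union>i. set (u i))" for n by (induction n) auto
  show "set_iword (iconcat u) \<subseteq> (\<Union>i. set (u i))"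
  proof
    fix a assume a: "a \<in> set_iword (iconcat u)"
    have "\<exists>x\<in>iprefixes (iconcat u). a \<in> set x"
    proof (cases "iconcat u")
      case (Fin x)
      then show ?thesis using a by (auto simp: iprefixes_Fin)
    next
      case (Inf w)
      then obtain k where "a = w k" using a by auto
      then have "a \<in> set (map w [0..<Suc k])" "map w [0..<Suc k] \<in> iprefixes (Inf w)"
        by (auto simp: iprefixes_Inf simp del: upt_Suc)
      then show ?thesis using Inf by metis
    qed
    then obtain x n v where "a \<in> set x" "concats u n = x @ v" unfolding Bex_def iprefixes_iconcat by blast
    then have "a \<in> set (concats u n)" by simp
    then show "a \<in> (\<Union>i. set (u i))" using sp by blast
  qed
qed

text \<open>Blocks of single letters, padded with empty blocks when the word is finite. Runs can
  therefore always be analysed one step per block.\<close>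

lemma iconcat_blocks: "\<exists>u. W = iconcat u \<and> (\<forall>i. length (u i) \<le> 1)"
proof (cases W)
  case (Fin x)
  define u where "u i = (if i < length x then [x ! i] else [])" for i
  have "concats u n = take n x" for n
    by (induction n) (auto simp: u_def take_Suc_conv_app_nth)
  then have "iconcat u = Fin x" by (auto simp: iconcat_Fin_iff u_def)
  then show ?thesis using Fin by (metis u_def One_nat_def le_refl length_Cons list.size(3) zero_le)
next
  case (Inf w)
  have "concats (\<lambda>i. [w i]) n = map w [0..<n]" for n by (induction n) auto
  then have "W = iconcat (\<lambda>i. [w i])"
    unfolding Inf by (intro iconcatI) (metis append_Nil2 iprefixes_Inf iprefixes_append length_map length_upt minus_nat.diff_0)
  then show ?thesis by force
qed

section \<open>Paths and block runs\<close>

type_synonym ('p, 'a, 's) gstep = "('p \<Rightarrow> 's) \<times> 'a \<times> ('p \<Rightarrow> 's)"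

text \<open>In contrast to \<open>gpath\<close>, the end state is an argument, so that paths can be
  composed.\<close>

fun path :: "('p, 'a) alphabet \<Rightarrow> ('p, 'a, 's) zautomaton \<Rightarrow> ('p \<Rightarrow> 's) \<Rightarrow>
    ('p, 'a, 's) gstep list \<Rightarrow> ('p \<Rightarrow> 's) \<Rightarrow> bool" where
  "path D A s [] s' \<longleftrightarrow> s' = s"
| "path D A s ((t, a, t') # \<rho>) s' \<longleftrightarrow> t = s \<and> gtrans D A t a t' \<and> path D A t' \<rho> s'"

definition touches :: "('p, 'a) alphabet \<Rightarrow> ('p, 'a, 's) gstep list \<Rightarrow> 'p set \<Rightarrow> bool" where
  "touches D \<rho> X \<longleftrightarrow> (\<exists>s a s'. (s, a, s') \<in> set \<rho> \<and> adom D a \<inter> X \<noteq> {})"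

lemma touches_Nil [simp]: "\<not> touches D [] X"
  by (simp add: touches_def)

lemma touches_Cons [simp]: "touches D ((s, a, s') # \<rho>) X \<longleftrightarrow> adom D a \<inter> X \<noteq> {} \<or> touches D \<rho> X"
  by (auto simp: touches_def)

lemma touches_append [simp]: "touches D (\<rho> @ \<rho>') X \<longleftrightarrow> touches D \<rho> X \<or> touches D \<rho>' X"
  unfolding touches_def set_append by blast

lemma touches_subset: "touches D \<rho> X \<Longrightarrow> X \<subseteq> Y \<Longrightarrow> touches D \<rho> Y"
  by (auto simp: touches_def)

definition enabled :: "('p, 'a) alphabet \<Rightarrow> ('p, 'a, 's) zautomaton \<Rightarrow> ('p \<Rightarrow> 's) \<Rightarrow> 'a \<Rightarrow> bool" where
  "enabled D A s a \<longleftrightarrow> (\<exists>s'. gtrans D A s a s')"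

text \<open>
  The infinite concatenation of the blocks \<open>u i\<close> is a finite or an infinite run, depending on
  whether almost all blocks are empty.
\<close>

definition block_run :: "('p, 'a) alphabet \<Rightarrow> ('p, 'a, 's) zautomaton \<Rightarrow> (nat \<Rightarrow> 'p \<Rightarrow> 's) \<Rightarrow>
    (nat \<Rightarrow> ('p, 'a, 's) gstep list) \<Rightarrow> bool" where
  "block_run D A t u \<longleftrightarrow> t 0 = init_st A \<and> (\<forall>i. path D A (t i) (u i) (t (Suc i)))"

text \<open>Block boundaries suffice as test points: an action enabled inside a block is touched in
  the rest of that block or is still enabled at its end (\<open>enabled_persist\<close>).\<close>

definition block_maximal :: "('p, 'a) alphabet \<Rightarrow> ('p, 'a, 's) zautomaton \<Rightarrow> (nat \<Rightarrow> 'p \<Rightarrow> 's) \<Rightarrow>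
    (nat \<Rightarrow> ('p, 'a, 's) gstep list) \<Rightarrow> bool" where
  "block_maximal D A t u \<longleftrightarrow> (\<forall>i a. enabled D A (t i) a \<longrightarrow> (\<exists>j\<ge>i. touches D (u j) (adom D a)))"

lemma path_append: "path D A s (\<rho> @ \<rho>') s'' \<longleftrightarrow> (\<exists>s'. path D A s \<rho> s' \<and> path D A s' \<rho>' s'')"
  by (induction \<rho> arbitrary: s) auto

lemma path_gpath: "path D A s \<rho> s' \<Longrightarrow> gpath D A s \<rho>"
  by (induction \<rho> arbitrary: s) auto

lemma gpath_path: "gpath D A s \<rho> \<Longrightarrow> path D A s \<rho> (if \<rho> = [] then s else snd (snd (last \<rho>)))"
  by (induction \<rho> arbitrary: s) auto

lemma path_end: "path D A s \<rho> s' \<Longrightarrow> s' = (if \<rho> = [] then s else snd (snd (last \<rho>)))"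
  by (induction \<rho> arbitrary: s) auto

lemma block_run_concats: "block_run D A t u \<Longrightarrow> path D A (t 0) (concats u n) (t n)"
  by (induction n) (auto simp: block_run_def path_append)

lemma block_run_init: "block_run D A t u \<Longrightarrow> t 0 = init_st A"
  by (simp add: block_run_def)

lemma block_run_path: "block_run D A t u \<Longrightarrow> path D A (t i) (u i) (t (Suc i))"
  by (simp add: block_run_def)

lemma block_run_reach: "block_run D A t u \<Longrightarrow> \<exists>\<rho>. path D A (init_st A) \<rho> (t n)"
  by (metis block_run_concats block_run_init)

lemma gtrans_det:
  assumes "zielonka D A" "gtrans D A s a s'" "gtrans D A s a s''"
  shows "s' = s''"
proof
  fix p
  have "a \<in> acts D" using assms by (simp add: gtrans_def)
  then have sv: "single_valued (delta A a)" using assms(1) by (simp add: zielonka_def)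
  have "restrict s' (adom D a) = restrict s'' (adom D a)"
    using assms sv unfolding gtrans_def single_valued_def by blast
  then show "s' p = s'' p"
    using assms unfolding gtrans_def by (metis restrict_apply')
qed

definition lab :: "('p, 'a, 's) gstep \<Rightarrow> 'a" where "lab = (\<lambda>(s, a, s'). a)"

lemma lab_simp [simp]: "lab (s, a, s') = a"
  by (simp add: lab_def)

lemma path_det:
  assumes "zielonka D A"
  shows "path D A s \<rho> s' \<Longrightarrow> path D A s \<rho>' s'' \<Longrightarrow> map lab \<rho> = map lab \<rho>' \<Longrightarrow> \<rho> = \<rho>'"
proof (induction \<rho> arbitrary: s \<rho>')
  case (Cons x \<rho>)
  obtain t a t' where x: "x = (t, a, t')" by (cases x)
  from Cons.prems obtain y \<rho>2 where \<rho>': "\<rho>' = y # \<rho>2" by (cases \<rho>') auto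
  obtain r b r' where y: "y = (r, b, r')" by (cases y)
  have "a = b" "t = r" "t = s" using Cons.prems by (auto simp: x y \<rho>')
  then have "t' = r'" using gtrans_det[OF assms, of s a t' r'] Cons.prems by (auto simp: x y \<rho>')
  then show ?case using Cons by (auto simp: x y \<rho>')
qed auto

lemma gtrans_outside: "gtrans D A s a s' \<Longrightarrow> p \<notin> adom D a \<Longrightarrow> s' p = s p"
  by (simp add: gtrans_def)

lemma path_outside: "path D A s \<rho> s' \<Longrightarrow> \<not> touches D \<rho> X \<Longrightarrow> p \<in> X \<Longrightarrow> s' p = s p"
proof (induction \<rho> arbitrary: s)
  case (Cons x \<rho>)
  obtain t a t' where x: "x = (t, a, t')" by (cases x)
  have "s' p = t' p" using Cons.IH[of t'] Cons.prems by (auto simp: x)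
  moreover have "p \<notin> adom D a" using Cons.prems by (auto simp: x)
  then have "t' p = s p" using gtrans_outside Cons.prems by (auto simp: x)
  ultimately show ?case by simp
qed auto

lemma enabled_iff:
  assumes "zielonka D A" "a \<in> acts D"
  shows "enabled D A s a \<longleftrightarrow> restrict s (adom D a) \<in> Domain (delta A a)"
proof
  assume "restrict s (adom D a) \<in> Domain (delta A a)"
  then obtain x where x: "(restrict s (adom D a), x) \<in> delta A a" by blast
  then have "x \<in> (\<Pi>\<^sub>E p\<in>adom D a. st A p)" using assms unfolding zielonka_def by blast
  then have "restrict (override_on s x (adom D a)) (adom D a) = x"
    by (auto simp: PiE_def extensional_def)
  then have "gtrans D A s a (override_on s x (adom D a))"
    using x assms(2) by (simp add: gtrans_def override_on_def)
  then show "enabled D A s a" by (auto simp: enabled_def)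
qed (auto simp: enabled_def gtrans_def)

lemma enabled_acts: "enabled D A s a \<Longrightarrow> a \<in> acts D"
  by (auto simp: enabled_def gtrans_def)

lemma enabled_cong:
  assumes "zielonka D A" "\<And>p. p \<in> adom D a \<Longrightarrow> s p = s' p"
  shows "enabled D A s a \<longleftrightarrow> enabled D A s' a"
proof -
  have "restrict s (adom D a) = restrict s' (adom D a)" using assms(2) by auto
  then show ?thesis using enabled_iff[OF assms(1), of a] enabled_acts by metis
qed

lemma enabled_persist:
  assumes "zielonka D A" "enabled D A s a" "path D A s \<rho> s'" "\<not> touches D \<rho> (adom D a)"
  shows "enabled D A s' a"
  using enabled_cong[OF assms(1), of a s' s] path_outside[OF assms(3,4)] assms(2) by simp

lemma block_run_persist:
  assumes "zielonka D A" "block_run D A t u" "enabled D A (t i) a" "i \<le> n"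
    "\<And>j. i \<le> j \<Longrightarrow> j < n \<Longrightarrow> \<not> touches D (u j) (adom D a)"
  shows "enabled D A (t n) a"
  using assms(4,5)
proof (induction rule: dec_induct)
  case (step n)
  have "path D A (t n) (u n) (t (Suc n))" using assms(2) by (simp add: block_run_def)
  then show ?case using step enabled_persist[OF assms(1)] by (meson le_refl lessI less_SucI)
qed (use assms in auto)

text \<open>An action enabled early and never touched is still enabled at boundary \<open>n\<close>.
  Fairness thus depends only on the tail, which permits ignoring a block where steps were
  inserted.\<close>

lemma block_maximalI_late:
  assumes "zielonka D A" "block_run D A t u"
    "\<And>i a. i \<ge> n \<Longrightarrow> enabled D A (t i) a \<Longrightarrow> \<exists>j\<ge>i. touches D (u j) (adom D a)"
  shows "block_maximal D A t u"
  unfolding block_maximal_def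
proof (intro allI impI)
  fix i a assume e: "enabled D A (t i) a"
  show "\<exists>j\<ge>i. touches D (u j) (adom D a)"
  proof (rule ccontr)
    assume no: "\<not> ?thesis"
    have "enabled D A (t (max i n)) a"
      by (rule block_run_persist[OF assms(1,2) e]) (use no in auto)
    then obtain j where "j \<ge> max i n" "touches D (u j) (adom D a)" using assms(3)[of "max i n" a] by auto
    with no show False by auto
  qed
qed

section \<open>Inserting steps on processes that are inactive from then on\<close>

lemma gtrans_override:
  assumes "gtrans D A s a s'" "adom D a \<inter> X = {}"
  shows "gtrans D A (override_on s z X) a (override_on s' z X)"
proof -
  have "restrict (override_on s z X) (adom D a) = restrict s (adom D a)" for s
    using assms(2) by (intro restrict_ext) (auto simp: override_on_def)
  then show ?thesis using assms by (auto simp: gtrans_def override_on_def)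
qed

definition ovstep :: "'p set \<Rightarrow> ('p \<Rightarrow> 's) \<Rightarrow> ('p, 'a, 's) gstep \<Rightarrow> ('p, 'a, 's) gstep" where
  "ovstep X z = (\<lambda>(s, a, s'). (override_on s z X, a, override_on s' z X))"

lemma path_override:
  "path D A s \<rho> s' \<Longrightarrow> \<not> touches D \<rho> X \<Longrightarrow>
    path D A (override_on s z X) (map (ovstep X z) \<rho>) (override_on s' z X)"
proof (induction \<rho> arbitrary: s)
  case (Cons x \<rho>)
  then show ?case by (cases x) (auto simp: ovstep_def intro: gtrans_override)
qed auto

lemma touches_ovstep: "touches D (map (ovstep X z) \<rho>) Y \<longleftrightarrow> touches D \<rho> Y"
  by (force simp: touches_def ovstep_def split_beta)

text \<open>The inserted word \<open>w\<close> opens block \<open>n\<close>: the state at boundary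
  \<open>n\<close> is still the old one, and the \<open>X\<close>-components are frozen at those of
  \<open>z\<close> from boundary \<open>n + 1\<close> on.\<close>

definition insert_st :: "nat \<Rightarrow> 'p set \<Rightarrow> ('p \<Rightarrow> 's) \<Rightarrow> (nat \<Rightarrow> 'p \<Rightarrow> 's) \<Rightarrow> nat \<Rightarrow> 'p \<Rightarrow> 's" where
  "insert_st n X z t i = (if i \<le> n then t i else override_on (t i) z X)"

definition insert_block :: "nat \<Rightarrow> 'p set \<Rightarrow> ('p \<Rightarrow> 's) \<Rightarrow> ('p, 'a, 's) gstep list \<Rightarrow>
    (nat \<Rightarrow> ('p, 'a, 's) gstep list) \<Rightarrow> nat \<Rightarrow> ('p, 'a, 's) gstep list" where
  "insert_block n X z w u i =
     (if i < n then u i else if i = n then w @ map (ovstep X z) (u n) else map (ovstep X z) (u i))"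

text \<open>From block \<open>n\<close> on no step reads or writes a component in \<open>X\<close>,
  so the old steps remain valid with the \<open>X\<close>-components left by
  \<open>w\<close>.\<close>

lemma block_run_insert:
  assumes r: "block_run D A t u" and w: "path D A (t n) w z" "\<And>s a s'. (s, a, s') \<in> set w \<Longrightarrow> adom D a \<subseteq> X"
    and u: "\<And>j. n \<le> j \<Longrightarrow> \<not> touches D (u j) X"
  shows "block_run D A (insert_st n X z t) (insert_block n X z w u)"
  unfolding block_run_def
proof (intro conjI allI)
  show "insert_st n X z t 0 = init_st A" using r by (simp add: insert_st_def block_run_def)
  fix i
  have g: "path D A (t i) (u i) (t (Suc i))" for i using r by (simp add: block_run_def)
  have "\<not> touches D w (- X)" using w(2) by (fastforce simp: touches_def)
  then have "z p = t n p" if "p \<notin> X" for p using path_outside[OF w(1)] that by auto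
  \<comment> \<open>\<open>w\<close> acts inside \<open>X\<close> only, hence its end state differs
    from \<open>t n\<close> only there.\<close>
  then have z: "z = override_on (t n) z X" by (auto simp: override_on_def)
  show "path D A (insert_st n X z t i) (insert_block n X z w u i) (insert_st n X z t (Suc i))"
  proof (cases "i < n")
    case True then show ?thesis using g by (auto simp: insert_st_def insert_block_def)
  next
    case False
    then have "path D A (override_on (t i) z X) (map (ovstep X z) (u i)) (override_on (t (Suc i)) z X)"
      using path_override[OF g u] by auto
    then show ?thesis using False w(1) z by (auto simp: insert_st_def insert_block_def path_append)
  qed
qed

lemma lab_ovstep: "lab (ovstep X z x) = lab x"
  by (simp add: lab_def ovstep_def split_beta)

lemma Nil_iprefixes [simp]: "[] \<in> iprefixes W"
  by (cases W) (auto simp: iprefixes_Fin iprefixes_Inf)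

section \<open>Maximality of runs as fairness of block runs\<close>

lemma is_gpath_iff: "is_gpath D A \<rho> \<longleftrightarrow> (\<forall>x\<in>iprefixes \<rho>. gpath D A (init_st A) x)"
proof (cases \<rho>)
  case (Fin x)
  have "gpath D A s (y @ z) \<Longrightarrow> gpath D A s y" for s y z
    by (metis path_append path_gpath gpath_path)
  then show ?thesis using Fin by (auto simp: iprefixes_Fin)
next
  case (Inf w)
  have "subsequence w 0 n \<in> iprefixes (Inf w)" for n by (simp add: iprefixes_Inf subsequence_def)
  moreover have "x = subsequence w 0 (length x)" if "x \<in> iprefixes (Inf w)" for x
    using that by (simp add: iprefixes_Inf subsequence_def)
  ultimately show ?thesis using Inf by (metis is_gpath.simps(2))
qed

lemma block_run_is_gpath: assumes "block_run D A t u" shows "is_gpath D A (iconcat u)"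
  unfolding is_gpath_iff
proof
  fix x assume "x \<in> iprefixes (iconcat u)"
  then obtain n v where "concats u n = x @ v" by (auto simp: iprefixes_iconcat)
  then have "path D A (init_st A) (x @ v) (t n)" using block_run_concats[OF assms, of n] assms by (simp add: block_run_def)
  then show "gpath D A (init_st A) x" by (metis path_append path_gpath)
qed

lemma is_gpath_block_run:
  assumes "is_gpath D A \<rho>"
  shows "\<exists>t u. block_run D A t u \<and> \<rho> = iconcat u \<and> (\<forall>i. length (u i) \<le> 1)"
proof -
  obtain u where u: "\<rho> = iconcat u" "\<And>i. length (u i) \<le> 1" using iconcat_blocks by blast
  define t where "t n = (if concats u n = [] then init_st A else snd (snd (last (concats u n))))" for n
  have g: "path D A (init_st A) (concats u n) (t n)" for n
  proof -
    have "gpath D A (init_st A) (concats u n)" using assms u concats_in_iprefixes is_gpath_iff by metis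
    from gpath_path[OF this] show ?thesis by (simp add: t_def)
  qed
  have "block_run D A t u"
    unfolding block_run_def
  proof (intro conjI allI)
    fix i
    obtain s where "path D A (init_st A) (concats u i) s" "path D A s (u i) (t (Suc i))"
      using g[of "Suc i"] by (auto simp: path_append)
    moreover from this g have "s = t i" using path_end by metis
    ultimately show "path D A (t i) (u i) (t (Suc i))" by simp
  qed (simp add: t_def)
  then show ?thesis using u by blast
qed

lemma single_block:
  assumes "path D A s \<rho> s'" "length \<rho> \<le> 1"
  shows "(\<rho> = [] \<and> s' = s) \<or> (\<exists>a. \<rho> = [(s, a, s')] \<and> gtrans D A s a s')"
  using assms by (cases \<rho>) (auto simp: prod.splits)

text \<open>An enabled action that is never touched later could be inserted at that boundary by
  \<open>block_run_insert\<close> with \<open>X\<close> its domain, which \<open>maximal\<close>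
  forbids.\<close>

lemma maximal_block_maximal:
  assumes r: "block_run D A t u" and m: "maximal D A (map_iword (\<lambda>(s, a, s'). a) (iconcat u))"
  shows "block_maximal D A t u"
  unfolding block_maximal_def
proof (intro allI impI, rule ccontr)
  fix i a assume e: "enabled D A (t i) a" and no: "\<not> (\<exists>j\<ge>i. touches D (u j) (adom D a))"
  from e obtain z where z: "gtrans D A (t i) a z" by (auto simp: enabled_def)
  let ?u = "insert_block i (adom D a) z [(t i, a, z)] u" and ?t = "insert_st i (adom D a) z t"
  have lab: "(\<lambda>(s, a, s'). a) = lab" by (simp add: lab_def)
  have r': "block_run D A ?t ?u" using z no by (intro block_run_insert[OF r]) auto
  define v where "v = iconcat (\<lambda>j. map lab (u (j + i)))"
  have "map_iword lab (iconcat u) = conc_iword (map lab (concats u i)) v"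
    using iconcat_split[of "\<lambda>i. map lab (u i)" i] by (simp add: map_iconcat concats_map v_def)
  moreover have "\<forall>b\<in>set_iword v. adom D a \<inter> adom D b = {}"
  proof
    fix b assume "b \<in> set_iword v"
    then obtain j s s' where "(s, b, s') \<in> set (u (j + i))"
      by (auto simp: v_def set_iconcat lab_def)
    moreover have "\<not> touches D (u (j + i)) (adom D a)" using no by auto
    ultimately show "adom D a \<inter> adom D b = {}" by (auto simp: touches_def)
  qed
  moreover have "map_iword lab (iconcat ?u) = conc_iword (map lab (concats u i)) (conc_iword [a] v)"
  proof -
    have "concats ?u i = concats u i" by (rule concats_cong) (simp add: insert_block_def)
    then have 1: "map_iword lab (iconcat ?u) =
        conc_iword (map lab (concats u i)) (iconcat (\<lambda>j. map lab (?u (j + i))))"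
      using iconcat_split[of "\<lambda>i. map lab (?u i)" i] by (simp add: map_iconcat concats_map)
    have "iconcat (\<lambda>j. map lab (?u (j + i))) =
        conc_iword (map lab (?u i)) (iconcat (\<lambda>j. map lab (?u (Suc j + i))))"
      using iconcat_split[of "\<lambda>j. map lab (?u (j + i))" 1] by simp
    also have "map lab (?u i) = [a] @ map lab (u i)"
      by (simp add: insert_block_def lab_ovstep comp_def)
    also have "(\<lambda>j. map lab (?u (Suc j + i))) = (\<lambda>j. map lab (u (Suc j + i)))"
      by (auto simp: insert_block_def lab_ovstep comp_def)
    also have "conc_iword ([a] @ map lab (u i)) (iconcat (\<lambda>j. map lab (u (Suc j + i)))) = conc_iword [a] v"
      using iconcat_split[of "\<lambda>j. map lab (u (j + i))" 1]
      by (simp only: v_def conc_iword_conc[symmetric]) simp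
    finally show ?thesis using 1 by simp
  qed
  then have "run_defined D A (conc_iword (map lab (concats u i)) (conc_iword [a] v))"
    unfolding run_defined_def is_run_def lab using block_run_is_gpath[OF r'] by blast
  ultimately show False using m enabled_acts[OF e] unfolding maximal_def lab by blast
qed

text \<open>Suppose \<open>a\<close> could be inserted after \<open>x\<close>. By determinism the
  state reached on \<open>x\<close> is the one of the given run, so \<open>a\<close> is enabled
  there; it stays enabled up to a block boundary, and fairness produces a dependent letter in the
  remainder \<open>v\<close>.\<close>

lemma block_maximal_maximal:
  assumes A: "zielonka D A" and r: "block_run D A t u" and m: "block_maximal D A t u"
  shows "maximal D A (map_iword (\<lambda>(s, a, s'). a) (iconcat u))"
proof -
  have lab: "(\<lambda>(s, a, s'). a) = lab" by (simp add: lab_def)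
  let ?w = "map_iword lab (iconcat u)"
  have "run_defined D A ?w"
    unfolding run_defined_def is_run_def lab using block_run_is_gpath[OF r] by blast
  moreover have False if w: "?w = conc_iword x v" and a: "a \<in> acts D"
    "\<forall>b\<in>set_iword v. adom D a \<inter> adom D b = {}" "run_defined D A (conc_iword x (conc_iword [a] v))"
    for x v a
  proof -
    from a(3) obtain \<rho> where \<rho>: "map_iword lab \<rho> = conc_iword x (conc_iword [a] v)" "is_gpath D A \<rho>"
      unfolding run_defined_def is_run_def lab by blast
    have "x @ [a] \<in> iprefixes (map_iword lab \<rho>)" unfolding \<rho> iprefixes_def conc_iword_conc by blast
    then obtain y' where y': "y' \<in> iprefixes \<rho>" "map lab y' = x @ [a]" unfolding iprefixes_map by auto
    then obtain y s s' where y: "y' = y @ [(s, a, s')]" "map lab y = x"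
      by (auto simp: map_eq_append_conv lab_def)
    have "gpath D A (init_st A) y'" using \<rho>(2) y'(1) by (simp add: is_gpath_iff)
    from gpath_path[OF this] obtain s0 where s0: "path D A (init_st A) y s0" "gtrans D A s0 a s'"
      unfolding y(1) path_append by auto
    have "x \<in> iprefixes ?w" unfolding w iprefixes_def by blast
    \<comment> \<open>The cut after \<open>x\<close> may fall inside a block; \<open>z'\<close> is
      the stretch from the cut to the next boundary considered, \<open>n\<close>.\<close>
    then obtain z n z' where z: "map lab z = x" "concats u n = z @ z'"
      unfolding iprefixes_map by (auto simp: iprefixes_iconcat)
    have "path D A (init_st A) (z @ z') (t n)" using block_run_concats[OF r, of n] r z by (simp add: block_run_def)
    then obtain s1 where s1: "path D A (init_st A) z s1" "path D A s1 z' (t n)" by (auto simp: path_append)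
    have "y = z" using path_det[OF A s0(1) s1(1)] y z by simp
    then have "s1 = s0" using s0 s1 path_end by metis
    \<comment> \<open>Every letter of the run that comes after \<open>z\<close> belongs to
      \<open>v\<close>, hence is independent of \<open>a\<close>.\<close>
    have late: "b \<in> set_iword v" if "concats u k = z @ z2" "(s, b, s') \<in> set z2" for k z2 s b s'
    proof -
      have "map lab (z @ z2) \<in> iprefixes ?w"
        unfolding iprefixes_map using that(1) concats_in_iprefixes[of u k] by (metis imageI)
      then have "map lab z2 \<in> iprefixes v" unfolding w iprefixes_conc using z(1) by auto
      then have "set (map lab z2) \<subseteq> set_iword v" by (rule set_iprefixes)
      then show ?thesis using that(2) by force
    qed
    have "\<not> touches D z' (adom D a)" using late[OF z(2)] a(2) unfolding touches_def by blast
    then have "enabled D A (t n) a"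
      using enabled_persist[OF A _ s1(2)] s0(2) \<open>s1 = s0\<close> by (auto simp: enabled_def)
    then obtain j where j: "j \<ge> n" "touches D (u j) (adom D a)" using m by (auto simp: block_maximal_def)
    then obtain s b s' where b: "(s, b, s') \<in> set (u j)" "adom D b \<inter> adom D a \<noteq> {}"
      by (auto simp: touches_def)
    obtain z2 where "concats u j = concats u n @ z2" using concats_le j(1) by blast
    then have "concats u (Suc j) = z @ (z' @ z2 @ u j)" using z by simp
    then have "b \<in> set_iword v" using late[of "Suc j" "z' @ z2 @ u j"] b(1) by auto
    then show False using a(2) b(2) by blast
  qed
  ultimately show ?thesis unfolding maximal_def lab by blast
qed

text \<open>Fairness by round robin: at each time one action of a fixed finite list is tried and
  executed if enabled.\<close>

lemma block_maximal_extension: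
  assumes C: "zielonka D C" "finite (acts D)" "path D C (init_st C) \<rho> s"
    "\<And>a. a \<in> acts D \<Longrightarrow> adom D a \<noteq> {}"
  shows "\<exists>t u. block_run D C t u \<and> block_maximal D C t u \<and> t 1 = s"
proof -
  obtain as where as: "set as = acts D" using C(2) finite_list by blast
  define nxt where "nxt n s = (if enabled D C s (as ! (n mod length as))
    then SOME s'. gtrans D C s (as ! (n mod length as)) s' else s)" for n s
  define g where "g = rec_nat s nxt"
  \<comment> \<open>Block 0 carries the given path, so the round robin state \<open>g m\<close> sits
    at boundary \<open>m + 1\<close>.\<close>
  define t where "t n = (case n of 0 \<Rightarrow> init_st C | Suc m \<Rightarrow> g m)" for n
  define u where "u n = (case n of 0 \<Rightarrow> \<rho> | Suc m \<Rightarrow>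
    if enabled D C (g m) (as ! (m mod length as)) then [(g m, as ! (m mod length as), g (Suc m))] else [])" for n
  have g: "gtrans D C (g m) (as ! (m mod length as)) (g (Suc m))"
    if "enabled D C (g m) (as ! (m mod length as))" for m
    using that someI_ex[of "gtrans D C (g m) (as ! (m mod length as))"]
    by (simp add: g_def nxt_def enabled_def)
  have r: "block_run D C t u"
    unfolding block_run_def
  proof (intro conjI allI)
    fix i show "path D C (t i) (u i) (t (Suc i))"
      using C(3) g by (cases i) (auto simp: t_def u_def, auto simp: g_def nxt_def)
  qed (simp add: t_def)
  have "block_maximal D C t u"
  proof (rule block_maximalI_late[OF C(1) r, of 1])
    fix i a assume i: "i \<ge> 1" and e: "enabled D C (t i) a"
    then obtain k where k: "k < length as" "as ! k = a" using as enabled_acts[OF e] by (metis in_set_conv_nth)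
    \<comment> \<open>A time at or after \<open>i\<close> at which it is the turn of
      \<open>a\<close>.\<close>
    define m where "m = k + length as * i"
    have mi: "m \<ge> i" using k by (cases "length as") (auto simp: m_def)
    have am: "as ! (m mod length as) = a" using k by (simp add: m_def)
    show "\<exists>j\<ge>i. touches D (u j) (adom D a)"
    proof (rule ccontr)
      assume no: "\<not> ?thesis"
      have "enabled D C (t (Suc m)) a"
        by (rule block_run_persist[OF C(1) r e]) (use no mi in auto)
      then have "u (Suc m) = [(g m, a, g (Suc m))]" using am by (simp add: t_def u_def)
      moreover have "\<not> touches D (u (Suc m)) (adom D a)" using no mi by (meson le_SucI)
      ultimately show False using C(4) enabled_acts[OF e] by auto
    qed
  qed
  moreover have "t 1 = s" by (simp add: t_def g_def)
  ultimately show ?thesis using r by blast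
qed

lemma path_tuple:
  assumes "dist_alphabet D" "zielonka D A" "path D A s \<rho> s'" "s \<in> (\<Pi>\<^sub>E p\<in>procs D. st A p)"
  shows "s' \<in> (\<Pi>\<^sub>E p\<in>procs D. st A p)"
  using assms(3,4)
proof (induction \<rho> arbitrary: s)
  case (Cons x \<rho>)
  obtain t a t' where x: "x = (t, a, t')" by (cases x)
  with Cons.prems have g: "gtrans D A s a t'" and g2: "path D A t' \<rho> s'" by auto
  from g assms(1) have ad: "a \<in> acts D" "adom D a \<subseteq> procs D" by (auto simp: gtrans_def dist_alphabet_def)
  then have r: "restrict t' (adom D a) \<in> (\<Pi>\<^sub>E p\<in>adom D a. st A p)"
    using g assms(2) unfolding zielonka_def gtrans_def by blast
  have "t' \<in> (\<Pi>\<^sub>E p\<in>procs D. st A p)"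
  proof (rule PiE_I)
    fix p assume "p \<in> procs D"
    then show "t' p \<in> st A p"
      using Cons.prems(2) gtrans_outside[OF g, of p] PiE_mem[OF r, of p] by (cases "p \<in> adom D a") (auto simp: PiE_mem)
  next
    fix p assume p: "p \<notin> procs D"
    then have "t' p = s p" using gtrans_outside[OF g, of p] ad by auto
    then show "t' p = undefined" using PiE_arb[OF Cons.prems(2) p] by simp
  qed
  then show ?case using Cons.IH[OF g2] by blast
qed auto

lemma reach_tuple:
  assumes "dist_alphabet D" "zielonka D A" "path D A (init_st A) \<rho> s"
  shows "s \<in> (\<Pi>\<^sub>E p\<in>procs D. st A p)"
  using path_tuple[OF assms] assms(2) by (auto simp: zielonka_def)

section \<open>Controllability in terms of block runs\<close>

definition aproj :: "('p, 'a) alphabet \<Rightarrow> ('p \<Rightarrow> 'c \<Rightarrow> 's) \<Rightarrow> 'p \<Rightarrow> ('p, 'a, 'c) gstep list \<Rightarrow> ('s \<times> 'a \<times> 's) list" where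
  "aproj D \<pi> p \<rho> = map (\<lambda>(s, a, s'). (\<pi> p (s p), a, \<pi> p (s' p))) (filter (\<lambda>(s, a, s'). p \<in> adom D a) \<rho>)"

lemma aproj_Nil [simp]: "aproj D \<pi> p [] = []"
  by (simp add: aproj_def)

lemma aproj_Cons [simp]: "aproj D \<pi> p ((s, a, s') # \<rho>) =
    (if p \<in> adom D a then (\<pi> p (s p), a, \<pi> p (s' p)) # aproj D \<pi> p \<rho> else aproj D \<pi> p \<rho>)"
  by (simp add: aproj_def)

lemma aproj_append [simp]: "aproj D \<pi> p (\<rho> @ \<rho>') = aproj D \<pi> p \<rho> @ aproj D \<pi> p \<rho>'"
  by (simp add: aproj_def)

lemma concats_aproj: "concats (\<lambda>i. aproj D \<pi> p (u i)) n = aproj D \<pi> p (concats u n)"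
  by (induction n) auto

lemma aproj_empty_iff: "aproj D \<pi> p \<rho> = [] \<longleftrightarrow> \<not> touches D \<rho> {p}"
  by (induction \<rho>) (auto split: if_splits)

lemma aproj_end:
  "path D A s \<rho> s' \<Longrightarrow> \<pi> p (s' p) = (if aproj D \<pi> p \<rho> = [] then \<pi> p (s p) else snd (snd (last (aproj D \<pi> p \<rho>))))"
proof (induction \<rho> arbitrary: s)
  case (Cons x \<rho>)
  obtain t a t' where x: "x = (t, a, t')" by (cases x)
  show ?case using Cons.IH[of t'] Cons.prems gtrans_outside[of D A s a t' p] by (auto simp: x)
qed auto

lemma map_proj_iconcat:
  "map_iword (\<lambda>(c, a, c'). (\<pi> p c, a, \<pi> p c')) (proj D p (iconcat u)) = iconcat (\<lambda>i. aproj D \<pi> p (u i))"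
  unfolding proj_def filter_iconcat map_iconcat aproj_def map_map
  by (rule arg_cong[of _ _ iconcat]) (auto intro!: map_cong)

text \<open>The projection on an inactive \<open>p\<close> is finite and its last state is the one
  at boundary \<open>n\<close>; if \<open>p\<close> never moved at all, this is the initial state,
  as in \<open>satisfies_corr\<close>.\<close>

lemma satisfies_corr_finite:
  assumes r: "block_run D C t u" and \<pi>: "\<pi> p (init_st C p) = init_st A p"
    and n: "\<And>m. m \<ge> n \<Longrightarrow> \<not> touches D (u m) {p}"
  shows "satisfies_corr A K p (iconcat (\<lambda>i. aproj D \<pi> p (u i))) \<longleftrightarrow> \<pi> p (t n p) \<in> fin_ok K p"
proof -
  have "iconcat (\<lambda>i. aproj D \<pi> p (u i)) = Fin (aproj D \<pi> p (concats u n))"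
    unfolding iconcat_Fin_iff concats_aproj using n by (auto simp: aproj_empty_iff)
  moreover have "\<pi> p (t n p) = (if aproj D \<pi> p (concats u n) = [] then init_st A p
      else snd (snd (last (aproj D \<pi> p (concats u n)))))"
    using aproj_end[OF block_run_concats[OF r, of n], of \<pi> p] \<pi> block_run_init[OF r] by simp
  ultimately show ?thesis by simp
qed

lemma correct_coveringD:
  assumes "correct_covering D A K C \<pi>" "block_run D C t u" "block_maximal D C t u" "p \<in> procs D"
  shows "satisfies_corr A K p (iconcat (\<lambda>i. aproj D \<pi> p (u i)))"
proof -
  have "zielonka D C" using assms(1) by (simp add: correct_covering_def covering_def)
  then have "maximal D C (map_iword (\<lambda>(s, a, s'). a) (iconcat u))"
    using block_maximal_maximal assms(2,3) by blast
  moreover have "is_run D C (map_iword (\<lambda>(s, a, s'). a) (iconcat u)) (iconcat u)"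
    using block_run_is_gpath[OF assms(2)] by (simp add: is_run_def)
  ultimately show ?thesis
    using assms(1,4) map_proj_iconcat[of \<pi> p D u] unfolding correct_covering_def by metis
qed

text \<open>
  Uncontrollable actions have to be enabled at reachable global states only: sink states, which
  merely follow the controlled automaton, take care of all other tuples of local states.
\<close>

lemma controllableI:
  fixes C :: "('p, 'a, 'c) zautomaton" and A :: "('p, 'a, 's) zautomaton"
  assumes D: "dist_alphabet D" and A: "zielonka D A" and C: "zielonka D C"
    and \<pi>_st: "\<And>p c. p \<in> procs D \<Longrightarrow> c \<in> st C p \<Longrightarrow> \<pi> p c \<in> st A p"
    and \<pi>_init: "\<And>p. p \<in> procs D \<Longrightarrow> \<pi> p (init_st C p) = init_st A p"
    and hom: "\<And>a c c'. a \<in> acts D \<Longrightarrow> (c, c') \<in> delta C a \<Longrightarrow>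
        ((\<lambda>p\<in>adom D a. \<pi> p (c p)), (\<lambda>p\<in>adom D a. \<pi> p (c' p))) \<in> delta A a"
    and env: "\<And>a s \<rho>. path D C (init_st C) \<rho> s \<Longrightarrow> a \<in> env D \<Longrightarrow>
        (\<lambda>p\<in>adom D a. \<pi> p (s p)) \<in> Domain (delta A a) \<Longrightarrow> enabled D C s a"
    and corr: "\<And>t u p. block_run D C t u \<Longrightarrow> block_maximal D C t u \<Longrightarrow> (\<And>i. length (u i) \<le> 1) \<Longrightarrow> p \<in> procs D \<Longrightarrow>
        satisfies_corr A K p (iconcat (\<lambda>i. aproj D \<pi> p (u i)))"
  shows "controllable D A K"
proof -
  let ?E = "Inl ` (\<Union>p\<in>procs D. st C p) \<union> Inr ` (\<Union>p\<in>procs D. st A p)"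
  have fin: "finite ?E" using D A C by (auto simp: zielonka_def dist_alphabet_def)
  obtain e :: "'c + 's \<Rightarrow> nat" where e: "inj_on e ?E"
    using finite_imp_inj_to_nat_seg[OF fin] by blast
  define d where "d = inv_into ?E e"
  have dC: "d (e (Inl c)) = Inl c" if "p \<in> procs D" "c \<in> st C p" for p c
    unfolding d_def using that by (intro inv_into_f_f[OF e]) auto
  have dA: "d (e (Inr c)) = Inr c" if "p \<in> procs D" "c \<in> st A p" for p c
    unfolding d_def using that by (intro inv_into_f_f[OF e]) auto
  define \<pi>' where "\<pi>' p n = (case d n of Inl c \<Rightarrow> \<pi> p c | Inr s \<Rightarrow> s)" for p n
  define S where "S p = e ` (Inl ` st C p \<union> Inr ` st A p)" for p
  define enc where "enc a x = (\<lambda>p\<in>adom D a. e (Inl (x p)))" for a and x :: "'p \<Rightarrow> 'c"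
  define snk where "snk a x = (\<lambda>p\<in>adom D a. e (Inr (x p)))" for a and x :: "'p \<Rightarrow> 's"
  define m where "m a y = (\<lambda>p\<in>adom D a. \<pi>' p (y p))" for a y
  \<comment> \<open>The second part sends tuples to sinks (\<open>Inr\<close>). It applies only to
    uncontrollable actions and only where \<open>C\<close> has no transition, which keeps the
    relation deterministic and leaves the behaviour of \<open>C\<close> as it is.\<close>
  define \<delta> where "\<delta> a = {(enc a x, enc a x') | x x'. (x, x') \<in> delta C a} \<union>
    {(y, snk a z) | y z. a \<in> env D \<and> y \<in> (\<Pi>\<^sub>E p\<in>adom D a. S p) \<and> y \<notin> enc a ` Domain (delta C a) \<and>
       (m a y, z) \<in> delta A a}" for a
  have \<delta>_cases: "(\<exists>x x'. y = enc a x \<and> z = enc a x' \<and> (x, x') \<in> delta C a) \<or>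
      (\<exists>w. z = snk a w \<and> a \<in> env D \<and> y \<in> (\<Pi>\<^sub>E p\<in>adom D a. S p) \<and> y \<notin> enc a ` Domain (delta C a) \<and>
        (m a y, w) \<in> delta A a)" if "(y, z) \<in> \<delta> a" for y z a
    using that unfolding \<delta>_def by blast
  have \<delta>_enc: "(enc a x, enc a x') \<in> \<delta> a" if "(x, x') \<in> delta C a" for x x' a
    using that unfolding \<delta>_def by blast
  have \<delta>_snk: "(y, snk a z) \<in> \<delta> a" if "a \<in> env D" "y \<in> (\<Pi>\<^sub>E p\<in>adom D a. S p)"
    "y \<notin> enc a ` Domain (delta C a)" "(m a y, z) \<in> delta A a" for y z a
    using that unfolding \<delta>_def by blast
  define C' where "C' = \<lparr>st = S, init_st = (\<lambda>p\<in>procs D. e (Inl (init_st C p))), delta = \<delta>\<rparr>"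
  have dom: "p \<in> procs D" if "a \<in> acts D" "p \<in> adom D a" for a p
    using D that by (auto simp: dist_alphabet_def)
  have Cst: "x \<in> (\<Pi>\<^sub>E p\<in>adom D a. st C p)" "x' \<in> (\<Pi>\<^sub>E p\<in>adom D a. st C p)"
    if "a \<in> acts D" "(x, x') \<in> delta C a" for a x x'
    using C that unfolding zielonka_def by blast+
  have Ast: "x' \<in> (\<Pi>\<^sub>E p\<in>adom D a. st A p)" if "a \<in> acts D" "(x, x') \<in> delta A a" for a x x'
    using A that unfolding zielonka_def by blast
  have encS: "enc a x \<in> (\<Pi>\<^sub>E p\<in>adom D a. S p)" if "x \<in> (\<Pi>\<^sub>E p\<in>adom D a. st C p)" for a x
    using that by (auto simp: enc_def S_def)
  have encI: "x = x'" if a: "a \<in> acts D" and x: "x \<in> (\<Pi>\<^sub>E p\<in>adom D a. st C p)" "x' \<in> (\<Pi>\<^sub>E p\<in>adom D a. st C p)"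
    and eq: "enc a x = enc a x'" for a x x'
  proof (rule PiE_ext[OF x])
    fix p assume p: "p \<in> adom D a"
    have "e (Inl (x p)) = e (Inl (x' p))" using fun_cong[OF eq, of p] p by (simp add: enc_def)
    then have "d (e (Inl (x p))) = d (e (Inl (x' p)))" by simp
    then show "x p = x' p" using dC dom[OF a p] PiE_mem[OF x(1) p] PiE_mem[OF x(2) p] by auto
  qed
  have svC: "single_valued (delta C a)" and svA: "single_valued (delta A a)" if "a \<in> acts D" for a
    using A C that by (auto simp: zielonka_def)
  have C': "zielonka D C'"
    unfolding zielonka_def
  proof (intro conjI ballI)
    fix p assume "p \<in> procs D"
    then show "finite (st C' p)" using A C by (simp add: C'_def S_def zielonka_def)
  next
    have "init_st C p \<in> st C p" if "p \<in> procs D" for p using C that by (auto simp: zielonka_def)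
    then show "init_st C' \<in> (\<Pi>\<^sub>E p\<in>procs D. st C' p)" by (auto simp: C'_def S_def)
  next
    fix a assume a: "a \<in> acts D"
    show "delta C' a \<subseteq> (\<Pi>\<^sub>E p\<in>adom D a. st C' p) \<times> (\<Pi>\<^sub>E p\<in>adom D a. st C' p)"
    proof -
      have snkS: "snk a z \<in> (\<Pi>\<^sub>E p\<in>adom D a. S p)" if "(y, z) \<in> delta A a" for y z
        using Ast[OF a that] by (auto simp: snk_def S_def)
      show ?thesis
      proof
        fix z assume "z \<in> delta C' a"
        then obtain y z' where z: "z = (y, z')" "(y, z') \<in> \<delta> a" by (cases z) (auto simp: C'_def)
        from \<delta>_cases[OF z(2)] show "z \<in> (\<Pi>\<^sub>E p\<in>adom D a. st C' p) \<times> (\<Pi>\<^sub>E p\<in>adom D a. st C' p)"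
        proof (elim disjE exE conjE)
          fix x x' assume x: "y = enc a x" "z' = enc a x'" "(x, x') \<in> delta C a"
          show ?thesis
            using encS[OF Cst(1)[OF a x(3)]] encS[OF Cst(2)[OF a x(3)]] by (simp add: z(1) x C'_def)
        next
          fix w assume w: "z' = snk a w" "y \<in> (\<Pi>\<^sub>E p\<in>adom D a. S p)" "(m a y, w) \<in> delta A a"
          show ?thesis using snkS[OF w(3)] w(2) by (simp add: z(1) w(1) C'_def)
        qed
      qed
    qed
    show "single_valued (delta C' a)"
    proof (rule single_valuedI)
      fix y z z' assume 1: "(y, z) \<in> delta C' a" "(y, z') \<in> delta C' a"
      show "z = z'"
      proof (cases "y \<in> enc a ` Domain (delta C a)")
        case True
        obtain x x1 where x: "y = enc a x" "z = enc a x1" "(x, x1) \<in> delta C a"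
          using 1(1) True \<delta>_cases[of y z a] unfolding C'_def by auto
        obtain w w1 where w: "y = enc a w" "z' = enc a w1" "(w, w1) \<in> delta C a"
          using 1(2) True \<delta>_cases[of y z' a] unfolding C'_def by auto
        have "x = w" using encI[OF a Cst(1)[OF a x(3)] Cst(1)[OF a w(3)]] x w by simp
        then show ?thesis using x w svC[OF a] by (auto simp: single_valued_def)
      next
        case False
        then have no: "(x, x') \<notin> delta C a" if "y = enc a x" for x x' using that by blast
        obtain x where x: "z = snk a x" "(m a y, x) \<in> delta A a"
          using 1(1) no \<delta>_cases[of y z a] unfolding C'_def by auto
        obtain w where w: "z' = snk a w" "(m a y, w) \<in> delta A a"
          using 1(2) no \<delta>_cases[of y z' a] unfolding C'_def by auto
        show ?thesis using x w svA[OF a] by (auto simp: single_valued_def)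
      qed
    qed
  qed
  have m_enc: "m a (enc a x) = (\<lambda>p\<in>adom D a. \<pi> p (x p))"
    if "a \<in> acts D" "x \<in> (\<Pi>\<^sub>E p\<in>adom D a. st C p)" for a x
    unfolding m_def
  proof (rule restrict_ext)
    fix p assume p: "p \<in> adom D a"
    then show "\<pi>' p (enc a x p) = \<pi> p (x p)"
      using dC[OF dom[OF that(1) p] PiE_mem[OF that(2) p]] by (simp add: \<pi>'_def enc_def)
  qed
  have m_snk: "m a (snk a x) = x"
    if "a \<in> acts D" "x \<in> (\<Pi>\<^sub>E p\<in>adom D a. st A p)" for a x
  proof
    fix p
    show "m a (snk a x) p = x p"
    proof (cases "p \<in> adom D a")
      case True
      then show ?thesis
        using dA[OF dom[OF that(1) True] PiE_mem[OF that(2) True]] by (simp add: m_def snk_def \<pi>'_def)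
    next
      case False
      then show ?thesis using PiE_arb[OF that(2) False] by (simp add: m_def)
    qed
  qed
  have cov: "covering D A C' \<pi>'"
    unfolding covering_def
  proof (intro conjI ballI)
    fix p assume p: "p \<in> procs D"
    show "\<pi>' p \<in> st C' p \<rightarrow> st A p"
      using \<pi>_st[OF p] dC[OF p] dA[OF p] by (auto simp: C'_def S_def \<pi>'_def)
    have "init_st C p \<in> st C p" using C p by (auto simp: zielonka_def)
    then show "\<pi>' p (init_st C' p) = init_st A p"
      using p \<pi>_init dC by (simp add: C'_def \<pi>'_def)
  next
    fix a cc assume a: "a \<in> acts D" and cc: "cc \<in> delta C' a"
    obtain c c' where c: "cc = (c, c')" by (cases cc)
    have "(c, c') \<in> \<delta> a" using cc by (simp add: c C'_def)
    from \<delta>_cases[OF this] have "(m a c, m a c') \<in> delta A a"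
    proof (elim disjE exE conjE)
      fix x x' assume x: "c = enc a x" "c' = enc a x'" "(x, x') \<in> delta C a"
      show ?thesis
        using hom[OF a x(3)] m_enc[OF a Cst(1)[OF a x(3)]] m_enc[OF a Cst(2)[OF a x(3)]] by (simp add: x)
    next
      fix w assume w: "c' = snk a w" "(m a c, w) \<in> delta A a"
      show ?thesis using w(2) m_snk[OF a Ast[OF a w(2)]] by (simp add: w(1))
    qed
    then show "case cc of (c, c') \<Rightarrow>
       ((\<lambda>p\<in>adom D a. \<pi>' p (c p)), (\<lambda>p\<in>adom D a. \<pi>' p (c' p))) \<in> delta A a"
      by (simp add: c m_def)
  next
    fix a y assume a: "a \<in> env D" and y: "y \<in> (\<Pi>\<^sub>E p\<in>adom D a. st C' p)"
    show "(\<lambda>p\<in>adom D a. \<pi>' p (y p)) \<in> Domain (delta A a) \<longrightarrow> y \<in> Domain (delta C' a)"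
    proof
      assume "(\<lambda>p\<in>adom D a. \<pi>' p (y p)) \<in> Domain (delta A a)"
      then obtain z where z: "(m a y, z) \<in> delta A a" by (auto simp: m_def)
      show "y \<in> Domain (delta C' a)"
      proof (cases "y \<in> enc a ` Domain (delta C a)")
        case True
        then show ?thesis using \<delta>_enc by (auto simp: C'_def)
      next
        case False
        then show ?thesis using \<delta>_snk[OF a _ False z] y by (auto simp: C'_def)
      qed
    qed
  qed (rule C')
  \<comment> \<open>Reachable states of \<open>C'\<close> are encodings of reachable states of
    \<open>C\<close>, so runs of \<open>C'\<close> never enter a sink.\<close>
  define R where "R s y \<longleftrightarrow> s \<in> (\<Pi>\<^sub>E p\<in>procs D. st C p) \<and> y = (\<lambda>p\<in>procs D. e (Inl (s p)))" for s y
  define dc where "dc y = (\<lambda>p\<in>procs D. projl (d (y p)))" for y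
  have dcR: "s = dc y" if "R s y" for s y
  proof
    fix p
    show "s p = dc y p"
    proof (cases "p \<in> procs D")
      case True
      have "s \<in> (\<Pi>\<^sub>E p\<in>procs D. st C p)" using that by (simp add: R_def)
      from dC[OF True PiE_mem[OF this True]] show ?thesis using that True by (simp add: R_def dc_def)
    next
      case False
      have "s \<in> (\<Pi>\<^sub>E p\<in>procs D. st C p)" using that by (simp add: R_def)
      from PiE_arb[OF this False] show ?thesis using False by (simp add: dc_def)
    qed
  qed
  have renc: "restrict y (adom D a) = enc a (restrict s (adom D a))" if "R s y" "a \<in> acts D" for s y a
    using that dom by (auto simp: R_def enc_def)
  have rst: "restrict s (adom D a) \<in> (\<Pi>\<^sub>E p\<in>adom D a. st C p)" if "R s y" "a \<in> acts D" for s y a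
    using that dom by (auto simp: R_def)
  have step: "\<exists>s'. R s' y' \<and> gtrans D C s a s'"
    if R: "R s y" and g: "gtrans D C' y a y'" and rch: "path D C (init_st C) \<rho> s" for s y a y' \<rho>
  proof -
    have a: "a \<in> acts D" using g by (simp add: gtrans_def)
    have tr: "(enc a (restrict s (adom D a)), restrict y' (adom D a)) \<in> \<delta> a"
      using g renc[OF R a] by (simp add: gtrans_def C'_def)
    \<comment> \<open>A transition to a sink would be uncontrollable and possible in
      \<open>A\<close>; by hypothesis \<open>C\<close> then has its own transition, which excludes
      the one to the sink.\<close>
    have "enabled D C s a" if "a \<in> env D" "m a (enc a (restrict s (adom D a))) \<in> Domain (delta A a)"
    proof (rule env[OF rch that(1)])
      show "(\<lambda>p\<in>adom D a. \<pi> p (s p)) \<in> Domain (delta A a)"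
        using that(2) m_enc[OF a rst[OF R a]] by (simp cong: restrict_cong)
    qed
    then have "\<exists>x x'. (x, x') \<in> delta C a \<and> enc a (restrict s (adom D a)) = enc a x \<and> restrict y' (adom D a) = enc a x'"
      using \<delta>_cases[OF tr] enabled_iff[OF C a, of s] by blast
    then obtain x x' where x: "(x, x') \<in> delta C a" "enc a (restrict s (adom D a)) = enc a x"
      "restrict y' (adom D a) = enc a x'" by blast
    have xs: "x = restrict s (adom D a)" using encI[OF a rst[OF R a] Cst(1)[OF a x(1)] x(2)] by simp
    have x': "x' \<in> (\<Pi>\<^sub>E p\<in>adom D a. st C p)" by (rule Cst[OF a x(1)])
    let ?s' = "override_on s x' (adom D a)"
    have "restrict ?s' (adom D a) = x'" using x' by (auto simp: PiE_def extensional_def)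
    then have gs: "gtrans D C s a ?s'" using x(1) xs a by (simp add: gtrans_def)
    then have "path D C s [(s, a, ?s')] ?s'" by simp
    then have st': "?s' \<in> (\<Pi>\<^sub>E p\<in>procs D. st C p)" using path_tuple[OF D C] R unfolding R_def by blast
    have "y' p = (\<lambda>p\<in>procs D. e (Inl (?s' p))) p" for p
    proof (cases "p \<in> adom D a")
      case True
      then show ?thesis using fun_cong[OF x(3), of p] dom[OF a] by (simp add: enc_def)
    next
      case False
      then show ?thesis using gtrans_outside[OF g False] R by (simp add: R_def)
    qed
    then have "R ?s' y'" using st' by (auto simp: R_def)
    then show ?thesis using gs by blast
  qed
  have "correct_covering D A K C' \<pi>'"
    unfolding correct_covering_def
  proof (intro conjI allI impI ballI cov)
    fix w \<rho> p assume w: "maximal D C' w \<and> is_run D C' w \<rho>" and p: "p \<in> procs D"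
    then have wr: "map_iword (\<lambda>(s, a, s'). a) \<rho> = w" "is_gpath D C' \<rho>" by (auto simp: is_run_def)
    then obtain t u where r: "block_run D C' t u" and \<rho>: "\<rho> = iconcat u" and l: "\<And>i. length (u i) \<le> 1"
      using is_gpath_block_run by blast
    have mx: "block_maximal D C' t u" using maximal_block_maximal[OF r] w wr \<rho> by simp
    let ?t = "\<lambda>i. dc (t i)"
    let ?u = "\<lambda>i. map (\<lambda>(y, a, y'). (dc y, a, dc y')) (u i)"
    have Rt: "R (?t i) (t i) \<and> path D C (init_st C) (concats ?u i) (?t i)" for i
    proof (induction i)
      case 0
      have "R (init_st C) (init_st C')" using C by (simp add: R_def C'_def zielonka_def)
      then show ?case using dcR block_run_init[OF r] by force
    next
      case (Suc i)
      then have R: "R (?t i) (t i)" and g: "path D C (init_st C) (concats ?u i) (?t i)" by auto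
      from single_block[OF block_run_path[OF r, of i] l] show ?case
      proof (elim disjE conjE exE)
        fix a assume a: "u i = [(t i, a, t (Suc i))]" "gtrans D C' (t i) a (t (Suc i))"
        obtain s' where s': "R s' (t (Suc i))" "gtrans D C (?t i) a s'" using step[OF R a(2) g] by blast
        then show ?thesis using dcR[OF s'(1)] g a(1) by (auto simp: path_append)
      qed (use Suc in auto)
    qed
    have stp: "path D C (?t i) (?u i) (?t (Suc i))" for i
    proof -
      obtain s where s: "path D C (init_st C) (concats ?u i) s" "path D C s (?u i) (?t (Suc i))"
        using Rt[of "Suc i"] unfolding concats_Suc path_append by blast
      have "s = ?t i" using path_end[OF s(1)] path_end[of D C "init_st C" "concats ?u i" "?t i"] Rt[of i] by simp
      with s(2) show ?thesis by simp
    qed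
    have r': "block_run D C ?t ?u"
      unfolding block_run_def using stp Rt[of 0] by auto
    have tch: "touches D (?u i) X \<longleftrightarrow> touches D (u i) X" for i X
      by (force simp: touches_def)
    have "block_maximal D C ?t ?u"
      unfolding block_maximal_def tch
    proof (intro allI impI)
      fix i a assume en: "enabled D C (?t i) a"
      have a: "a \<in> acts D" by (rule enabled_acts[OF en])
      have "restrict (?t i) (adom D a) \<in> Domain (delta C a)" using en enabled_iff[OF C a] by simp
      then have "enc a (restrict (?t i) (adom D a)) \<in> Domain (delta C' a)"
        using \<delta>_enc by (auto simp: C'_def)
      then have "enabled D C' (t i) a"
        using enabled_iff[OF C' a] renc[OF _ a, of "?t i" "t i"] Rt by simp
      then show "\<exists>j\<ge>i. touches D (u j) (adom D a)" using mx by (simp add: block_maximal_def)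
    qed
    from corr[OF r' this _ p] have "satisfies_corr A K p (iconcat (\<lambda>i. aproj D \<pi> p (?u i)))"
      using l by simp
    moreover have "aproj D \<pi> p (?u i) = aproj D \<pi>' p (u i)" for i
    proof -
      have "\<pi> p (dc (t j) p) = \<pi>' p (t j p)" for j
      proof -
        have *: "R (?t j) (t j)" using Rt by blast
        then have "t j = (\<lambda>p\<in>procs D. e (Inl (?t j p)))" by (simp add: R_def)
        from fun_cong[OF this, of p] have "t j p = e (Inl (?t j p))" using p by simp
        moreover have "?t j p \<in> st C p" using * p by (auto simp: R_def)
        ultimately show ?thesis using dC[OF p] by (simp add: \<pi>'_def)
      qed
      then show ?thesis using single_block[OF block_run_path[OF r, of i] l] by auto
    qed
    ultimately show "satisfies_corr A K p (map_iword (\<lambda>(c, a, c'). (\<pi>' p c, a, \<pi>' p c')) (proj D p \<rho>))"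
      unfolding \<rho> map_proj_iconcat by simp
  qed
  then show ?thesis unfolding controllable_def by blast
qed

section \<open>The reduced automaton\<close>

text \<open>Extends \<open>q_of\<close> to the states of the other processes, so that all components
  can be read in the same way.\<close>

fun main_of :: "('a, 's) rstate \<Rightarrow> 's" where
  "main_of (Other s) = s"
| "main_of (QR sq sr) = sq"
| "main_of (QRF sq sr f) = sq"
| "main_of (QARF sq a sr f) = sq"

lemma lpath_lists: "lpath D A p s u s' \<Longrightarrow> u \<in> lists (loc_acts D p)"
  by (induction u arbitrary: s) auto

lemma lpath_append: "lpath D A p s (u @ v) s'' \<longleftrightarrow> (\<exists>s'. lpath D A p s u s' \<and> lpath D A p s' v s'')"
  by (induction u arbitrary: s) auto

lemma tup1_eq_iff [simp]: "tup1 p s = tup1 p s' \<longleftrightarrow> s = s'"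
  by (auto simp: tup1_def restrict_def fun_eq_iff)

lemma tup1_same [simp]: "tup1 p s p = s"
  by (simp add: tup1_def)

lemma tup2_simps [simp]: "tup2 p s p' s' p = s" "p' \<noteq> p \<Longrightarrow> tup2 p s p' s' p' = s'"
  by (auto simp: tup2_def)

lemma tup1_PiE_iff: "tup1 p s \<in> (\<Pi>\<^sub>E x\<in>{p}. S x) \<longleftrightarrow> s \<in> S p"
  by (auto simp: tup1_def)

lemma restrict_singleton: "restrict s {p} = tup1 p (s p)"
  by (auto simp: tup1_def restrict_def)

lemma restrict_doubleton: "restrict s {p, p'} = tup2 p (s p) p' (s p')"
  by (auto simp: tup2_def restrict_def)

definition strategies :: "('p, 'a) alphabet \<Rightarrow> ('p, 'a, 's) zautomaton \<Rightarrow> 'p \<Rightarrow> 'a strategy set" where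
  "strategies D A r = {f. \<exists>s\<in>st A r. local_strategy D A r s f}"

lemma finite_local_runs:
  assumes "short_by N D A r" "finite (st A r)" "finite (acts D)"
  shows "finite (local_runs D A r)"
proof -
  have "local_runs D A r \<subseteq> st A r \<times> {u. set u \<subseteq> loc_acts D r \<and> length u \<le> N}"
    using assms(1) lpath_lists by (fastforce simp: local_runs_def short_by_def)
  moreover have "finite (loc_acts D r)" using assms(3) by (simp add: loc_acts_def)
  then have "finite {u. set u \<subseteq> loc_acts D r \<and> length u \<le> N}" by (rule finite_lists_length_le)
  ultimately show ?thesis using assms(2) by (meson finite_SigmaI finite_subset)
qed

text \<open>A strategy is determined by the set of its one-letter prolongations, all of which are local runs.\<close>

lemma strategies_bound:
  assumes "finite (local_runs D A r)"
  shows "finite (strategies D A r)" "card (strategies D A r) \<le> 2 ^ card (local_runs D A r)"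
proof -
  define g where "g f = {v @ [a] | v a. f v = Some a}" for f :: "'b strategy"
  have fin: "finite (Pow (snd ` local_runs D A r))" using assms by simp
  have sub: "g ` strategies D A r \<subseteq> Pow (snd ` local_runs D A r)"
  proof
    fix X assume "X \<in> g ` strategies D A r"
    then obtain f s where f: "X = g f" "s \<in> st A r" "local_strategy D A r s f"
      by (auto simp: strategies_def)
    have "v @ [a] \<in> snd ` local_runs D A r" if "f v = Some a" for v a
    proof
      show "(s, v @ [a]) \<in> local_runs D A r"
        using f that by (auto simp: local_strategy_def local_runs_def)
    qed simp
    then show "X \<in> Pow (snd ` local_runs D A r)" by (auto simp: f(1) g_def)
  qed
  have "inj g"
  proof (rule injI)
    fix f f' assume eq: "g f = g f'"
    have *: "f v = Some a \<longleftrightarrow> v @ [a] \<in> g f" for f v a by (auto simp: g_def)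
    show "f = f'"
    proof
      fix v
      have "f v = Some a \<longleftrightarrow> f' v = Some a" for a using * eq by simp
      then show "f v = f' v" by (metis not_None_eq)
    qed
  qed
  then have inj: "inj_on g (strategies D A r)" by (rule inj_on_subset) simp
  from inj sub fin show "finite (strategies D A r)" by (rule inj_on_finite)
  have "card (strategies D A r) \<le> card (Pow (snd ` local_runs D A r))"
    using inj sub fin by (rule card_inj_on_le)
  also have "\<dots> = 2 ^ card (snd ` local_runs D A r)" using assms by (simp add: card_Pow)
  also have "\<dots> \<le> 2 ^ card (local_runs D A r)" using assms by (simp add: card_image_le)
  finally show "card (strategies D A r) \<le> 2 ^ card (local_runs D A r)" .
qed

section \<open>Domains, alphabet and transitions of the reduced automaton\<close>

locale reduction =
  fixes D :: "('p, 'a) alphabet" and A :: "('p, 'a, 's) zautomaton" and K r q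
  assumes setting: "reduction_setting D A K r q"
begin

abbreviation "Db \<equiv> red_alphabet D A r q"
abbreviation "Ab \<equiv> red_automaton D A r q"
abbreviation "Kb \<equiv> red_condition D A K r q"

lemma D: "dist_alphabet D" and A: "zielonka D A"
  using setting by (auto simp: reduction_setting_def)

lemma r_procs: "r \<in> procs D" and q_procs: "q \<in> procs D" and q_ne_r: "q \<noteq> r" "r \<noteq> q"
proof -
  have "leaf_with_neighbour D r q" using setting by (simp add: reduction_setting_def)
  then have "r \<in> procs D" "comm_edge D r q" by (auto simp: leaf_with_neighbour_def)
  then show "r \<in> procs D" "q \<in> procs D" "q \<noteq> r" "r \<noteq> q" by (auto simp: comm_edge_def)
qed

lemma adom_procs: "a \<in> acts D \<Longrightarrow> p \<in> adom D a \<Longrightarrow> p \<in> procs D"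
  using D by (auto simp: dist_alphabet_def)

lemma adom_two:
  assumes "a \<in> acts D" "p \<in> adom D a" "p' \<in> adom D a" "p \<noteq> p'"
  shows "adom D a = {p, p'}"
proof -
  have "finite (adom D a)" using D assms(1) by (auto simp: dist_alphabet_def intro: finite_subset)
  moreover have "card (adom D a) \<le> card {p, p'}"
    using setting assms by (auto simp: reduction_setting_def)
  ultimately show ?thesis using assms card_seteq[of "adom D a" "{p, p'}"] by auto
qed

text \<open>Any further process in the domain would be a neighbour of the leaf \<open>r\<close>,
  hence is \<open>q\<close>; and domains have at most two elements.\<close>

lemma adom_r:
  assumes "a \<in> acts D" "r \<in> adom D a"
  shows "adom D a = {r} \<or> adom D a = {q, r}"
proof (cases "adom D a = {r}")
  case False
  then obtain p where p: "p \<in> adom D a" "p \<noteq> r" using assms by auto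
  then have "comm_edge D r p" using assms r_procs adom_procs by (auto simp: comm_edge_def)
  then have "p = q" using setting by (auto simp: reduction_setting_def leaf_with_neighbour_def)
  then show ?thesis using adom_two[OF assms(1) p(1) assms(2)] p by simp
qed simp

lemma adom_q:
  assumes "a \<in> acts D" "q \<in> adom D a"
  shows "adom D a = {q} \<or> adom D a = {q, r} \<or> (\<exists>p\<in>procs D. p \<noteq> q \<and> p \<noteq> r \<and> adom D a = {p, q})"
proof (cases "adom D a = {q}")
  case False
  then obtain p where p: "p \<in> adom D a" "p \<noteq> q" using assms by auto
  then have "adom D a = {p, q}" using adom_two assms by blast
  then show ?thesis using adom_procs[OF assms(1) p(1)] p(2) by (cases "p = r") auto
qed simp

lemma sys_acts: "a \<in> sys D \<Longrightarrow> a \<in> acts D"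
  using D by (auto simp: dist_alphabet_def)

lemma sys_local: "a \<in> sys D \<Longrightarrow> p \<in> adom D a \<Longrightarrow> adom D a = {p}"
  using setting by (auto simp: reduction_setting_def)

lemma finite_acts: "finite (acts D)" and finite_st: "p \<in> procs D \<Longrightarrow> finite (st A p)"
  using D A by (auto simp: dist_alphabet_def zielonka_def)

lemma delta_st:
  assumes "a \<in> acts D" "(x, x') \<in> delta A a"
  shows "x \<in> (\<Pi>\<^sub>E p\<in>adom D a. st A p)" "x' \<in> (\<Pi>\<^sub>E p\<in>adom D a. st A p)"
  using A assms unfolding zielonka_def by blast+

lemma delta_det:
  assumes "a \<in> acts D" "(x, x') \<in> delta A a" "(x, x'') \<in> delta A a"
  shows "x' = x''"
  using A assms unfolding zielonka_def single_valued_def by blast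

lemma loc_actsD: "a \<in> loc_acts D p \<Longrightarrow> a \<in> acts D" "a \<in> loc_acts D p \<Longrightarrow> adom D a = {p}"
  by (auto simp: loc_acts_def)

lemma loc_st:
  assumes "a \<in> loc_acts D p" "(tup1 p s, tup1 p s') \<in> delta A a"
  shows "s \<in> st A p" "s' \<in> st A p"
  using delta_st[OF loc_actsD(1)[OF assms(1)] assms(2)] loc_actsD(2)[OF assms(1)] PiE_mem by fastforce+

lemma pair_st:
  assumes "b \<in> acts D" "adom D b = {p, p'}" "p \<noteq> p'" "(tup2 p x p' y, tup2 p x' p' y') \<in> delta A b"
  shows "x \<in> st A p" "y \<in> st A p'" "x' \<in> st A p" "y' \<in> st A p'"
  using PiE_mem[OF delta_st(1)[OF assms(1,4)]] PiE_mem[OF delta_st(2)[OF assms(1,4)]] assms(2,3)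
  by (metis insertCI tup2_simps)+

lemma loc_det:
  assumes "a \<in> loc_acts D p" "(tup1 p s, tup1 p s') \<in> delta A a" "(tup1 p s, tup1 p s'') \<in> delta A a"
  shows "s' = s''"
  using delta_det[OF loc_actsD(1)[OF assms(1)] assms(2,3)] by simp

text \<open>The local run that witnesses a value at \<open>b # v\<close> starts with a step on
  \<open>b\<close>, which by determinism leads to \<open>s'\<close>; its rest is the required run
  from there.\<close>

lemma local_strategy_residual:
  assumes "local_strategy D A r s f" "b \<in> loc_acts D r" "(tup1 r s, tup1 r s') \<in> delta A b"
  shows "local_strategy D A r s' (residual f b)"
  unfolding local_strategy_def residual_def
proof (intro allI impI)
  fix v a assume "f (b # v) = Some a"
  then obtain s2 where "b # v \<in> lists (loc_acts D r)" "a \<in> sys D \<inter> acts_of D r"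
      "lpath D A r s (b # v @ [a]) s2"
    using assms(1) by (fastforce simp: local_strategy_def)
  then show "v \<in> lists (loc_acts D r) \<and> a \<in> sys D \<inter> acts_of D r \<and> (\<exists>s''. lpath D A r s' (v @ [a]) s'')"
    using loc_det[OF assms(2) _ assms(3)] by auto
qed

definition shortness :: nat where "shortness = (SOME N. short_by N D A r)"

lemma short_by_shortness: "short_by shortness D A r"
  using setting someI_ex[of "\<lambda>N. short_by N D A r"]
  by (auto simp: reduction_setting_def short_def shortness_def)

lemma lpath_short: "s \<in> st A r \<Longrightarrow> lpath D A r s u s' \<Longrightarrow> length u \<le> shortness"
  using short_by_shortness by (fastforce simp: short_by_def local_runs_def)

lemma finite_runs: "finite (local_runs D A r)"
  by (rule finite_local_runs[OF short_by_shortness finite_st[OF r_procs] finite_acts])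

lemmas finite_strategies = strategies_bound(1)[OF finite_runs]
lemmas card_strategies = strategies_bound(2)[OF finite_runs]

lemma procs_Db [simp]: "procs Db = procs D - {r}"
  by (simp add: red_alphabet_def)

lemma acts_Db [simp]:
  "Act a \<in> acts Db \<longleftrightarrow> a \<in> acts D"
  "ChF f \<in> acts Db \<longleftrightarrow> f \<in> strategies D A r"
  "ChA a \<in> acts Db \<longleftrightarrow> a \<in> sys D \<and> a \<in> acts_of D q"
  by (auto simp: red_alphabet_def strategies_def)

lemma adom_Db:
  "adom Db (Act a) = (\<lambda>p. if p = r then q else p) ` adom D a"
  "adom Db (ChF f) = {q}"
  "adom Db (ChA a) = {q}"
  by (auto simp: red_alphabet_def)

lemma in_adom_Db: "p \<in> adom Db (Act a) \<longleftrightarrow> p \<noteq> r \<and> (p \<in> adom D a \<or> p = q \<and> r \<in> adom D a)"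
  using q_ne_r by (auto simp: adom_Db)

lemma adom_Db_other: "r \<notin> adom D a \<Longrightarrow> adom Db (Act a) = adom D a"
  by (auto simp: in_adom_Db)

lemma adom_Db_r: "a \<in> acts D \<Longrightarrow> r \<in> adom D a \<Longrightarrow> adom Db (Act a) = {q}"
  using adom_r[of a] q_ne_r by (auto simp: in_adom_Db)

lemma env_Db:
  "Act a \<in> env Db \<longleftrightarrow> a \<in> acts D \<and> (a \<in> env D \<or> q \<in> adom D a \<or> r \<in> adom D a)"
  "ChF f \<notin> env Db"
  "ChA a \<notin> env Db"
  using sys_acts by (auto simp: env_def red_alphabet_def acts_of_def)

lemma Db: "dist_alphabet Db"
  unfolding dist_alphabet_def
proof (intro conjI ballI)
  have "acts Db = Act ` acts D \<union> ChF ` strategies D A r \<union> ChA ` (sys D \<inter> acts_of D q)"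
    by (auto simp: red_alphabet_def strategies_def)
  moreover have "finite (sys D)" using D finite_acts by (auto simp: dist_alphabet_def intro: finite_subset)
  ultimately show "finite (acts Db)" using finite_strategies finite_acts by simp
  show "sys Db \<subseteq> acts Db" using sys_acts by (auto simp: red_alphabet_def)
next
  fix a assume a: "a \<in> acts Db"
  then show "adom Db a \<subseteq> procs Db"
    using q_procs q_ne_r adom_procs by (cases a) (auto simp: adom_Db)
  show "adom Db a \<noteq> {}"
    using a D by (cases a) (auto simp: adom_Db dist_alphabet_def)
qed (use D in \<open>simp add: dist_alphabet_def\<close>)

lemma st_Ab [simp]: "st Ab p = (if p = q then red_qstates D A r q else Other ` st A p)"
  by (simp add: red_automaton_def)

lemma init_Ab: "init_st Ab = (\<lambda>p\<in>procs D - {r}. if p = q then QR (init_st A q) (init_st A r) else Other (init_st A p))"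
  by (simp add: red_automaton_def)

lemma delta_Ab: "(t, t') \<in> delta Ab x \<longleftrightarrow> red_trans D A r q x t t'"
  by (simp add: red_automaton_def)

lemma red_qstates_iff [simp]:
  "QR sq sr \<in> red_qstates D A r q \<longleftrightarrow> sq \<in> st A q \<and> sr \<in> st A r"
  "QRF sq sr f \<in> red_qstates D A r q \<longleftrightarrow> sq \<in> st A q \<and> sr \<in> st A r \<and> local_strategy D A r sr f"
  "QARF sq a sr f \<in> red_qstates D A r q \<longleftrightarrow>
     sq \<in> st A q \<and> a \<in> sys D \<and> a \<in> acts_of D q \<and> sr \<in> st A r \<and> local_strategy D A r sr f"
  "Other s \<notin> red_qstates D A r q"
  by (auto simp: red_qstates_def)

lemma q_of_main [simp]: "x \<in> red_qstates D A r q \<Longrightarrow> q_of x = main_of x"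
  by (cases x) auto

text \<open>The component of the original automaton: the state of \<open>r\<close> is kept by \<open>q\<close>.\<close>

definition base :: "'a \<Rightarrow> ('p \<Rightarrow> ('a, 's) rstate) \<Rightarrow> 'p \<Rightarrow> 's" where
  "base b t = (\<lambda>p\<in>adom D b. if p = r then r_of (t q) else main_of (t p))"

text \<open>The part of the rules for \<open>Act\<close> that concerns the \<open>q\<close>-state.
  Equations such as \<open>x' = QR (main_of x') (r_of x')\<close> fix only the constructor and the
  strategy; the new local states come from the transition of the original automaton on
  \<open>base\<close>.\<close>

definition qstep :: "'a \<Rightarrow> ('a, 's) rstate \<Rightarrow> ('a, 's) rstate \<Rightarrow> bool" where
  "qstep b x x' \<longleftrightarrow> (\<exists>sq a sr f. x = QARF sq a sr f \<and> (b \<in> sys D \<and> q \<in> adom D b \<longrightarrow> b = a) \<and>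
     (if adom D b = {r} then allowed D r f b \<and> x' = QARF sq a (r_of x') (residual f b)
      else if r \<in> adom D b then x' = QR (main_of x') (r_of x')
      else x' = QRF (main_of x') sr f))"

text \<open>Replaces the separate rules for original actions by one description: a transition of
  \<open>A\<close> on the underlying tuple together with a condition on the
  \<open>q\<close>-component. The simulation arguments in both directions rest on this form.\<close>

lemma red_trans_Act_iff:
  "red_trans D A r q (Act b) t t' \<longleftrightarrow> b \<in> acts D \<and>
     t \<in> (\<Pi>\<^sub>E p\<in>adom Db (Act b). st Ab p) \<and> t' \<in> (\<Pi>\<^sub>E p\<in>adom Db (Act b). st Ab p) \<and>
     (base b t, base b t') \<in> delta A b \<and> (q \<in> adom Db (Act b) \<longrightarrow> qstep b (t q) (t' q))"
  (is "?L \<longleftrightarrow> ?R")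
proof
  assume ?L
  then show ?R
  proof cases
    case (other z z')
    have z: "z \<in> (\<Pi>\<^sub>E p\<in>adom D b. st A p)" "z' \<in> (\<Pi>\<^sub>E p\<in>adom D b. st A p)"
      using delta_st other by auto
    have "base b t = z" "base b t' = z'"
      using PiE_arb[OF z(1)] PiE_arb[OF z(2)] other by (auto simp: base_def fun_eq_iff)
    moreover have "t \<in> (\<Pi>\<^sub>E p\<in>adom Db (Act b). st Ab p)" "t' \<in> (\<Pi>\<^sub>E p\<in>adom Db (Act b). st Ab p)"
      using z other by (auto simp: adom_Db_other PiE_mem)
    ultimately show ?thesis using other by (auto simp: in_adom_Db)
  next
    case (q_sys sq sr f sq')
    then have b: "b \<in> acts D" "adom D b = {q}" "b \<in> loc_acts D q"
      using sys_acts sys_local[of b q] by (auto simp: acts_of_def loc_acts_def)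
    then show ?thesis using q_sys q_ne_r loc_st[OF b(3)]
      by (auto simp: base_def qstep_def adom_Db_other tup1_def cong: restrict_cong)
  next
    case (q_env sq a sr f sq')
    then have b: "b \<in> acts D" "adom D b = {q}" "b \<in> loc_acts D q" "b \<notin> sys D"
      by (auto simp: loc_acts_def env_def)
    then show ?thesis using q_env q_ne_r loc_st[OF b(3)]
      by (auto simp: base_def qstep_def adom_Db_other tup1_def cong: restrict_cong)
  next
    case (r_local sq a sr f sr')
    then have b: "b \<in> acts D" "adom D b = {r}"
      by (auto simp: loc_acts_def)
    then show ?thesis using r_local q_ne_r loc_st[OF r_local(4,6)] local_strategy_residual[OF _ r_local(4,6)]
      by (auto simp: base_def qstep_def adom_Db_r tup1_def cong: restrict_cong)
  next
    case (q_with_r sq a sr f sq' sr')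
    then have b: "b \<in> acts D" "adom D b = {q, r}"
      using adom_r[of b] q_ne_r by (auto simp: acts_of_def)
    have "b \<notin> sys D" using sys_local[of b q] b q_ne_r by auto
    moreover have "sq' \<in> st A q" "sr' \<in> st A r"
      by (rule pair_st(3,4)[OF b q_ne_r(1) q_with_r(5)])+
    moreover have "base b t = tup2 q sq r sr" "base b t' = tup2 q sq' r sr'"
      using q_ne_r by (simp_all add: base_def b(2) q_with_r restrict_doubleton)
    ultimately show ?thesis using q_with_r q_ne_r b
      by (auto simp: qstep_def adom_Db_r tup1_def)
  next
    case (q_with_p sq a sr f p sp sp' sq')
    have "b \<notin> sys D" using sys_local[of b q] q_with_p by auto
    moreover have "sq' \<in> st A q" "sp \<in> st A p" "sp' \<in> st A p"
      by (rule pair_st(4,1,3)[OF q_with_p(4,5,6,8)])+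
    moreover have "base b t = tup2 p sp q sq" "base b t' = tup2 p sp' q sq'"
      using q_with_p(6,7) q_ne_r by (simp_all add: base_def q_with_p(1,2,5) restrict_doubleton)
    ultimately show ?thesis using q_with_p q_ne_r
      by (auto simp: qstep_def adom_Db_other tup2_def)
  qed
next
  assume R: ?R
  then have b: "b \<in> acts D" and d: "(base b t, base b t') \<in> delta A b"
    and t: "t \<in> (\<Pi>\<^sub>E p\<in>adom Db (Act b). st Ab p)" "t' \<in> (\<Pi>\<^sub>E p\<in>adom Db (Act b). st Ab p)" by auto
  show ?L
  proof (cases "q \<in> adom Db (Act b)")
    case False
    then have nq: "q \<notin> adom D b" "r \<notin> adom D b" using q_ne_r by (auto simp: in_adom_Db)
    have "t' = (\<lambda>p\<in>adom D b. Other (base b t' p))" if t': "t' \<in> (\<Pi>\<^sub>E p\<in>adom Db (Act b). st Ab p)" for t'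
    proof
      fix p
      show "t' p = (\<lambda>p\<in>adom D b. Other (base b t' p)) p"
        using PiE_mem[OF t', of p] PiE_arb[OF t', of p] nq
        by (cases "p \<in> adom D b") (auto simp: adom_Db_other base_def split: if_splits)
    qed
    then show ?thesis using red_trans.other[OF b nq d] t by simp
  next
    case True
    then have qs: "qstep b (t q) (t' q)" and tq: "t q \<in> red_qstates D A r q" "t' q \<in> red_qstates D A r q"
      using R PiE_mem[OF t(1) True] PiE_mem[OF t(2) True] by auto
    from qs obtain sq a sr f where x: "t q = QARF sq a sr f" "b \<in> sys D \<and> q \<in> adom D b \<longrightarrow> b = a"
      by (auto simp: qstep_def)
    have tqx: "QARF sq a sr f \<in> red_qstates D A r q" using tq(1) unfolding x(1) .
    have sgl: "t' = tup1 q (t' q)" if "adom Db (Act b) = {q}" "t' \<in> (\<Pi>\<^sub>E p\<in>adom Db (Act b). st Ab p)" for t'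
    proof
      fix p
      show "t' p = tup1 q (t' q) p"
        using PiE_arb[OF that(2), of p] that(1) by (cases "p = q") (auto simp: tup1_def)
    qed
    show ?thesis
    proof (cases "r \<in> adom D b")
      case rT: True
      note s = sgl[OF adom_Db_r[OF b rT]]
      consider "adom D b = {r}" | "adom D b = {q, r}" using adom_r[OF b rT] by blast
      then show ?thesis
      proof cases
        case 1
        then have x': "allowed D r f b" "t' q = QARF sq a (r_of (t' q)) (residual f b)"
          using qs x by (auto simp: qstep_def)
        have "base b t = tup1 r sr" "base b t' = tup1 r (r_of (t' q))"
          by (simp_all add: base_def 1 restrict_singleton x(1))
        then have "red_trans D A r q (Act b) (tup1 q (QARF sq a sr f)) (tup1 q (QARF sq a (r_of (t' q)) (residual f b)))"
          using 1 x' d b by (intro red_trans.r_local[OF tqx]) (auto simp: loc_acts_def)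
        then show ?thesis using s[OF t(1)] s[OF t(2)] x x' by metis
      next
        case 2
        then have x': "t' q = QR (main_of (t' q)) (r_of (t' q))"
          using qs x q_ne_r by (auto simp: qstep_def doubleton_eq_iff)
        have "base b t = tup2 q sq r sr" "base b t' = tup2 q (main_of (t' q)) r (r_of (t' q))"
          using q_ne_r by (simp_all add: base_def 2 restrict_doubleton x(1))
        then have "red_trans D A r q (Act b) (tup1 q (QARF sq a sr f)) (tup1 q (QR (main_of (t' q)) (r_of (t' q))))"
          using 2 d b by (intro red_trans.q_with_r[OF tqx]) (auto simp: acts_of_def)
        then show ?thesis using s[OF t(1)] s[OF t(2)] x x' by metis
      qed
    next
      case rF: False
      then have qb: "q \<in> adom D b" using True by (auto simp: in_adom_Db)
      have "adom D b \<noteq> {r}" using rF by auto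
      then have x': "t' q = QRF (main_of (t' q)) sr f"
        using qs x(1) rF by (simp add: qstep_def)
      consider "adom D b = {q}" | p where "p \<in> procs D" "p \<noteq> q" "p \<noteq> r" "adom D b = {p, q}"
        using adom_q[OF b qb] rF by auto
      then show ?thesis
      proof cases
        case 1
        then have ad: "adom Db (Act b) = {q}" using rF adom_Db_other by simp
        note s = sgl[OF ad]
        have bs: "base b t = tup1 q sq" "base b t' = tup1 q (main_of (t' q))"
          using q_ne_r by (simp_all add: base_def 1 restrict_singleton x(1))
        have "red_trans D A r q (Act b) (tup1 q (QARF sq a sr f)) (tup1 q (QRF (main_of (t' q)) sr f))"
        proof (cases "b \<in> sys D")
          case True
          then have "b = a" using x qb by simp
          moreover have "(tup1 q sq, tup1 q (main_of (t' q))) \<in> delta A b" using d bs by simp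
          ultimately show ?thesis using red_trans.q_sys[OF tqx] by simp
        next
          case False
          then have "b \<in> env D \<inter> loc_acts D q" using b 1 by (simp add: env_def loc_acts_def)
          moreover have "(tup1 q sq, tup1 q (main_of (t' q))) \<in> delta A b" using d bs by simp
          ultimately show ?thesis using red_trans.q_env[OF tqx] by simp
        qed
        then show ?thesis using s[OF t(1)] s[OF t(2)] x x' by metis
      next
        case (2 p)
        have ad: "adom Db (Act b) = {p, q}" using rF 2 adom_Db_other by simp
        have *: "t' = tup2 p (Other (main_of (t' p))) q (t' q)"
          if "t' \<in> (\<Pi>\<^sub>E p\<in>adom Db (Act b). st Ab p)" for t'
        proof
          fix z
          show "t' z = tup2 p (Other (main_of (t' p))) q (t' q) z"
            using PiE_mem[OF that, of p] PiE_arb[OF that, of z] ad 2 by (auto simp: tup2_def)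
        qed
        have bs: "base b t' = tup2 p (main_of (t' p)) q (main_of (t' q))" for t'
          using 2(3) q_ne_r by (simp add: base_def 2(4) restrict_doubleton)
        have "red_trans D A r q (Act b) (tup2 p (Other (main_of (t p))) q (QARF sq a sr f))
            (tup2 p (Other (main_of (t' p))) q (QRF (main_of (t' q)) sr f))"
          using d[unfolded bs] b 2 x(1) by (intro red_trans.q_with_p[OF tqx]) auto
        then show ?thesis using *[OF t(1)] *[OF t(2)] x x' by metis
      qed
    qed
  qed
qed

lemma red_trans_ChF_iff:
  "red_trans D A r q (ChF f) t t' \<longleftrightarrow> (\<exists>sq sr. sq \<in> st A q \<and> sr \<in> st A r \<and> local_strategy D A r sr f \<and>
     t = tup1 q (QR sq sr) \<and> t' = tup1 q (QRF sq sr f))"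
  by (rule iffI, erule red_trans.cases) (auto intro: red_trans.choose_strategy)

lemma red_trans_ChA_iff:
  "red_trans D A r q (ChA a) t t' \<longleftrightarrow> (\<exists>sq sr f. sq \<in> st A q \<and> sr \<in> st A r \<and> local_strategy D A r sr f \<and>
     a \<in> sys D \<and> a \<in> acts_of D q \<and> t = tup1 q (QRF sq sr f) \<and> t' = tup1 q (QARF sq a sr f))"
  by (rule iffI, erule red_trans.cases) (auto intro: red_trans.choose_action)

lemma qstep_det:
  assumes "qstep b x y" "qstep b x y'" "q \<in> adom D b \<Longrightarrow> main_of y = main_of y'"
    "r \<in> adom D b \<Longrightarrow> r_of y = r_of y'" "q \<in> adom D b \<or> r \<in> adom D b" "b \<in> acts D"
  shows "y = y'"
proof -
  have "adom D b \<noteq> {r} \<Longrightarrow> q \<in> adom D b" using assms(5) adom_r[OF assms(6)] by auto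
  then show ?thesis using assms(1-4) unfolding qstep_def by (auto split: if_splits)
qed

lemma finite_qstates: "finite (red_qstates D A r q)"
proof -
  let ?F = "strategies D A r"
  have "red_qstates D A r q \<subseteq> (\<lambda>(x, y). QR x y) ` (st A q \<times> st A r) \<union>
      (\<lambda>(x, y, f). QRF x y f) ` (st A q \<times> st A r \<times> ?F) \<union>
      (\<lambda>(x, a, y, f). QARF x a y f) ` (st A q \<times> acts D \<times> st A r \<times> ?F)"
    by (auto simp: red_qstates_def strategies_def acts_of_def image_iff)
  then show ?thesis
    using finite_strategies finite_acts finite_st[OF q_procs] finite_st[OF r_procs]
    by (auto intro: finite_subset)
qed

lemma Ab: "zielonka Db Ab"
  unfolding zielonka_def
proof (intro conjI ballI)
  fix p assume "p \<in> procs Db"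
  then show "finite (st Ab p)" using finite_qstates finite_st by simp
next
  have "init_st A p \<in> st A p" if "p \<in> procs D" for p using A that by (auto simp: zielonka_def)
  then show "init_st Ab \<in> (\<Pi>\<^sub>E p\<in>procs Db. st Ab p)" using q_procs r_procs by (auto simp: init_Ab)
next
  fix x assume x: "x \<in> acts Db"
  show "delta Ab x \<subseteq> (\<Pi>\<^sub>E p\<in>adom Db x. st Ab p) \<times> (\<Pi>\<^sub>E p\<in>adom Db x. st Ab p)"
  proof (cases x)
    case (Act b)
    then show ?thesis using red_trans_Act_iff[of b] by (auto simp: delta_Ab simp del: st_Ab)
  next
    case (ChF f)
    then show ?thesis
      by (clarsimp simp: delta_Ab red_trans_ChF_iff adom_Db simp del: PiE_iff) (simp add: tup1_PiE_iff)
  next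
    case (ChA a)
    then show ?thesis
      by (clarsimp simp: delta_Ab red_trans_ChA_iff adom_Db simp del: PiE_iff) (simp add: tup1_PiE_iff)
  qed
  show "single_valued (delta Ab x)"
  proof (rule single_valuedI)
    fix t t1 t2 assume 1: "(t, t1) \<in> delta Ab x" "(t, t2) \<in> delta Ab x"
    show "t1 = t2"
    proof (cases x)
      case (Act b)
      note R = 1[unfolded delta_Ab Act red_trans_Act_iff]
      have t: "t1 \<in> (\<Pi>\<^sub>E p\<in>adom Db (Act b). st Ab p)" "t2 \<in> (\<Pi>\<^sub>E p\<in>adom Db (Act b). st Ab p)"
        and b: "b \<in> acts D" using R by auto
      have eq: "base b t1 = base b t2" using R delta_det[OF b] by blast
      show ?thesis
      proof (rule PiE_ext[OF t])
        fix p assume p: "p \<in> adom Db (Act b)"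
        show "t1 p = t2 p"
        proof (cases "p = q")
          case True
          have "qstep b (t q) (t1 q)" "qstep b (t q) (t2 q)" using R p True by auto
          moreover have "q \<in> adom D b \<Longrightarrow> main_of (t1 q) = main_of (t2 q)"
            "r \<in> adom D b \<Longrightarrow> r_of (t1 q) = r_of (t2 q)"
            using fun_cong[OF eq, of q] fun_cong[OF eq, of r] q_ne_r by (auto simp: base_def)
          ultimately show ?thesis using qstep_det[of b "t q" "t1 q" "t2 q"] p True b
            by (auto simp: in_adom_Db)
        next
          case False
          then have "p \<in> adom D b" "p \<noteq> r" using p by (auto simp: in_adom_Db)
          then have "main_of (t1 p) = main_of (t2 p)" using fun_cong[OF eq, of p] by (simp add: base_def)
          then show ?thesis using PiE_mem[OF t(1) p] PiE_mem[OF t(2) p] False by auto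
        qed
      qed
    next
      case (ChF f)
      then show ?thesis using 1 by (auto simp: delta_Ab red_trans_ChF_iff)
    next
      case (ChA f)
      then show ?thesis using 1 by (auto simp: delta_Ab red_trans_ChA_iff)
    qed
  qed
qed

end

section \<open>Bounded counters, tails of runs and blockwise projections\<close>

lemma eventually_const_nat:
  fixes f :: "nat \<Rightarrow> nat"
  assumes "mono f" "\<And>n. f n \<le> B"
  shows "\<exists>n. \<forall>m\<ge>n. f m = f n"
proof -
  obtain n where "\<forall>m. f m \<le> f n"
    using ex_has_greatest_nat[of "\<lambda>_. True" 0 f "Suc B"] assms(2) by (auto simp: le_imp_less_Suc)
  then have "\<forall>m\<ge>n. f m = f n" using assms(1) by (meson antisym monoD)
  then show ?thesis by blast
qed

text \<open>Letters beyond position \<open>length (concats u n)\<close> come from later blocks. This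
  relates "almost all positions" of an infinite word to "almost all blocks".\<close>

lemma iconcat_tail:
  assumes "iconcat u = Inf w"
  shows "\<exists>k. \<forall>i\<ge>k. \<exists>j\<ge>n. w i \<in> set (u j)"
proof -
  have W: "Inf w = conc_iword (concats u n) (iconcat (\<lambda>i. u (i + n)))"
    using iconcat_split[of u n] assms by simp
  then obtain w' where w': "iconcat (\<lambda>i. u (i + n)) = Inf w'"
    by (cases "iconcat (\<lambda>i. u (i + n))") auto
  have "\<exists>j\<ge>n. w i \<in> set (u j)" if "i \<ge> length (concats u n)" for i
  proof -
    have "w i = w' (i - length (concats u n))" using W w' that by (auto simp: conc_def)
    then have "w i \<in> (\<Union>i. set (u (i + n)))" using set_iconcat[of "\<lambda>i. u (i + n)"] w' by auto
    then show ?thesis by (metis UN_E le_add2)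
  qed
  then show ?thesis by blast
qed

lemma lpath_path:
  assumes "lpath D C p c v c'" "s p = c"
  shows "\<exists>\<rho>. path D C s \<rho> (s(p := c')) \<and> map lab \<rho> = v \<and> (\<forall>(x, a, x')\<in>set \<rho>. adom D a = {p} \<and> a \<in> loc_acts D p)"
  using assms
proof (induction v arbitrary: c s)
  case (Cons a v)
  then obtain d where a: "a \<in> loc_acts D p" and d: "(tup1 p c, tup1 p d) \<in> delta C a" "lpath D C p d v c'" by auto
  have ad: "a \<in> acts D" "adom D a = {p}" using a by (auto simp: loc_acts_def)
  have g: "gtrans D C s a (s(p := d))" using ad d Cons.prems by (simp add: gtrans_def restrict_singleton)
  obtain \<rho> where \<rho>: "path D C (s(p := d)) \<rho> (s(p := c'))" "map lab \<rho> = v"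
    "\<forall>(x, a, x')\<in>set \<rho>. adom D a = {p} \<and> a \<in> loc_acts D p"
    using Cons.IH[OF d(2), of "s(p := d)"] unfolding fun_upd_upd fun_upd_same by blast
  show ?case
  proof (intro exI conjI)
    show "path D C s ((s, a, s(p := d)) # \<rho>) (s(p := c'))" unfolding path.simps using \<rho>(1) g by blast
  qed (use \<rho> ad a in auto)
next
  case Nil
  then have "s(p := c') = s" by auto
  then have "path D C s [] (s(p := c'))" by simp
  then show ?case using Nil by (intro exI[of _ "[]"]) simp
qed

lemma block_run_touch_step:
  assumes "block_run D C t u" "length (u i) \<le> 1"
  shows "(u i = [] \<and> t (Suc i) = t i) \<or> (\<exists>a. u i = [(t i, a, t (Suc i))] \<and> gtrans D C (t i) a (t (Suc i)))"
  using single_block[OF block_run_path[OF assms(1)] assms(2)] by blast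

lemma aproj_insert:
  assumes "p \<notin> X" "\<And>s a s'. (s, a, s') \<in> set w \<Longrightarrow> adom D a \<subseteq> X"
  shows "aproj D \<pi> p (insert_block n X z w u i) = aproj D \<pi> p (u i)"
proof -
  have "aproj D \<pi> p w = []" unfolding aproj_empty_iff using assms by (auto simp: touches_def)
  moreover have "aproj D \<pi> p (map (ovstep X z) \<rho>) = aproj D \<pi> p \<rho>" for \<rho>
    using assms(1) by (induction \<rho>) (auto simp: ovstep_def override_on_def)
  ultimately show ?thesis by (simp add: insert_block_def)
qed

text \<open>The version of \<open>red_proj\<close> for finite words, so that it can be applied to
  single blocks (\<open>red_proj_iconcat\<close>).\<close>

definition rproj :: "('p, 'a) alphabet \<Rightarrow> 'p \<Rightarrow> (('a, 's) rstate \<Rightarrow> 's) \<Rightarrow>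
    (('a, 's) rstate \<times> 'a raction \<times> ('a, 's) rstate) list \<Rightarrow> ('s \<times> 'a \<times> 's) list" where
  "rproj D p sel l = map (\<lambda>(x, b, x'). (sel x, act_of b, sel x'))
     (filter (\<lambda>(x, b, x'). \<exists>a\<in>acts_of D p. b = Act a) l)"

lemma rproj_Nil [simp]: "rproj D p sel [] = []"
  by (simp add: rproj_def)

lemma rproj_Cons [simp]: "rproj D p sel ((x, b, x') # l) =
    (if \<exists>a\<in>acts_of D p. b = Act a then (sel x, act_of b, sel x') # rproj D p sel l else rproj D p sel l)"
  by (simp add: rproj_def)

lemma rproj_append [simp]: "rproj D p sel (l @ l') = rproj D p sel l @ rproj D p sel l'"
  by (simp add: rproj_def)

lemma red_proj_iconcat:
  assumes "iconcat v = Inf w"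
  shows "red_proj D p sel w = iconcat (\<lambda>i. rproj D p sel (v i))"
  unfolding red_proj_def rproj_def assms[symmetric] filter_iconcat map_iconcat ..

definition lift_step :: "'s \<times> 'a \<times> 's \<Rightarrow> ('a, 's) rstate \<times> 'a raction \<times> ('a, 's) rstate" where
  "lift_step = (\<lambda>(s, a, s'). (Other s, Act a, Other s'))"

lemma inj_lift_step: "inj lift_step"
  by (auto simp: inj_def lift_step_def)

context reduction
begin

text \<open>For these processes the reduced condition is the original one under the injective
  recoding \<open>lift_step\<close>, so correctness can be moved both ways.\<close>

lemma corr_other:
  assumes "p \<in> procs D" "p \<noteq> q" "p \<noteq> r"
  shows "satisfies_corr Ab Kb p (iconcat (\<lambda>i. map lift_step (v i))) \<longleftrightarrow> satisfies_corr A K p (iconcat v)"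
proof (cases "iconcat v")
  case (Fin x)
  then have "iconcat (\<lambda>i. map lift_step (v i)) = Fin (map lift_step x)"
    using map_iconcat[of lift_step v] by simp
  moreover have "snd (snd (last (map lift_step x))) = Other (snd (snd (last x)))" if "x \<noteq> []"
    using that by (simp add: last_map lift_step_def split_beta)
  ultimately show ?thesis
    using Fin assms by (auto simp: red_condition_def init_Ab)
next
  case (Inf w)
  then have *: "iconcat (\<lambda>i. map lift_step (v i)) = Inf (\<lambda>i. lift_step (w i))"
    using map_iconcat[of lift_step v] by (simp add: comp_def)
  have "(\<lambda>i. lift_step (w i)) \<in> (\<lambda>w i. lift_step (w i)) ` inf_ok K p \<longleftrightarrow> w \<in> inf_ok K p"
  proof
    assume "(\<lambda>i. lift_step (w i)) \<in> (\<lambda>w i. lift_step (w i)) ` inf_ok K p"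
    then obtain w' where w': "w' \<in> inf_ok K p" "(\<lambda>i. lift_step (w i)) = (\<lambda>i. lift_step (w' i))" by blast
    have "w i = w' i" for i using injD[OF inj_lift_step fun_cong[OF w'(2), of i]] .
    then have "w = w'" ..
    then show "w \<in> inf_ok K p" using w'(1) by simp
  qed auto
  moreover have "inf_ok Kb p = (\<lambda>w i. lift_step (w i)) ` inf_ok K p"
    using assms by (simp add: red_condition_def lift_step_def split_beta)
  ultimately show ?thesis using * Inf by simp
qed

lemma follows_lpath: "follows D A r s f u s' \<Longrightarrow> lpath D A r s u s'"
  by (induction u arbitrary: s f) (auto simp: allowed_def)

text \<open>Sequences respecting \<open>f\<close> are local runs of \<open>r\<close>, hence bounded
  by \<open>shortness\<close>; a longest one is maximal.\<close>

lemma ex_maximal_respecting: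
  assumes "s \<in> st A r"
  shows "\<exists>u s'. maximal_respecting D A r s f u s'"
proof -
  let ?P = "\<lambda>(u, s'). follows D A r s f u s'"
  have "?P ([], s)" by simp
  moreover have "\<forall>y. ?P y \<longrightarrow> length (fst y) < Suc shortness"
    using follows_lpath[of s f] lpath_short[OF assms] unfolding less_Suc_eq_le by auto
  ultimately obtain x where x: "?P x" "\<forall>y. ?P y \<longrightarrow> length (fst y) \<le> length (fst x)"
    using ex_has_greatest_nat[of ?P "([], s)" "length \<circ> fst" "Suc shortness"] by auto
  then have "maximal_respecting D A r s f (fst x) (snd x)"
    unfolding maximal_respecting_def by (fastforce simp: split_beta)
  then show ?thesis by blast
qed

end

section \<open>From a controller to a controller of the reduced automaton\<close>

text \<open>Stages 0, 1, 2 correspond to \<open>QR\<close>, \<open>QRF\<close>, \<open>QARF\<close>.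
  The strategy and the announced action are not stored, since \<open>strat\<close> and
  \<open>ann\<close> compute them from the two controller states.\<close>

datatype 'c joint = Plain (main_c: 'c) | Joint (stage: nat) (main_c: 'c) (r_c: 'c)

locale reduction_forward = reduction D A K r q
  for D :: "('p, 'a) alphabet" and A :: "('p, 'a, 's) zautomaton" and K r q +
  fixes C :: "('p, 'a, 'c) zautomaton" and \<pi>
  assumes correct: "correct_covering D A K C \<pi>" and idle: "can_idle D A q"
begin

lemma cov: "covering D A C \<pi>" and C: "zielonka D C"
  using correct by (auto simp: correct_covering_def covering_def)

lemma \<pi>_st: "p \<in> procs D \<Longrightarrow> c \<in> st C p \<Longrightarrow> \<pi> p c \<in> st A p"
  and \<pi>_init: "p \<in> procs D \<Longrightarrow> \<pi> p (init_st C p) = init_st A p"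
  using cov by (auto simp: covering_def)

lemma C_hom:
  assumes "a \<in> acts D" "(c, c') \<in> delta C a"
  shows "((\<lambda>p\<in>adom D a. \<pi> p (c p)), (\<lambda>p\<in>adom D a. \<pi> p (c' p))) \<in> delta A a"
  using cov assms unfolding covering_def by blast

lemma C_env:
  assumes "a \<in> env D" "c \<in> (\<Pi>\<^sub>E p\<in>adom D a. st C p)" "(\<lambda>p\<in>adom D a. \<pi> p (c p)) \<in> Domain (delta A a)"
  shows "c \<in> Domain (delta C a)"
  using cov assms unfolding covering_def by blast

lemma C_st:
  assumes "a \<in> acts D" "(x, x') \<in> delta C a"
  shows "x \<in> (\<Pi>\<^sub>E p\<in>adom D a. st C p)" "x' \<in> (\<Pi>\<^sub>E p\<in>adom D a. st C p)"
  using C assms unfolding zielonka_def by blast+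

lemma C_det:
  assumes "a \<in> acts D" "(x, x') \<in> delta C a" "(x, x'') \<in> delta C a"
  shows "x' = x''"
  using C assms unfolding zielonka_def single_valued_def by blast

lemma tup1_map: "(\<lambda>p\<in>{p'}. \<pi> p (tup1 p' c p)) = tup1 p' (\<pi> p' c)"
  by (simp add: restrict_singleton)

lemma C_loc_hom:
  assumes "a \<in> loc_acts D p" "(tup1 p c, tup1 p c') \<in> delta C a"
  shows "(tup1 p (\<pi> p c), tup1 p (\<pi> p c')) \<in> delta A a"
  using C_hom[OF loc_actsD(1)[OF assms(1)] assms(2)] loc_actsD(2)[OF assms(1)] by (simp add: tup1_map)

lemma C_loc_det:
  assumes "a \<in> loc_acts D p" "(tup1 p c, tup1 p c') \<in> delta C a" "(tup1 p c, tup1 p c'') \<in> delta C a"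
  shows "c' = c''"
  using C_det[OF loc_actsD(1)[OF assms(1)] assms(2,3)] by simp

lemma C_loc_dom:
  assumes "a \<in> loc_acts D p" "tup1 p c \<in> Domain (delta C a)"
  obtains c' where "(tup1 p c, tup1 p c') \<in> delta C a" "c' \<in> st C p"
proof -
  obtain x where x: "(tup1 p c, x) \<in> delta C a" using assms(2) by blast
  have "x \<in> (\<Pi>\<^sub>E p\<in>{p}. st C p)" using C_st(2)[OF loc_actsD(1)[OF assms(1)] x] loc_actsD(2)[OF assms(1)] by simp
  then have "x = tup1 p (x p)" "x p \<in> st C p"
    using PiE_restrict[of x "{p}"] restrict_singleton[of x p] by auto
  with x that show ?thesis by metis
qed

lemma C_lpath: "lpath D C r c u c' \<Longrightarrow> lpath D A r (\<pi> r c) u (\<pi> r c')"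
  by (induction u arbitrary: c) (auto dest: C_loc_hom)

section \<open>Strategies and announcements read off a controller\<close>

definition rsys :: "'c \<Rightarrow> 'a \<Rightarrow> bool" where
  "rsys c a \<longleftrightarrow> a \<in> sys D \<and> a \<in> loc_acts D r \<and> tup1 r c \<in> Domain (delta C a)"

text \<open>Among the controllable actions offered to \<open>r\<close> after \<open>v\<close>, one
  is chosen. The choice depends only on the controller states reached on \<open>v\<close>, so the
  residual of such a strategy is the strategy of the successor state
  (\<open>strat_residual\<close>).\<close>

definition strat :: "'c \<Rightarrow> 'a strategy" where
  "strat c v = (if \<exists>a c'. lpath D C r c v c' \<and> rsys c' a
     then Some (SOME a. \<exists>c'. lpath D C r c v c' \<and> rsys c' a) else None)"

text \<open>When the controller offers \<open>q\<close> no controllable action, a disabled one is announced.\<close>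

definition ann :: "'c \<Rightarrow> 'a" where
  "ann c = (if \<exists>a. a \<in> sys D \<and> a \<in> loc_acts D q \<and> tup1 q c \<in> Domain (delta C a)
     then SOME a. a \<in> sys D \<and> a \<in> loc_acts D q \<and> tup1 q c \<in> Domain (delta C a)
     else SOME a. a \<in> sys D \<inter> acts_of D q \<and> tup1 q (\<pi> q c) \<notin> Domain (delta A a))"

lemma strat_Some: "strat c v = Some a \<Longrightarrow> \<exists>c'. lpath D C r c v c' \<and> rsys c' a"
  unfolding strat_def using someI_ex[of "\<lambda>a. \<exists>c'. lpath D C r c v c' \<and> rsys c' a"]
  by (auto split: if_splits)

lemma strat_local_strategy: "local_strategy D A r (\<pi> r c) (strat c)"
  unfolding local_strategy_def
proof (intro allI impI)
  fix v a assume "strat c v = Some a"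
  then obtain c' where c': "lpath D C r c v c'" "rsys c' a" using strat_Some by blast
  then obtain d where "(tup1 r c', tup1 r d) \<in> delta C a" using C_loc_dom unfolding rsys_def by metis
  then have "lpath D C r c (v @ [a]) d" using c' by (auto simp: lpath_append rsys_def)
  then show "v \<in> lists (loc_acts D r) \<and> a \<in> sys D \<inter> acts_of D r \<and> (\<exists>s'. lpath D A r (\<pi> r c) (v @ [a]) s')"
    using c' lpath_lists C_lpath by (fastforce simp: rsys_def acts_of_def loc_acts_def)
qed

lemma strat_residual:
  assumes "b \<in> loc_acts D r" "(tup1 r c, tup1 r c') \<in> delta C b"
  shows "residual (strat c) b = strat c'"
proof
  fix v
  have "lpath D C r c (b # v) d \<longleftrightarrow> lpath D C r c' v d" for d
    unfolding lpath.simps using assms C_loc_det[OF assms] by blast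
  then show "residual (strat c) b v = strat c' v"
    unfolding residual_def strat_def by (simp del: lpath.simps)
qed

text \<open>The action \<open>a\<close> itself may have lost against the choice made by
  \<open>strat\<close>, but then the chosen one is available. Having some allowed action of
  \<open>r\<close> is enough, as fairness asks only for an action with domain
  \<open>{r}\<close>.\<close>

lemma r_progress:
  assumes "a \<in> loc_acts D r" "tup1 r c \<in> Domain (delta C a)"
  shows "\<exists>b c'. b \<in> loc_acts D r \<and> allowed D r (strat c) b \<and> (tup1 r c, tup1 r c') \<in> delta C b"
proof (cases "a \<in> sys D")
  case True
  then have "rsys c a" using assms by (simp add: rsys_def)
  then have "\<exists>a c'. lpath D C r c [] c' \<and> rsys c' a" by auto
  then obtain b where b: "strat c [] = Some b" by (simp add: strat_def)
  then have "rsys c b" using strat_Some by fastforce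
  then show ?thesis using b C_loc_dom unfolding rsys_def allowed_def by metis
next
  case False
  then have "allowed D r (strat c) a" using assms by (auto simp: allowed_def env_def loc_acts_def)
  then show ?thesis using assms C_loc_dom by metis
qed

lemma ann_sys: "c \<in> st C q \<Longrightarrow> ann c \<in> sys D \<and> ann c \<in> acts_of D q"
proof (cases "\<exists>a. a \<in> sys D \<and> a \<in> loc_acts D q \<and> tup1 q c \<in> Domain (delta C a)")
  case True
  then show ?thesis using someI_ex[OF True] unfolding ann_def by (auto simp: acts_of_def loc_acts_def)
next
  case False
  assume "c \<in> st C q"
  then have "\<exists>a. a \<in> sys D \<inter> acts_of D q \<and> tup1 q (\<pi> q c) \<notin> Domain (delta A a)"
    using idle \<pi>_st[OF q_procs] unfolding can_idle_def by blast
  from someI_ex[OF this] False show ?thesis unfolding ann_def by auto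
qed

text \<open>Both parts follow the case split of \<open>ann\<close>: a chosen action is enabled in
  \<open>C\<close>, and the fallback is disabled in \<open>A\<close>. The second part ensures that
  the announced action, uncontrollable in the reduced automaton, is never possible there while
  \<open>C\<close> refuses it.\<close>

lemma ann_enabled:
  assumes "c \<in> st C q"
  shows "(\<exists>a. a \<in> sys D \<and> a \<in> loc_acts D q \<and> tup1 q c \<in> Domain (delta C a)) \<Longrightarrow> tup1 q c \<in> Domain (delta C (ann c))"
    and "tup1 q (\<pi> q c) \<in> Domain (delta A (ann c)) \<Longrightarrow> tup1 q c \<in> Domain (delta C (ann c))"
proof -
  show 1: "tup1 q c \<in> Domain (delta C (ann c))"
    if "\<exists>a. a \<in> sys D \<and> a \<in> loc_acts D q \<and> tup1 q c \<in> Domain (delta C a)"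
    using someI_ex[OF that] that unfolding ann_def by auto
  have "\<exists>a. a \<in> sys D \<inter> acts_of D q \<and> tup1 q (\<pi> q c) \<notin> Domain (delta A a)"
    using idle \<pi>_st[OF q_procs assms] unfolding can_idle_def by blast
  from someI_ex[OF this]
  have "tup1 q (\<pi> q c) \<notin> Domain (delta A (ann c))"
    if "\<not> (\<exists>a. a \<in> sys D \<and> a \<in> loc_acts D q \<and> tup1 q c \<in> Domain (delta C a))"
    unfolding ann_def if_not_P[OF that] by blast
  with 1 show "tup1 q (\<pi> q c) \<in> Domain (delta A (ann c)) \<Longrightarrow> tup1 q c \<in> Domain (delta C (ann c))"
    by blast
qed

section \<open>The controller in which \<open>q\<close> carries the states of \<open>q\<close> and
  \<open>r\<close>\<close>

definition \<pi>b :: "'p \<Rightarrow> 'c joint \<Rightarrow> ('a, 's) rstate" where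
  "\<pi>b p x = (case x of Plain c \<Rightarrow> Other (\<pi> p c)
     | Joint k c d \<Rightarrow> if k = 0 then QR (\<pi> q c) (\<pi> r d)
         else if k = 1 then QRF (\<pi> q c) (\<pi> r d) (strat d)
         else QARF (\<pi> q c) (ann c) (\<pi> r d) (strat d))"

definition Sb :: "'p \<Rightarrow> 'c joint set" where
  "Sb p = (if p = q then {Joint k c d | k c d. k \<le> 2 \<and> c \<in> st C q \<and> d \<in> st C r} else Plain ` st C p)"

definition cbase :: "'a \<Rightarrow> ('p \<Rightarrow> 'c joint) \<Rightarrow> 'p \<Rightarrow> 'c" where
  "cbase b y = (\<lambda>p\<in>adom D b. if p = r then r_c (y q) else main_c (y p))"

definition next_stage :: "'a \<Rightarrow> nat" where
  "next_stage b = (if adom D b = {r} then 2 else if r \<in> adom D b then 0 else 1)"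

text \<open>Counterpart of \<open>qstep\<close> for joint states, as \<open>cbase\<close> is the
  counterpart of \<open>base\<close>; local controller states outside the domain of \<open>b\<close>
  have to be kept explicitly.\<close>

definition qcond :: "'a \<Rightarrow> 'c joint \<Rightarrow> 'c joint \<Rightarrow> bool" where
  "qcond b x x' \<longleftrightarrow> stage x = 2 \<and> (b \<in> sys D \<and> q \<in> adom D b \<longrightarrow> b = ann (main_c x)) \<and>
     (adom D b = {r} \<longrightarrow> allowed D r (strat (r_c x)) b) \<and> stage x' = next_stage b \<and>
     (q \<notin> adom D b \<longrightarrow> main_c x' = main_c x) \<and> (r \<notin> adom D b \<longrightarrow> r_c x' = r_c x)"

text \<open>Announcements are controllable, so only those dictated by the controller states are
  offered: \<open>strat d\<close> and \<open>ann c\<close>.\<close>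

definition \<delta>b :: "'a raction \<Rightarrow> (('p \<Rightarrow> 'c joint) \<times> ('p \<Rightarrow> 'c joint)) set" where
  "\<delta>b x = (case x of
      Act b \<Rightarrow> {(y, y'). y \<in> (\<Pi>\<^sub>E p\<in>adom Db x. Sb p) \<and> y' \<in> (\<Pi>\<^sub>E p\<in>adom Db x. Sb p) \<and>
        (cbase b y, cbase b y') \<in> delta C b \<and> (q \<in> adom Db x \<longrightarrow> qcond b (y q) (y' q))}
    | ChF f \<Rightarrow> {(tup1 q (Joint 0 c d), tup1 q (Joint 1 c d)) | c d. c \<in> st C q \<and> d \<in> st C r \<and> f = strat d}
    | ChA a \<Rightarrow> {(tup1 q (Joint 1 c d), tup1 q (Joint 2 c d)) | c d. c \<in> st C q \<and> d \<in> st C r \<and> a = ann c})"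

definition Cb :: "('p, 'a raction, 'c joint) zautomaton" where
  "Cb = \<lparr>st = Sb, init_st = (\<lambda>p\<in>procs D - {r}. if p = q then Joint 0 (init_st C q) (init_st C r)
      else Plain (init_st C p)), delta = \<delta>b\<rparr>"

lemma Cb_simps [simp]: "st Cb = Sb" "delta Cb = \<delta>b"
  by (simp_all add: Cb_def)

lemma Sb_q: "x \<in> Sb q \<longleftrightarrow> (\<exists>k c d. x = Joint k c d \<and> k \<le> 2 \<and> c \<in> st C q \<and> d \<in> st C r)"
  by (auto simp: Sb_def)

lemma Sb_other: "p \<noteq> q \<Longrightarrow> x \<in> Sb p \<longleftrightarrow> (\<exists>c. x = Plain c \<and> c \<in> st C p)"
  by (auto simp: Sb_def)

lemma joint_eq: "x \<in> Sb q \<Longrightarrow> x' \<in> Sb q \<Longrightarrow> stage x = stage x' \<Longrightarrow> main_c x = main_c x' \<Longrightarrow> r_c x = r_c x' \<Longrightarrow> x = x'"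
  by (auto simp: Sb_q)

lemma init_C: "p \<in> procs D \<Longrightarrow> init_st C p \<in> st C p"
  using C by (auto simp: zielonka_def)

lemma Cb: "zielonka Db Cb"
  unfolding zielonka_def
proof (intro conjI ballI)
  fix p assume p: "p \<in> procs Db"
  have fin: "finite (st C p)" if "p \<in> procs D" for p using C that by (simp add: zielonka_def)
  have "{Joint k c d | k c d. k \<le> 2 \<and> c \<in> st C q \<and> d \<in> st C r} \<subseteq>
      (\<lambda>(k, c, d). Joint k c d) ` ({..2} \<times> st C q \<times> st C r)" by force
  then have "finite {Joint k c d | k c d. k \<le> 2 \<and> c \<in> st C q \<and> d \<in> st C r}"
    by (rule finite_subset) (use fin q_procs r_procs in auto)
  then show "finite (st Cb p)" using fin p by (simp add: Sb_def)
next
  show "init_st Cb \<in> (\<Pi>\<^sub>E p\<in>procs Db. st Cb p)"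
    using init_C q_procs r_procs by (auto simp: Cb_def Sb_def)
next
  fix x assume x: "x \<in> acts Db"
  show "delta Cb x \<subseteq> (\<Pi>\<^sub>E p\<in>adom Db x. st Cb p) \<times> (\<Pi>\<^sub>E p\<in>adom Db x. st Cb p)"
  proof (cases x)
    case (Act b)
    then show ?thesis unfolding \<delta>b_def Cb_simps by auto
  next
    case (ChF f)
    show ?thesis
    proof
      fix z assume "z \<in> delta Cb x"
      then obtain c d where "z = (tup1 q (Joint 0 c d), tup1 q (Joint 1 c d))" "c \<in> st C q" "d \<in> st C r"
        unfolding ChF Cb_simps \<delta>b_def by auto
      then show "z \<in> (\<Pi>\<^sub>E p\<in>adom Db x. st Cb p) \<times> (\<Pi>\<^sub>E p\<in>adom Db x. st Cb p)"
        by (simp add: ChF adom_Db tup1_PiE_iff Sb_q del: PiE_iff)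
    qed
  next
    case (ChA a)
    show ?thesis
    proof
      fix z assume "z \<in> delta Cb x"
      then obtain c d where "z = (tup1 q (Joint 1 c d), tup1 q (Joint 2 c d))" "c \<in> st C q" "d \<in> st C r"
        unfolding ChA Cb_simps \<delta>b_def by auto
      then show "z \<in> (\<Pi>\<^sub>E p\<in>adom Db x. st Cb p) \<times> (\<Pi>\<^sub>E p\<in>adom Db x. st Cb p)"
        by (simp add: ChA adom_Db tup1_PiE_iff Sb_q del: PiE_iff)
    qed
  qed
  show "single_valued (delta Cb x)"
  proof (rule single_valuedI)
    fix y y1 y2 assume 1: "(y, y1) \<in> delta Cb x" "(y, y2) \<in> delta Cb x"
    show "y1 = y2"
    proof (cases x)
      case (Act b)
      then have t: "y1 \<in> (\<Pi>\<^sub>E p\<in>adom Db x. Sb p)" "y2 \<in> (\<Pi>\<^sub>E p\<in>adom Db x. Sb p)"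
        and d: "(cbase b y, cbase b y1) \<in> delta C b" "(cbase b y, cbase b y2) \<in> delta C b"
        and qc: "q \<in> adom Db x \<Longrightarrow> qcond b (y q) (y1 q)" "q \<in> adom Db x \<Longrightarrow> qcond b (y q) (y2 q)"
        using 1 by (auto simp: \<delta>b_def)
      have eq: "cbase b y1 = cbase b y2" using C_det d x Act by auto
      show ?thesis
      proof (rule PiE_ext[OF t])
        fix p assume p: "p \<in> adom Db x"
        show "y1 p = y2 p"
        proof (cases "p = q")
          case True
          have "q \<in> adom D b \<Longrightarrow> main_c (y1 q) = main_c (y2 q)" "r \<in> adom D b \<Longrightarrow> r_c (y1 q) = r_c (y2 q)"
            using fun_cong[OF eq, of q] fun_cong[OF eq, of r] q_ne_r by (auto simp: cbase_def)
          then show ?thesis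
            using PiE_mem[OF t(1) p] PiE_mem[OF t(2) p] qc p True by (auto simp: qcond_def intro!: joint_eq)
        next
          case False
          then have "p \<in> adom D b" "p \<noteq> r" using p Act by (auto simp: in_adom_Db)
          then have "main_c (y1 p) = main_c (y2 p)" using fun_cong[OF eq, of p] by (simp add: cbase_def)
          then show ?thesis using PiE_mem[OF t(1) p] PiE_mem[OF t(2) p] False by (auto simp: Sb_other)
        qed
      qed
    qed (use 1 in \<open>auto simp: \<delta>b_def\<close>)
  qed
qed

lemma \<pi>b_st:
  assumes "p \<in> procs D - {r}" "x \<in> Sb p"
  shows "\<pi>b p x \<in> st Ab p"
proof (cases "p = q")
  case True
  then obtain k c d where x: "x = Joint k c d" "c \<in> st C q" "d \<in> st C r" using assms(2) by (auto simp: Sb_q)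
  then show ?thesis
    using True \<pi>_st[OF q_procs x(2)] \<pi>_st[OF r_procs x(3)] ann_sys[OF x(2)] strat_local_strategy[of d]
    by (simp add: \<pi>b_def)
next
  case False
  then obtain c where "x = Plain c" "c \<in> st C p" using assms(2) by (auto simp: Sb_other)
  then show ?thesis using False assms(1) \<pi>_st[of p c] by (simp add: \<pi>b_def)
qed

lemma main_of_\<pi>b: "p \<noteq> q \<Longrightarrow> x \<in> Sb p \<Longrightarrow> main_of (\<pi>b p x) = \<pi> p (main_c x)"
  "x \<in> Sb q \<Longrightarrow> main_of (\<pi>b q x) = \<pi> q (main_c x)" "x \<in> Sb q \<Longrightarrow> r_of (\<pi>b q x) = \<pi> r (r_c x)"
  by (auto simp: Sb_q Sb_other \<pi>b_def)

lemma base_\<pi>b: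
  assumes "b \<in> acts D" "y \<in> (\<Pi>\<^sub>E p\<in>adom Db (Act b). Sb p)"
  shows "base b (\<lambda>p\<in>adom Db (Act b). \<pi>b p (y p)) = (\<lambda>p\<in>adom D b. \<pi> p (cbase b y p))"
proof
  fix p
  show "base b (\<lambda>p\<in>adom Db (Act b). \<pi>b p (y p)) p = (\<lambda>p\<in>adom D b. \<pi> p (cbase b y p)) p"
  proof (cases "p \<in> adom D b")
    case True
    then have "p \<noteq> r \<Longrightarrow> p \<in> adom Db (Act b)" "p = r \<Longrightarrow> q \<in> adom Db (Act b)"
      using q_ne_r by (auto simp: in_adom_Db)
    then show ?thesis
      using True PiE_mem[OF assms(2)] main_of_\<pi>b by (cases "p = q") (auto simp: base_def cbase_def)
  qed (simp add: base_def)
qed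

lemma cbase_st:
  assumes "b \<in> acts D" "y \<in> (\<Pi>\<^sub>E p\<in>adom Db (Act b). Sb p)"
  shows "cbase b y \<in> (\<Pi>\<^sub>E p\<in>adom D b. st C p)"
proof (rule PiE_I)
  fix p assume p: "p \<in> adom D b"
  then have "p \<noteq> r \<Longrightarrow> p \<in> adom Db (Act b)" "p = r \<Longrightarrow> q \<in> adom Db (Act b)"
    using q_ne_r by (auto simp: in_adom_Db)
  then show "cbase b y p \<in> st C p"
    using p PiE_mem[OF assms(2), of p] PiE_mem[OF assms(2), of q] q_ne_r
    by (cases "p = q") (auto simp: cbase_def Sb_q Sb_other)
qed (simp add: cbase_def)

text \<open>The one case with content is a local move of \<open>r\<close>: the residual strategy
  required by \<open>qstep\<close> is, by \<open>strat_residual\<close>, the strategy of the new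
  controller state of \<open>r\<close>.\<close>

lemma qcond_qstep:
  assumes b: "b \<in> acts D" and x: "x \<in> Sb q" "x' \<in> Sb q" and c: "qcond b x x'"
    and d: "adom D b = {r} \<Longrightarrow> (tup1 r (r_c x), tup1 r (r_c x')) \<in> delta C b"
  shows "qstep b (\<pi>b q x) (\<pi>b q x')"
proof -
  obtain cq cr where x1: "x = Joint 2 cq cr" using x(1) c by (auto simp: Sb_q qcond_def)
  obtain k dq dr where x2: "x' = Joint k dq dr" using x(2) by (auto simp: Sb_q)
  have k: "k = next_stage b" using c by (simp add: qcond_def x2)
  show ?thesis
  proof (cases "adom D b = {r}")
    case True
    then have "b \<in> loc_acts D r" using b by (simp add: loc_acts_def)
    then have "residual (strat cr) b = strat dr" using strat_residual d[OF True] by (simp add: x1 x2)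
    then show ?thesis using True c q_ne_r unfolding qstep_def qcond_def
      by (simp add: x1 x2 \<pi>b_def k next_stage_def)
  next
    case False
    then show ?thesis using c unfolding qstep_def qcond_def
      by (auto simp: x1 x2 \<pi>b_def k next_stage_def)
  qed
qed

lemma Cb_hom:
  assumes "x \<in> acts Db" "(y, y') \<in> delta Cb x"
  shows "((\<lambda>p\<in>adom Db x. \<pi>b p (y p)), (\<lambda>p\<in>adom Db x. \<pi>b p (y' p))) \<in> delta Ab x"
proof (cases x)
  case (Act b)
  have b: "b \<in> acts D" using assms(1) Act by simp
  have y: "y \<in> (\<Pi>\<^sub>E p\<in>adom Db (Act b). Sb p)" "y' \<in> (\<Pi>\<^sub>E p\<in>adom Db (Act b). Sb p)"
    "(cbase b y, cbase b y') \<in> delta C b" "q \<in> adom Db (Act b) \<Longrightarrow> qcond b (y q) (y' q)"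
    using assms(2) Act by (auto simp: \<delta>b_def)
  have "(\<lambda>p\<in>adom Db (Act b). \<pi>b p (z p)) \<in> (\<Pi>\<^sub>E p\<in>adom Db (Act b). st Ab p)"
    if z: "z \<in> (\<Pi>\<^sub>E p\<in>adom Db (Act b). Sb p)" for z
  proof (rule PiE_I)
    fix p assume p: "p \<in> adom Db (Act b)"
    then have "p \<in> procs D - {r}" using Db b unfolding dist_alphabet_def by auto
    then show "(\<lambda>p\<in>adom Db (Act b). \<pi>b p (z p)) p \<in> st Ab p"
      using \<pi>b_st PiE_mem[OF z p] p by (simp del: st_Ab)
  qed simp
  moreover have "qstep b (\<pi>b q (y q)) (\<pi>b q (y' q))" if "q \<in> adom Db (Act b)"
  proof (rule qcond_qstep[OF b PiE_mem[OF y(1) that] PiE_mem[OF y(2) that] y(4)[OF that]])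
    assume "adom D b = {r}"
    then have "cbase b z = tup1 r (r_c (z q))" for z by (simp add: cbase_def restrict_singleton)
    then show "(tup1 r (r_c (y q)), tup1 r (r_c (y' q))) \<in> delta C b" using y(3) by simp
  qed
  ultimately show ?thesis
    unfolding Act delta_Ab red_trans_Act_iff
    using b y C_hom[OF b y(3)] unfolding base_\<pi>b[OF b y(1)] base_\<pi>b[OF b y(2)]
    by (simp del: st_Ab restrict_PiE_iff)
next
  case (ChF f)
  then show ?thesis
    using assms(2) \<pi>_st[OF q_procs] \<pi>_st[OF r_procs] strat_local_strategy
    unfolding ChF delta_Ab red_trans_ChF_iff adom_Db restrict_singleton
    by (auto simp: \<delta>b_def \<pi>b_def)
next
  case (ChA a)
  then show ?thesis
    using assms(2) \<pi>_st[OF q_procs] \<pi>_st[OF r_procs] strat_local_strategy ann_sys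
    unfolding ChA delta_Ab red_trans_ChA_iff adom_Db restrict_singleton
    by (auto simp: \<delta>b_def \<pi>b_def)
qed

lemma Act_enabled:
  assumes b: "b \<in> acts D" and s: "s \<in> (\<Pi>\<^sub>E p\<in>procs Db. Sb p)"
    and d: "cbase b s \<in> Domain (delta C b)"
    and qc: "q \<in> adom Db (Act b) \<Longrightarrow> stage (s q) = 2 \<and> (b \<in> sys D \<and> q \<in> adom D b \<longrightarrow> b = ann (main_c (s q))) \<and>
      (adom D b = {r} \<longrightarrow> allowed D r (strat (r_c (s q))) b)"
  shows "enabled Db Cb s (Act b)"
proof -
  obtain c' where c': "(cbase b s, c') \<in> delta C b" using d by blast
  have c'S: "c' \<in> (\<Pi>\<^sub>E p\<in>adom D b. st C p)" by (rule C_st(2)[OF b c'])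
  define y where "y = restrict s (adom Db (Act b))"
  define y' where "y' = (\<lambda>p\<in>adom Db (Act b). if p = q then Joint (next_stage b)
      (if q \<in> adom D b then c' q else main_c (s q)) (if r \<in> adom D b then c' r else r_c (s q)) else Plain (c' p))"
  have sub: "adom Db (Act b) \<subseteq> procs Db" using Db b unfolding dist_alphabet_def by auto
  have y: "y \<in> (\<Pi>\<^sub>E p\<in>adom Db (Act b). Sb p)" using s sub by (auto simp: y_def)
  have sq: "s q \<in> Sb q" using s q_procs q_ne_r by auto
  have y': "y' \<in> (\<Pi>\<^sub>E p\<in>adom Db (Act b). Sb p)"
  proof (rule PiE_I)
    fix p assume p: "p \<in> adom Db (Act b)"
    have "next_stage b \<le> 2" by (simp add: next_stage_def)
    then show "y' p \<in> Sb p"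
      using p sq PiE_mem[OF c'S] q_ne_r by (auto simp: y'_def Sb_q Sb_other in_adom_Db)
  qed (simp add: y'_def)
  have "cbase b y = cbase b s" using q_ne_r by (auto simp: cbase_def y_def in_adom_Db)
  moreover have "cbase b y' = c'"
  proof
    fix p show "cbase b y' p = c' p"
      using PiE_arb[OF c'S, of p] q_ne_r by (cases "p \<in> adom D b") (auto simp: cbase_def y'_def in_adom_Db)
  qed
  moreover have "qcond b (y q) (y' q)" if "q \<in> adom Db (Act b)"
    using qc[OF that] that by (simp add: qcond_def y_def y'_def)
  ultimately have "(y, y') \<in> delta Cb (Act b)"
    using y y' c' by (simp add: \<delta>b_def)
  then show ?thesis using enabled_iff[OF Cb, of "Act b" s] b by (auto simp: y_def)
qed

lemma cbase_singleton:
  "adom D b = {q} \<Longrightarrow> cbase b y = tup1 q (main_c (y q))"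
  "adom D b = {r} \<Longrightarrow> cbase b y = tup1 r (r_c (y q))"
  using q_ne_r by (simp_all add: cbase_def restrict_singleton)

lemma cbase_restrict: "cbase b (restrict s (adom Db (Act b))) = cbase b s"
  using q_ne_r by (auto simp: cbase_def in_adom_Db)

text \<open>Actions uncontrollable in \<open>A\<close> are handled by the covering \<open>C\<close>.
  A controllable one has become uncontrollable because it is local to \<open>q\<close> or to
  \<open>r\<close>; then it is the announced action or the value of the strategy, and
  \<open>C\<close> offers it.\<close>

lemma Cb_env:
  assumes s: "s \<in> (\<Pi>\<^sub>E p\<in>procs Db. Sb p)" and x: "x \<in> env Db"
    and d: "(\<lambda>p\<in>adom Db x. \<pi>b p (s p)) \<in> Domain (delta Ab x)"
  shows "enabled Db Cb s x"
proof -
  obtain b where xb: "x = Act b" using x env_Db by (cases x) auto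
  have b: "b \<in> acts D" using x xb env_Db by simp
  let ?y = "restrict s (adom Db (Act b))"
  have sub: "adom Db (Act b) \<subseteq> procs Db" using Db b unfolding dist_alphabet_def by auto
  have y: "?y \<in> (\<Pi>\<^sub>E p\<in>adom Db (Act b). Sb p)" using s sub by auto
  have yy: "(\<lambda>p\<in>adom Db (Act b). \<pi>b p (s p)) = (\<lambda>p\<in>adom Db (Act b). \<pi>b p (?y p))" by auto
  obtain z where z: "(base b (\<lambda>p\<in>adom Db (Act b). \<pi>b p (?y p)), base b z) \<in> delta A b"
    "q \<in> adom Db (Act b) \<Longrightarrow> qstep b (\<pi>b q (s q)) (z q)"
  proof -
    from d obtain z where "((\<lambda>p\<in>adom Db (Act b). \<pi>b p (?y p)), z) \<in> delta Ab (Act b)"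
      unfolding xb yy by blast
    then have "red_trans D A r q (Act b) (\<lambda>p\<in>adom Db (Act b). \<pi>b p (?y p)) z" by (simp only: delta_Ab)
    from this[unfolded red_trans_Act_iff] show ?thesis
      by (intro that[of z]) (auto simp del: restrict_apply simp: restrict_apply')
  qed
  have zA: "(\<lambda>p\<in>adom D b. \<pi> p (cbase b s p)) \<in> Domain (delta A b)"
    using z(1) base_\<pi>b[OF b y] cbase_restrict by auto
  have sq: "s q \<in> Sb q" using s q_procs q_ne_r by auto
  then obtain k cq cr where skc: "s q = Joint k cq cr" "k \<le> 2" "cq \<in> st C q" "cr \<in> st C r"
    by (auto simp: Sb_q)
  have qc: "stage (s q) = 2 \<and> (b \<in> sys D \<and> q \<in> adom D b \<longrightarrow> b = ann (main_c (s q))) \<and>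
      (adom D b = {r} \<longrightarrow> allowed D r (strat (r_c (s q))) b)" if qd: "q \<in> adom Db (Act b)"
  proof -
    from z(2)[OF qd] have "k = 2" using skc by (auto simp: qstep_def \<pi>b_def split: if_splits)
    then show ?thesis using z(2)[OF qd] skc by (auto simp: qstep_def \<pi>b_def)
  qed
  have "cbase b s \<in> Domain (delta C b)"
  proof (cases "b \<in> env D")
    case True
    show ?thesis by (rule C_env[OF True _ zA]) (use cbase_st[OF b y] cbase_restrict in simp)
  next
    case False
    then have bs: "b \<in> sys D" using b by (simp add: env_def)
    then have "q \<in> adom D b \<or> r \<in> adom D b" using x xb env_Db False by auto
    then consider "adom D b = {q}" | "adom D b = {r}" using sys_local[OF bs] by blast
    then show ?thesis
    proof cases
      case 1
      then have "b = ann cq" using qc bs skc q_ne_r by (auto simp: in_adom_Db)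
      moreover have "(\<lambda>p\<in>adom D b. \<pi> p (cbase b s p)) = tup1 q (\<pi> q cq)"
        using 1 skc by (simp add: cbase_singleton restrict_singleton)
      ultimately show ?thesis using ann_enabled(2)[OF skc(3)] zA 1 skc by (simp add: cbase_singleton)
    next
      case 2
      then have "allowed D r (strat cr) b" using qc skc by (auto simp: in_adom_Db q_ne_r)
      then have "strat cr [] = Some b" using False by (simp add: allowed_def)
      then have "rsys cr b" using strat_Some by fastforce
      then show ?thesis using 2 skc by (simp add: rsys_def cbase_singleton)
    qed
  qed
  then show ?thesis using Act_enabled[OF b s _ qc] xb by simp
qed


section \<open>Erasing the announcements\<close>

definition decode :: "('p \<Rightarrow> 'c joint) \<Rightarrow> 'p \<Rightarrow> 'c" where
  "decode s = (\<lambda>p\<in>procs D. if p = r then r_c (s q) else main_c (s p))"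

fun erase :: "('p, 'a raction, 'c joint) gstep list \<Rightarrow> ('p, 'a, 'c) gstep list" where
  "erase [] = []"
| "erase ((s, Act b, s') # \<rho>) = (decode s, b, decode s') # erase \<rho>"
| "erase ((s, x, s') # \<rho>) = erase \<rho>"

lemma set_erase: "(x, b, x') \<in> set (erase \<rho>) \<longleftrightarrow> (\<exists>s s'. (s, Act b, s') \<in> set \<rho> \<and> x = decode s \<and> x' = decode s')"
  by (induction \<rho> rule: erase.induct) auto

lemma cbase_decode: "a \<in> acts D \<Longrightarrow> cbase a s = restrict (decode s) (adom D a)"
  using adom_procs by (auto simp: cbase_def decode_def)

lemma gtrans_st:
  assumes "gtrans Db Cb s x s'" "s \<in> (\<Pi>\<^sub>E p\<in>procs Db. Sb p)"
  shows "s' \<in> (\<Pi>\<^sub>E p\<in>procs Db. Sb p)"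
  using path_tuple[OF Db Cb, of s "[(s, x, s')]" s'] assms by simp

lemma step_Act:
  assumes g: "gtrans Db Cb s (Act b) s'"
  shows "gtrans D C (decode s) b (decode s')" "q \<in> adom Db (Act b) \<Longrightarrow> qcond b (s q) (s' q)"
proof -
  let ?X = "adom Db (Act b)"
  have b: "b \<in> acts D" using g by (simp add: gtrans_def)
  have d: "(restrict s ?X, restrict s' ?X) \<in> \<delta>b (Act b)" using g by (simp add: gtrans_def)
  then have c: "(cbase b s, cbase b s') \<in> delta C b" using cbase_restrict by (simp add: \<delta>b_def)
  show qc: "qcond b (s q) (s' q)" if "q \<in> ?X" using d that by (simp add: \<delta>b_def)
  have "decode s' p = decode s p" if p: "p \<notin> adom D b" for p
  proof -
    have 1: "main_c (s' p) = main_c (s p)" if "p \<noteq> r"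
      using gtrans_outside[OF g, of p] qc p that by (cases "p \<in> ?X") (auto simp: in_adom_Db qcond_def)
    have 2: "r_c (s' q) = r_c (s q)" if "p = r"
      using gtrans_outside[OF g, of q] qc p that by (cases "q \<in> ?X") (auto simp: qcond_def)
    from 1 2 show ?thesis by (simp add: decode_def)
  qed
  then show "gtrans D C (decode s) b (decode s')"
    using c b by (simp add: gtrans_def cbase_decode)
qed

lemma step_Ch:
  assumes g: "gtrans Db Cb s x s'" and x: "\<And>b. x \<noteq> Act b"
  shows "decode s' = decode s" "stage (s' q) = Suc (stage (s q))" "r_c (s' q) = r_c (s q)" "adom Db x = {q}"
proof -
  show ad: "adom Db x = {q}" using x by (cases x) (auto simp: adom_Db)
  then have "(tup1 q (s q), tup1 q (s' q)) \<in> \<delta>b x" using g by (simp add: gtrans_def restrict_singleton)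
  then obtain k c d where sq: "s q = Joint k c d" "s' q = Joint (Suc k) c d"
    using x by (cases x) (auto simp: \<delta>b_def)
  then show "stage (s' q) = Suc (stage (s q))" "r_c (s' q) = r_c (s q)" by auto
  have "s' p = s p" if "p \<noteq> q" for p using gtrans_outside[OF g, of p] ad that by simp
  then have "main_c (s' p) = main_c (s p)" for p using sq by (cases "p = q") auto
  then show "decode s' = decode s" using sq by (auto simp: decode_def)
qed

lemma erase_path: "path Db Cb s \<rho> s' \<Longrightarrow> path D C (decode s) (erase \<rho>) (decode s')"
proof (induction \<rho> arbitrary: s rule: erase.induct)
  case (2 t b t' \<rho>)
  then show ?case using step_Act(1)[of t b t'] by auto
next
  case ("3_1" t f t' \<rho>)
  then show ?case using step_Ch(1)[of t "ChF f" t'] by fastforce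
next
  case ("3_2" t f t' \<rho>)
  then show ?case using step_Ch(1)[of t "ChA f" t'] by fastforce
qed auto

lemma decode_q: "decode s q = main_c (s q)" and decode_r: "decode s r = r_c (s q)"
  and decode_other: "p \<in> procs D \<Longrightarrow> p \<noteq> r \<Longrightarrow> decode s p = main_c (s p)"
  using q_procs r_procs q_ne_r by (auto simp: decode_def)

lemma q_of_\<pi>b: "x \<in> Sb q \<Longrightarrow> q_of (\<pi>b q x) = \<pi> q (main_c x)"
  by (auto simp: Sb_q \<pi>b_def)

text \<open>Each projection that occurs in the reduced condition is, on joint runs, the projection
  of the erased run; the moves of both \<open>q\<close> and \<open>r\<close> are extracted from the
  single component \<open>q\<close>.\<close>

lemma erase_proj:
  "path Db Cb s \<rho> s' \<Longrightarrow> s \<in> (\<Pi>\<^sub>E p\<in>procs Db. Sb p) \<Longrightarrow>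
    (\<forall>p\<in>procs D - {q, r}. aproj Db \<pi>b p \<rho> = map lift_step (aproj D \<pi> p (erase \<rho>))) \<and>
    rproj D q q_of (aproj Db \<pi>b q \<rho>) = aproj D \<pi> q (erase \<rho>) \<and>
    rproj D r r_of (aproj Db \<pi>b q \<rho>) = aproj D \<pi> r (erase \<rho>)"
proof (induction \<rho> arbitrary: s)
  case (Cons y \<rho>)
  obtain t x t' where y: "y = (t, x, t')" by (cases y)
  have g: "gtrans Db Cb s x t'" and ts: "t = s" and g2: "path Db Cb t' \<rho> s'" using Cons.prems y by auto
  note st = Cons.prems(2) gtrans_st[OF g Cons.prems(2)]
  note IH = Cons.IH[OF g2 st(2)]
  have sq: "s q \<in> Sb q" "t' q \<in> Sb q" using st q_procs q_ne_r by auto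
  show ?case
  proof (cases x)
    case (Act b)
    have b: "b \<in> acts D" using g Act by (simp add: gtrans_def)
    have "\<pi>b p (z p) = Other (\<pi> p (decode z p))"
      if "p \<in> procs D - {q, r}" "z \<in> (\<Pi>\<^sub>E p\<in>procs Db. Sb p)" for p z
    proof -
      have "z p \<in> Sb p" using that by auto
      then show ?thesis using that(1) by (auto simp: Sb_other \<pi>b_def decode_other)
    qed
    then show ?thesis
      using IH b st main_of_\<pi>b(3)[OF sq(1)] main_of_\<pi>b(3)[OF sq(2)] q_of_\<pi>b[OF sq(1)] q_of_\<pi>b[OF sq(2)]
      by (auto simp: y ts Act in_adom_Db decode_q decode_r acts_of_def lift_step_def q_ne_r)
  next
    case (ChF f)
    then show ?thesis using IH by (auto simp: y adom_Db)
  next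
    case (ChA f)
    then show ?thesis using IH by (auto simp: y adom_Db)
  qed
qed auto

text \<open>For \<open>q\<close> this fails, since the touching step may be an announcement, which
  is erased, or a move of \<open>r\<close>.\<close>

lemma erase_touches:
  assumes "touches Db \<rho> {p}" "p \<noteq> q"
  shows "touches D (erase \<rho>) {p}"
proof -
  obtain s x s' where x: "(s, x, s') \<in> set \<rho>" "p \<in> adom Db x" using assms(1) by (auto simp: touches_def)
  then obtain b where "x = Act b" using assms(2) by (cases x) (auto simp: adom_Db)
  then show ?thesis using x assms(2) set_erase unfolding touches_def by (fastforce simp: in_adom_Db)
qed

lemma erase_touches_q: "touches D (erase \<rho>) {q} \<or> touches D (erase \<rho>) {r} \<Longrightarrow> touches Db \<rho> {q}"
  using q_ne_r by (fastforce simp: touches_def set_erase in_adom_Db)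

text \<open>Without \<open>q\<close>, every move of \<open>r\<close> is local. The moves of
  \<open>r\<close> thus form one local run, whose length shortness bounds.\<close>

lemma C_r_path:
  "path D C s \<rho> s' \<Longrightarrow> \<not> touches D \<rho> {q} \<Longrightarrow>
    \<exists>v. lpath D C r (s r) v (s' r) \<and> length v = length (aproj D \<pi> r \<rho>)"
proof (induction \<rho> arbitrary: s)
  case (Cons y \<rho>)
  obtain x a x' where y: "y = (x, a, x')" by (cases y)
  have g: "gtrans D C s a x'" and g2: "path D C x' \<rho> s'" and nt: "\<not> touches D \<rho> {q}" "q \<notin> adom D a"
    using Cons.prems y by auto
  obtain v where v: "lpath D C r (x' r) v (s' r)" "length v = length (aproj D \<pi> r \<rho>)"
    using Cons.IH[OF g2 nt(1)] by blast
  show ?case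
  proof (cases "r \<in> adom D a")
    case True
    have a: "a \<in> acts D" using g by (simp add: gtrans_def)
    then have ad: "adom D a = {r}" using adom_r[OF a True] nt(2) by auto
    then have "(tup1 r (s r), tup1 r (x' r)) \<in> delta C a" using g by (simp add: gtrans_def restrict_singleton)
    then have "lpath D C r (s r) (a # v) (s' r)" using v(1) a ad by (auto simp: loc_acts_def)
    then show ?thesis using v(2) True y by (intro exI[of _ "a # v"]) simp
  next
    case False
    then have "x' r = s r" using gtrans_outside[OF g] by simp
    then show ?thesis using v False y by auto
  qed
qed auto

text \<open>\<open>C\<close> can execute any sequence respecting its strategy: it must admit the
  uncontrollable steps, and the controllable ones were taken from its own offers. The last clause
  says that a further allowed step of \<open>C\<close> would prolong the sequence, so after a
  maximal one \<open>C\<close> has none.\<close>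

lemma follows_C:
  "follows D A r (\<pi> r c) (strat c) u s' \<Longrightarrow> c \<in> st C r \<Longrightarrow> \<exists>c'. lpath D C r c u c' \<and> \<pi> r c' = s' \<and> c' \<in> st C r \<and>
    (\<forall>b d. b \<in> loc_acts D r \<and> allowed D r (strat c') b \<and> (tup1 r c', tup1 r d) \<in> delta C b \<longrightarrow>
      follows D A r (\<pi> r c) (strat c) (u @ [b]) (\<pi> r d))"
proof (induction u arbitrary: c)
  case Nil
  then show ?case using C_loc_hom by auto
next
  case (Cons a u)
  then obtain s1 where a: "allowed D r (strat c) a" "(tup1 r (\<pi> r c), tup1 r s1) \<in> delta A a"
    "follows D A r s1 (residual (strat c) a) u s'" by auto
  have al: "a \<in> loc_acts D r" using a(1) by (simp add: allowed_def)
  have "tup1 r c \<in> Domain (delta C a)"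
  proof (cases "a \<in> env D")
    case True
    then show ?thesis
      using C_env[OF True, of "tup1 r c"] loc_actsD(2)[OF al] Cons.prems(2) a(2)
      by (auto simp: tup1_PiE_iff tup1_map simp del: PiE_iff)
  next
    case False
    then have "strat c [] = Some a" using a(1) by (simp add: allowed_def)
    then show ?thesis using strat_Some by (fastforce simp: rsys_def)
  qed
  then obtain d where d: "(tup1 r c, tup1 r d) \<in> delta C a" "d \<in> st C r" using C_loc_dom[OF al] by blast
  have s1: "s1 = \<pi> r d" using loc_det[OF al a(2) C_loc_hom[OF al d(1)]] .
  have sd: "residual (strat c) a = strat d" by (rule strat_residual[OF al d(1)])
  obtain c' where c': "lpath D C r d u c'" "\<pi> r c' = s'" "c' \<in> st C r"
    "\<forall>b e. b \<in> loc_acts D r \<and> allowed D r (strat c') b \<and> (tup1 r c', tup1 r e) \<in> delta C b \<longrightarrow>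
      follows D A r (\<pi> r d) (strat d) (u @ [b]) (\<pi> r e)"
    using Cons.IH[OF _ d(2)] a(3) s1 sd by auto
  have "lpath D C r c (a # u) c'" using al d(1) c'(1) by auto
  moreover have "follows D A r (\<pi> r c) (strat c) ((a # u) @ [b]) (\<pi> r e)"
    if "follows D A r (\<pi> r d) (strat d) (u @ [b]) (\<pi> r e)" for b e
    using that a(1,2) s1 sd by auto
  ultimately show ?case using c' by blast
qed

end

section \<open>Correctness of maximal runs of the joint controller\<close>

locale forward_run = reduction_forward D A K r q C \<pi>
  for D :: "('p, 'a) alphabet" and A :: "('p, 'a, 's) zautomaton" and K r q
    and C :: "('p, 'a, 'c) zautomaton" and \<pi> +
  fixes t u
  assumes run: "block_run Db Cb t u" and mx: "block_maximal Db Cb t u" and len: "\<And>i. length (u i) \<le> 1"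
begin

definition s where "s i = decode (t i)"
definition w where "w i = erase (u i)"

lemma t_st: "t i \<in> (\<Pi>\<^sub>E p\<in>procs Db. Sb p)"
  using block_run_reach[OF run, of i] reach_tuple[OF Db Cb] by auto

lemma tq: "t i q \<in> Sb q"
  using t_st[of i] q_procs q_ne_r by auto

lemma crun: "block_run D C s w"
proof -
  have "decode (init_st Cb) = init_st C"
  proof
    fix p
    have "init_st C \<in> (\<Pi>\<^sub>E p\<in>procs D. st C p)" using C by (simp add: zielonka_def)
    from PiE_arb[OF this, of p] show "decode (init_st Cb) p = init_st C p"
      using q_procs q_ne_r by (auto simp: decode_def Cb_def)
  qed
  then show ?thesis
    using run erase_path by (auto simp: block_run_def s_def w_def)
qed

lemma block: "(u i = [] \<and> t (Suc i) = t i) \<or> (\<exists>x. u i = [(t i, x, t (Suc i))] \<and> gtrans Db Cb (t i) x (t (Suc i)))"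
  by (rule block_run_touch_step[OF run len])

lemma proj_other: "p \<in> procs D \<Longrightarrow> p \<noteq> q \<Longrightarrow> p \<noteq> r \<Longrightarrow> aproj Db \<pi>b p (u i) = map lift_step (aproj D \<pi> p (w i))"
  and proj_q: "rproj D q q_of (aproj Db \<pi>b q (u i)) = aproj D \<pi> q (w i)"
  and proj_r: "rproj D r r_of (aproj Db \<pi>b q (u i)) = aproj D \<pi> r (w i)"
  using erase_proj[OF block_run_path[OF run, of i] t_st] by (auto simp: w_def)

lemma other_touch:
  assumes "enabled D C (s i) a" "q \<notin> adom D a" "r \<notin> adom D a"
  shows "\<exists>j\<ge>i. touches D (w j) (adom D a)"
proof -
  have a: "a \<in> acts D" by (rule enabled_acts[OF assms(1)])
  have "cbase a (t i) \<in> Domain (delta C a)"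
    using assms(1) enabled_iff[OF C a] cbase_decode[OF a] by (simp add: s_def)
  then have "enabled Db Cb (t i) (Act a)"
    using Act_enabled[OF a t_st] assms by (simp add: in_adom_Db)
  then obtain j where j: "j \<ge> i" "touches Db (u j) (adom Db (Act a))" using mx by (auto simp: block_maximal_def)
  then obtain p where p: "p \<in> adom D a" "touches Db (u j) {p}"
    using adom_Db_other[OF assms(3)] by (fastforce simp: touches_def)
  then have "touches D (w j) {p}" using erase_touches assms by (auto simp: w_def)
  then show ?thesis using j p touches_subset[of D "w j" "{p}" "adom D a"] by blast
qed

text \<open>Uncontrollable actions transfer unchanged. A controllable one is replaced by the
  announced action of \<open>q\<close> or by an allowed action of \<open>r\<close>, with the same
  original domain.\<close>

lemma qr_alt:
  assumes "enabled D C (s i) a" "q \<in> adom D a \<or> r \<in> adom D a" "stage (t i q) = 2"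
  shows "\<exists>b\<in>acts D. adom D b = adom D a \<and> enabled Db Cb (t i) (Act b)"
proof -
  have a: "a \<in> acts D" by (rule enabled_acts[OF assms(1)])
  have ca: "cbase a (t i) \<in> Domain (delta C a)"
    using assms(1) enabled_iff[OF C a] cbase_decode[OF a] by (simp add: s_def)
  show ?thesis
  proof (cases "a \<in> sys D")
    case False
    then have "enabled Db Cb (t i) (Act a)"
      using Act_enabled[OF a t_st ca] a assms(3) by (auto simp: allowed_def env_def loc_acts_def)
    then show ?thesis using a by blast
  next
    case True
    obtain k c d where x: "t i q = Joint k c d" "c \<in> st C q" "d \<in> st C r" using tq[of i] unfolding Sb_q by blast
    from sys_local[OF True] assms(2) consider "adom D a = {q}" | "adom D a = {r}" by blast
    then show ?thesis
    proof cases
      case 1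
      then have "tup1 q c \<in> Domain (delta C a)" "a \<in> loc_acts D q"
        using ca x a by (auto simp: cbase_singleton loc_acts_def)
      then have dom: "tup1 q c \<in> Domain (delta C (ann c))" using ann_enabled(1)[OF x(2)] True by blast
      have b: "ann c \<in> acts D" "adom D (ann c) = {q}"
        using ann_sys[OF x(2)] sys_acts sys_local[of "ann c" q] by (auto simp: acts_of_def)
      have "enabled Db Cb (t i) (Act (ann c))"
        using Act_enabled[OF b(1) t_st] dom assms(3) x b(2) q_ne_r by (simp add: cbase_singleton)
      then show ?thesis using b 1 by auto
    next
      case 2
      then have "tup1 r d \<in> Domain (delta C a)" "a \<in> loc_acts D r"
        using ca x a by (auto simp: cbase_singleton loc_acts_def)
      then obtain b d' where b: "b \<in> loc_acts D r" "allowed D r (strat d) b" "(tup1 r d, tup1 r d') \<in> delta C b"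
        using r_progress by blast
      have "cbase b (t i) \<in> Domain (delta C b)"
        using b(3) x loc_actsD(2)[OF b(1)] by (auto simp: cbase_singleton)
      then have "enabled Db Cb (t i) (Act b)"
        using Act_enabled[OF loc_actsD(1)[OF b(1)] t_st] b(2) assms(3) x loc_actsD(2)[OF b(1)] q_ne_r by simp
      then show ?thesis using loc_actsD[OF b(1)] 2 by auto
    qed
  qed
qed

lemma corr_transfer:
  assumes "p \<in> procs D" "p \<noteq> q" "p \<noteq> r" "satisfies_corr A K p (iconcat (\<lambda>i. aproj D \<pi> p (w i)))"
  shows "satisfies_corr Ab Kb p (iconcat (\<lambda>i. aproj Db \<pi>b p (u i)))"
  using corr_other[OF assms(1-3)] assms(4) proj_other[OF assms(1-3)] by simp

lemma \<pi>b_init: "p \<in> procs Db \<Longrightarrow> \<pi>b p (init_st Cb p) = init_st Ab p"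
  using \<pi>_init q_procs r_procs by (auto simp: Cb_def init_Ab \<pi>b_def)

text \<open>At stages 0 and 1 an announcement is enabled, and it has domain \<open>{q}\<close>;
  fairness would let \<open>q\<close> move again.\<close>

lemma final_stage:
  assumes no: "\<And>j. j \<ge> n \<Longrightarrow> \<not> touches Db (u j) {q}"
  shows "stage (t n q) = 2"
proof (rule ccontr)
  assume ne: "stage (t n q) \<noteq> 2"
  obtain k c d where x: "t n q = Joint k c d" "k \<le> 2" "c \<in> st C q" "d \<in> st C r" using tq[of n] unfolding Sb_q by blast
  have "\<exists>x\<in>acts Db. adom Db x = {q} \<and> tup1 q (t n q) \<in> Domain (\<delta>b x)"
  proof (cases "k = 0")
    case True
    have "strat d \<in> strategies D A r"
      using strat_local_strategy \<pi>_st[OF r_procs x(4)] by (auto simp: strategies_def)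
    moreover have "tup1 q (t n q) \<in> Domain (\<delta>b (ChF (strat d)))"
      using x True by (auto simp: \<delta>b_def)
    ultimately show ?thesis by (intro bexI[of _ "ChF (strat d)"]) (auto simp: adom_Db)
  next
    case False
    then have "k = 1" using ne x by simp
    then have "tup1 q (t n q) \<in> Domain (\<delta>b (ChA (ann c)))"
      using x by (auto simp: \<delta>b_def)
    then show ?thesis using ann_sys[OF x(3)] by (intro bexI[of _ "ChA (ann c)"]) (auto simp: adom_Db)
  qed
  then obtain x where "x \<in> acts Db" "adom Db x = {q}" "enabled Db Cb (t n) x"
    using enabled_iff[OF Cb] by (auto simp: restrict_singleton)
  then show False using mx no unfolding block_maximal_def by metis
qed

text \<open>When the joint \<open>q\<close> stops, the erased run is already maximal, and the last
  \<open>q\<close>-state is of kind \<open>QARF\<close>. Accepting states of \<open>q\<close> and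
  \<open>r\<close> in \<open>C\<close> then give an accepting joint state.\<close>

lemma finite_case:
  assumes no: "\<And>j. j \<ge> n \<Longrightarrow> \<not> touches Db (u j) {q}" and p: "p \<in> procs Db"
  shows "satisfies_corr Ab Kb p (iconcat (\<lambda>i. aproj Db \<pi>b p (u i)))"
proof -
  have stg: "stage (t i q) = 2" if "i \<ge> n" for i using final_stage no that by simp
  have "block_maximal D C s w"
  proof (rule block_maximalI_late[OF C crun, of n])
    fix i a assume i: "i \<ge> n" and e: "enabled D C (s i) a"
    show "\<exists>j\<ge>i. touches D (w j) (adom D a)"
    proof (cases "q \<in> adom D a \<or> r \<in> adom D a")
      case True
      obtain b where b: "b \<in> acts D" "adom D b = adom D a" "enabled Db Cb (t i) (Act b)"
        using qr_alt[OF e True stg[OF i]] by blast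
      then obtain j where j: "j \<ge> i" "touches Db (u j) (adom Db (Act b))" using mx unfolding block_maximal_def by blast
      then obtain p where p: "p \<in> adom Db (Act b)" "touches Db (u j) {p}" by (fastforce simp: touches_def)
      \<comment> \<open>Fairness provides a later step dependent on the substitute action
        \<open>b\<close>. It cannot involve the stopped \<open>q\<close>, so it survives erasure,
        and its common process belongs to the domain of \<open>a\<close> as well.\<close>
      have "p \<noteq> q" using p(2) no[of j] j i by auto
      then have "touches D (w j) {p}" "p \<in> adom D a"
        using erase_touches p b(2) by (auto simp: w_def in_adom_Db)
      then show ?thesis using j touches_subset[of D "w j" "{p}" "adom D a"] by blast
    next
      case False
      then show ?thesis using other_touch[OF e] by simp
    qed
  qed
  note ok = correct_coveringD[OF correct crun this]
  show ?thesis
  proof (cases "p = q")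
    case False
    then show ?thesis using corr_transfer ok p by simp
  next
    case True
    have noC: "\<not> touches D (w j) {q}" "\<not> touches D (w j) {r}" if "j \<ge> n" for j
      using no[OF that] erase_touches_q by (auto simp: w_def)
    have "\<pi> q (s n q) \<in> fin_ok K q" "\<pi> r (s n r) \<in> fin_ok K r"
      using ok[OF q_procs] ok[OF r_procs] satisfies_corr_finite[where p = q and \<pi> = \<pi> and n = n, OF crun \<pi>_init[OF q_procs] noC(1)]
        satisfies_corr_finite[where p = r and \<pi> = \<pi> and n = n, OF crun \<pi>_init[OF r_procs] noC(2)] by auto
    moreover obtain k c d where x: "t n q = Joint k c d" using tq[of n] unfolding Sb_q by blast
    moreover have "\<pi>b q (t n q) \<in> red_qstates D A r q" using \<pi>b_st[of q "t n q"] tq q_procs q_ne_r by simp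
    ultimately have "\<pi>b q (t n q) \<in> fin_ok Kb q"
      using stg[of n] by (auto simp: red_condition_def \<pi>b_def s_def decode_q decode_r)
    then show ?thesis
      using satisfies_corr_finite[where p = q and \<pi> = \<pi>b and n = n, OF run \<pi>b_init[of q] no] True p by simp
  qed
qed

text \<open>If the original \<open>q\<close> stopped, the number of moves of \<open>r\<close> plus
  the current stage would grow with every step of the joint \<open>q\<close>. But it is bounded by
  \<open>shortness + 2\<close>, the 2 being the highest stage.\<close>

lemma q_infinite:
  assumes inf: "\<And>n. \<exists>j\<ge>n. touches Db (u j) {q}"
  shows "\<exists>j\<ge>n. touches D (w j) {q}"
proof (rule ccontr)
  assume no: "\<not> ?thesis"
  define L where "L j = length (aproj D \<pi> r (concats (\<lambda>i. w (i + n)) j))" for j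
  define f where "f j = L j + stage (t (j + n) q)" for j
  have step: "f j \<le> f (Suc j) \<and> (touches Db (u (j + n)) {q} \<longrightarrow> f j < f (Suc j))" for j
    using block[of "j + n"]
  proof (elim disjE exE conjE)
    fix x assume x: "u (j + n) = [(t (j + n), x, t (Suc (j + n)))]" "gtrans Db Cb (t (j + n)) x (t (Suc (j + n)))"
    show ?thesis
    proof (cases x)
      case (Act b)
      have wj: "w (j + n) = [(decode (t (j + n)), b, decode (t (Suc (j + n))))]" by (simp add: w_def x(1) Act)
      then have qb: "q \<notin> adom D b" using no by (metis le_add2 touches_Cons insert_not_empty Int_insert_right_if1)
      show ?thesis
      proof (cases "r \<in> adom D b")
        case True
        have b: "b \<in> acts D" using x(2) Act by (simp add: gtrans_def)
        have "adom D b = {r}" using adom_r[OF b True] qb by auto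
        moreover have "qcond b (t (j + n) q) (t (Suc (j + n)) q)"
          using step_Act(2)[of "t (j + n)" b] x(2) Act True by (simp add: in_adom_Db q_ne_r)
        ultimately have "stage (t (Suc (j + n)) q) = stage (t (j + n) q)"
          by (simp add: qcond_def next_stage_def)
        then show ?thesis using wj True by (simp add: f_def L_def)
      next
        case False
        then have "q \<notin> adom Db x" using qb Act by (simp add: in_adom_Db)
        then show ?thesis using x gtrans_outside[OF x(2), of q] wj False by (simp add: f_def L_def)
      qed
    next
      case (ChF g)
      then show ?thesis using step_Ch(2)[OF x(2)] x(1) by (simp add: f_def L_def w_def)
    next
      case (ChA g)
      then show ?thesis using step_Ch(2)[OF x(2)] x(1) by (simp add: f_def L_def w_def)
    qed
  qed (simp add: f_def L_def w_def)
  have "L j \<le> shortness" for j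
  proof -
    have rn: "path D C (s n) (concats (\<lambda>i. w (i + n)) j) (s (j + n))"
      by (induction j) (use block_run_path[OF crun] in \<open>auto simp: path_append\<close>)
    have "\<not> touches D (concats (\<lambda>i. w (i + n)) j) {q}" by (induction j) (use no in auto)
    then obtain v where "lpath D C r (s n r) v (s (j + n) r)" "length v = L j"
      using C_r_path[OF rn] by (auto simp: L_def)
    moreover have "s n r \<in> st C r" using block_run_reach[OF crun, of n] reach_tuple[OF D C] r_procs by auto
    ultimately show ?thesis using lpath_short[OF \<pi>_st[OF r_procs]] C_lpath by metis
  qed
  moreover have "stage (t j q) \<le> 2" for j using tq[of j] by (auto simp: Sb_q)
  ultimately have "f j \<le> shortness + 2" for j unfolding f_def by (rule add_mono)
  moreover have "mono f" using step by (simp add: mono_iff_le_Suc)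
  ultimately obtain m where m: "\<And>j. j \<ge> m \<Longrightarrow> f j = f m" using eventually_const_nat by blast
  obtain j where j: "j \<ge> m + n" "touches Db (u j) {q}" using inf by blast
  then have "f (j - n) < f (Suc (j - n))" using step[of "j - n"] by simp
  then show False using m[of "j - n"] m[of "Suc (j - n)"] j(1) by simp
qed

text \<open>The two alternatives for \<open>r\<close> mirror those of the reduced condition,
  expressed by blocks. In the second, stage at least 1 guarantees that a strategy is present in the
  state.\<close>

lemma red_qomega_intro:
  assumes inf: "\<And>n. \<exists>j\<ge>n. touches Db (u j) {q}"
    and q: "satisfies_corr A K q (iconcat (\<lambda>i. aproj D \<pi> q (w i)))"
    and r: "(\<forall>n. \<exists>j\<ge>n. touches D (w j) {r}) \<and> satisfies_corr A K r (iconcat (\<lambda>i. aproj D \<pi> r (w i))) \<or>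
      (\<exists>m c. (\<forall>j\<ge>m. \<not> touches D (w j) {r} \<and> stage (t j q) \<ge> 1 \<and> r_c (t j q) = c) \<and>
         (\<forall>v s'. maximal_respecting D A r (\<pi> r c) (strat c) v s' \<longrightarrow> s' \<in> fin_ok K r))"
  shows "satisfies_corr Ab Kb q (iconcat (\<lambda>i. aproj Db \<pi>b q (u i)))"
proof -
  let ?v = "\<lambda>i. aproj Db \<pi>b q (u i)"
  obtain W where W: "iconcat ?v = Inf W" using iconcat_Inf_iff[of ?v] inf by (auto simp: aproj_empty_iff)
  have elem: "fst y = \<pi>b q (t i q) \<and> y \<in> red_qstates D A r q \<times> acts_of Db q \<times> red_qstates D A r q"
    if y: "y \<in> set (?v i)" for y i
  proof -
    have "\<pi>b q (t j q) \<in> red_qstates D A r q" for j using \<pi>b_st[of q "t j q"] tq q_procs q_ne_r by simp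
    then show ?thesis
      using block[of i] y by (auto simp: acts_of_def gtrans_def split: if_splits)
  qed
  have "range W = (\<Union>i. set (?v i))" using set_iconcat[of ?v] W by simp
  then have rng: "range W \<subseteq> red_qstates D A r q \<times> acts_of Db q \<times> red_qstates D A r q"
    using elem by blast
  have pq: "red_proj D q q_of W = iconcat (\<lambda>i. aproj D \<pi> q (w i))"
    and pr: "red_proj D r r_of W = iconcat (\<lambda>i. aproj D \<pi> r (w i))"
    unfolding red_proj_iconcat[OF W] proj_q proj_r by (rule refl)+
  have third: "case red_proj D r r_of W of Inf v \<Rightarrow> v \<in> inf_ok K r
          | Fin v \<Rightarrow> (\<exists>sr f.
              (\<forall>\<^sub>\<infinity>i. \<exists>sq. fst (W i) = QRF sq sr f \<or> (\<exists>a. fst (W i) = QARF sq a sr f)) \<and>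
              (\<forall>u s'. maximal_respecting D A r sr f u s' \<longrightarrow> s' \<in> fin_ok K r))"
    using r
  proof (elim disjE exE conjE)
    assume "\<forall>n. \<exists>j\<ge>n. touches D (w j) {r}" and ok: "satisfies_corr A K r (iconcat (\<lambda>i. aproj D \<pi> r (w i)))"
    then obtain v where "iconcat (\<lambda>i. aproj D \<pi> r (w i)) = Inf v"
      using iconcat_Inf_iff[of "\<lambda>i. aproj D \<pi> r (w i)"] by (auto simp: aproj_empty_iff)
    then show ?thesis using ok pr by simp
  next
    fix m c
    assume m: "\<forall>j\<ge>m. \<not> touches D (w j) {r} \<and> stage (t j q) \<ge> 1 \<and> r_c (t j q) = c"
      and ok: "\<forall>v s'. maximal_respecting D A r (\<pi> r c) (strat c) v s' \<longrightarrow> s' \<in> fin_ok K r"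
    have "iconcat (\<lambda>i. aproj D \<pi> r (w i)) = Fin (concats (\<lambda>i. aproj D \<pi> r (w i)) m)"
      unfolding iconcat_Fin_iff using m by (auto simp: aproj_empty_iff)
    moreover have "\<forall>\<^sub>\<infinity>i. \<exists>sq. fst (W i) = QRF sq (\<pi> r c) (strat c) \<or> (\<exists>a. fst (W i) = QARF sq a (\<pi> r c) (strat c))"
    proof -
      \<comment> \<open>The condition speaks of positions of the projected run, the hypothesis of
        block boundaries; late positions stem from late blocks.\<close>
      obtain k where k: "\<forall>i\<ge>k. \<exists>j\<ge>m. W i \<in> set (?v j)" using iconcat_tail[OF W] by blast
      have "\<exists>sq. fst (W i) = QRF sq (\<pi> r c) (strat c) \<or> (\<exists>a. fst (W i) = QARF sq a (\<pi> r c) (strat c))"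
        if "i \<ge> k" for i
      proof -
        from k that have "\<exists>j\<ge>m. W i \<in> set (?v j)" by simp
        then obtain j where j: "j \<ge> m" "W i \<in> set (?v j)" by (elim exE conjE)
        obtain l c' d where x: "t j q = Joint l c' d" using tq[of j] unfolding Sb_q by blast
        have "fst (W i) = \<pi>b q (t j q)" using elem[OF j(2)] by simp
        moreover have "l \<ge> 1" "d = c" using m j(1) x by auto
        ultimately show ?thesis using x by (simp add: \<pi>b_def)
      qed
      then show ?thesis unfolding MOST_nat_le by blast
    qed
    ultimately show ?thesis using ok pr by auto
  qed
  show ?thesis unfolding W using rng q pq third by (simp add: red_condition_def red_qomega_def)
qed

text \<open>If \<open>r\<close> also moves infinitely often, no action of \<open>q\<close> or
  \<open>r\<close> can be neglected and the erased run is maximal. If \<open>r\<close> stops, one of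
  its actions may remain enabled for ever; each way of completing its local moves is then inserted
  into the erased run.\<close>

lemma infinite_case:
  assumes inf: "\<And>n. \<exists>j\<ge>n. touches Db (u j) {q}" and p: "p \<in> procs Db"
  shows "satisfies_corr Ab Kb p (iconcat (\<lambda>i. aproj Db \<pi>b p (u i)))"
proof (cases "\<forall>n. \<exists>j\<ge>n. touches D (w j) {r}")
  case True
  have "block_maximal D C s w"
    unfolding block_maximal_def
  proof (intro allI impI)
    fix i a assume e: "enabled D C (s i) a"
    show "\<exists>j\<ge>i. touches D (w j) (adom D a)"
    proof (cases "q \<in> adom D a \<or> r \<in> adom D a")
      case qr: True
      then show ?thesis
        using q_infinite[OF inf, of i] True touches_subset[of D _ "{q}" "adom D a"]
          touches_subset[of D _ "{r}" "adom D a"] by blast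
    next
      case False
      then show ?thesis using other_touch[OF e] by simp
    qed
  qed
  note ok = correct_coveringD[OF correct crun this]
  show ?thesis
  proof (cases "p = q")
    case True
    then show ?thesis
      using red_qomega_intro[OF inf ok[OF q_procs]] ok[OF r_procs] \<open>\<forall>n. \<exists>j\<ge>n. touches D (w j) {r}\<close> by blast
  next
    case False
    then show ?thesis using corr_transfer ok p by simp
  qed
next
  case False
  then obtain n where n: "\<And>j. j \<ge> n \<Longrightarrow> \<not> touches D (w j) {r}" by blast
  \<comment> \<open>Stage 0 is re-entered only by a synchronisation with \<open>r\<close>. Without
    further moves of \<open>r\<close>, a stage of at least 1 persists, and so does the controller
    state of \<open>r\<close>.\<close>
  have keep: "(stage (t j q) \<ge> 1 \<longrightarrow> stage (t (Suc j) q) \<ge> 1 \<and> r_c (t (Suc j) q) = r_c (t j q)) \<and>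
      (touches Db (u j) {q} \<longrightarrow> stage (t (Suc j) q) \<ge> 1)" if "j \<ge> n" for j
    using block[of j]
  proof (elim disjE exE conjE)
    fix x assume x: "u j = [(t j, x, t (Suc j))]" "gtrans Db Cb (t j) x (t (Suc j))"
    show ?thesis
    proof (cases "\<exists>b. x = Act b")
      case True
      then obtain b where b: "x = Act b" by blast
      have rb: "r \<notin> adom D b" using n[OF that] by (auto simp: w_def x(1) b)
      show ?thesis
      proof (cases "q \<in> adom Db x")
        case True
        have "adom D b \<noteq> {r}" using rb by auto
        then have "stage (t (Suc j) q) = 1" "r_c (t (Suc j) q) = r_c (t j q)"
          using step_Act(2)[of "t j" b] x(2) b True rb by (auto simp: qcond_def next_stage_def)
        then show ?thesis by simp
      next
        case False
        then show ?thesis using gtrans_outside[OF x(2) False] x(1) by simp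
      qed
    next
      case False
      then show ?thesis using step_Ch[OF x(2)] by auto
    qed
  qed simp
  obtain j where j: "j \<ge> n" "touches Db (u j) {q}" using inf by blast
  define m where "m = Suc j"
  define c where "c = r_c (t m q)"
  have sim_inv: "stage (t i q) \<ge> 1 \<and> r_c (t i q) = c" if "i \<ge> m" for i
    using that
  proof (induction rule: dec_induct)
    case base
    then show ?case using keep[OF j(1)] j(2) by (simp add: m_def c_def)
  next
    case (step i)
    then show ?case using keep[of i] j(1) by (simp add: m_def)
  qed
  have cst: "c \<in> st C r" using tq[of m] by (auto simp: Sb_q c_def)
  have sm: "s m r = c" by (simp add: s_def decode_r c_def)
  have noR: "\<not> touches D (w i) {r}" if "i \<ge> m" for i using n that j(1) by (simp add: m_def)
  \<comment> \<open>Inserting the moves \<open>v\<close> at boundary \<open>m\<close> makes the run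
    of \<open>C\<close> maximal. It ends for \<open>r\<close> in \<open>s'\<close>, and the
    projections on the other processes are those of the original run.\<close>
  have key: "s' \<in> fin_ok K r \<and> (\<forall>p\<in>procs D - {r}. satisfies_corr A K p (iconcat (\<lambda>i. aproj D \<pi> p (w i))))"
    if mr: "maximal_respecting D A r (\<pi> r c) (strat c) v s'" for v s'
  proof -
    obtain c' where c': "lpath D C r c v c'" "\<pi> r c' = s'" "c' \<in> st C r"
      "\<And>b d. b \<in> loc_acts D r \<Longrightarrow> allowed D r (strat c') b \<Longrightarrow> (tup1 r c', tup1 r d) \<in> delta C b \<Longrightarrow>
        follows D A r (\<pi> r c) (strat c) (v @ [b]) (\<pi> r d)"
      using follows_C[OF _ cst] mr unfolding maximal_respecting_def by blast
    obtain \<rho> where \<rho>: "path D C (s m) \<rho> ((s m)(r := c'))"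
      "\<And>x a x'. (x, a, x') \<in> set \<rho> \<Longrightarrow> adom D a = {r} \<and> a \<in> loc_acts D r"
      using lpath_path[of D C r c v c' "s m", OF c'(1) sm] by blast
    let ?z = "(s m)(r := c')"
    let ?s = "insert_st m {r} ?z s" and ?w = "insert_block m {r} ?z \<rho> w"
    have rho: "adom D a \<subseteq> {r}" if "(x, a, x') \<in> set \<rho>" for x a x' using \<rho>(2)[OF that] by simp
    have run': "block_run D C ?s ?w"
      by (rule block_run_insert[OF crun \<rho>(1) rho noR])
    have tch: "touches D (?w i) X \<longleftrightarrow> touches D (w i) X" if "i > m" for i X
      using that by (simp add: insert_block_def touches_ovstep)
    have "block_maximal D C ?s ?w"
    proof (rule block_maximalI_late[OF C run', of "Suc m"])
      fix i a assume i: "i \<ge> Suc m" and e: "enabled D C (?s i) a"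
      have a: "a \<in> acts D" by (rule enabled_acts[OF e])
      have "\<exists>j\<ge>i. touches D (w j) (adom D a)"
      proof (cases "q \<in> adom D a")
        case True
        then show ?thesis using q_infinite[OF inf, of i] touches_subset[of D _ "{q}" "adom D a"] by blast
      next
        case qF: False
        show ?thesis
        proof (cases "r \<in> adom D a")
          case True
          then have ad: "adom D a = {r}" using adom_r[OF a] qF by auto
          have "?s i r = c'" using i by (simp add: insert_st_def)
          then have "tup1 r c' \<in> Domain (delta C a)"
            using e enabled_iff[OF C a] ad by (simp add: restrict_singleton)
          \<comment> \<open>An enabled local action of \<open>r\<close> after the insertion would
            yield an allowed one and hence a prolongation of \<open>v\<close>, against its
            maximality.\<close>
          then obtain b d where "b \<in> loc_acts D r" "allowed D r (strat c') b" "(tup1 r c', tup1 r d) \<in> delta C b"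
            using r_progress[of a c'] a ad by (auto simp: loc_acts_def)
          then show ?thesis using c'(4) mr unfolding maximal_respecting_def by blast
        next
          case False
          have "?s i p = s i p" if "p \<in> adom D a" for p
            using that False by (auto simp: insert_st_def override_on_def)
          then have "enabled D C (s i) a" using e enabled_cong[OF C, of a "?s i" "s i"] by simp
          then show ?thesis using other_touch qF False by blast
        qed
      qed
      then show "\<exists>j\<ge>i. touches D (?w j) (adom D a)" using tch i by (meson Suc_le_lessD order_trans)
    qed
    note ok = correct_coveringD[OF correct run' this]
    have "\<not> touches D (?w i) {r}" if "i \<ge> Suc m" for i using tch noR that by simp
    then have "\<pi> r (?s (Suc m) r) \<in> fin_ok K r"
      using satisfies_corr_finite[where p = r and \<pi> = \<pi>, OF run' \<pi>_init[OF r_procs]] ok[OF r_procs] by blast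
    then have "s' \<in> fin_ok K r" using c'(2) by (simp add: insert_st_def)
    moreover have "satisfies_corr A K p (iconcat (\<lambda>i. aproj D \<pi> p (w i)))" if "p \<in> procs D - {r}" for p
    proof -
      have "aproj D \<pi> p (?w i) = aproj D \<pi> p (w i)" for i
        by (rule aproj_insert) (use that rho in auto)
      then show ?thesis using ok[of p] that by simp
    qed
    ultimately show ?thesis by blast
  qed
  \<comment> \<open>Correctness of the other processes is obtained through one such insertion, so at
    least one maximal sequence has to exist.\<close>
  obtain v s' where "maximal_respecting D A r (\<pi> r c) (strat c) v s'"
    using ex_maximal_respecting \<pi>_st[OF r_procs cst] by blast
  from key[OF this] have ok: "satisfies_corr A K p (iconcat (\<lambda>i. aproj D \<pi> p (w i)))" if "p \<in> procs D" "p \<noteq> r" for p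
    using that by blast
  show ?thesis
  proof (cases "p = q")
    case True
    show ?thesis
      unfolding True
    proof (rule red_qomega_intro[OF inf ok[OF q_procs q_ne_r(1)]], rule disjI2, intro exI conjI)
      show "\<forall>j\<ge>m. \<not> touches D (w j) {r} \<and> 1 \<le> stage (t j q) \<and> r_c (t j q) = c" using sim_inv noR by blast
      show "\<forall>v s'. maximal_respecting D A r (\<pi> r c) (strat c) v s' \<longrightarrow> s' \<in> fin_ok K r" using key by blast
    qed
  next
    case False
    then show ?thesis using corr_transfer ok p by simp
  qed
qed

lemma correct_run:
  assumes "p \<in> procs Db"
  shows "satisfies_corr Ab Kb p (iconcat (\<lambda>i. aproj Db \<pi>b p (u i)))"
proof (cases "\<exists>n. \<forall>j\<ge>n. \<not> touches Db (u j) {q}")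
  case True
  then show ?thesis using finite_case assms by blast
next
  case False
  then show ?thesis using infinite_case assms by blast
qed

end

context reduction_forward
begin

lemma controllable_reduced: "controllable Db Ab Kb"
proof (rule controllableI[of Db Ab Cb \<pi>b])
  fix p c assume "p \<in> procs Db" "c \<in> st Cb p"
  then show "\<pi>b p c \<in> st Ab p" using \<pi>b_st by simp
next
  fix p assume "p \<in> procs Db"
  then show "\<pi>b p (init_st Cb p) = init_st Ab p"
    using \<pi>_init q_procs r_procs by (auto simp: Cb_def init_Ab \<pi>b_def)
next
  fix a s \<rho> assume "path Db Cb (init_st Cb) \<rho> s" "a \<in> env Db"
    "(\<lambda>p\<in>adom Db a. \<pi>b p (s p)) \<in> Domain (delta Ab a)"
  then show "enabled Db Cb s a" using Cb_env reach_tuple[OF Db Cb] by simp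
next
  fix t u p assume "block_run Db Cb t u" "block_maximal Db Cb t u" "\<And>i. length (u i) \<le> 1" and p: "p \<in> procs Db"
  then interpret forward_run D A K r q C \<pi> t u by unfold_locales
  show "satisfies_corr Ab Kb p (iconcat (\<lambda>i. aproj Db \<pi>b p (u i)))" by (rule correct_run[OF p])
qed (use Db Ab Cb Cb_hom in auto)

end

section \<open>From a controller of the reduced automaton to a controller\<close>

lemma conc_iword_Nil [simp]: "conc_iword [] W = W"
  by (cases W) auto

lemma iconcat_shift: "u 0 = [] \<Longrightarrow> iconcat u = iconcat (\<lambda>i. u (Suc i))"
  using iconcat_split[of u 1] by simp

text \<open>Converse use of blocks: it locates the first letter of block \<open>j\<close> at a
  definite position, which allows the acceptance condition to be evaluated at a block
  boundary.\<close>

lemma iconcat_hd: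
  assumes "iconcat u = Inf w" "u j \<noteq> []"
  shows "w (length (concats u j)) = hd (u j)"
proof -
  have "concats u (Suc j) \<in> iprefixes (Inf w)" using concats_in_iprefixes[of u "Suc j"] assms(1) by simp
  then have *: "concats u (Suc j) = map w [0..<length (concats u (Suc j))]" by (simp only: iprefixes_Inf)
  have l: "length (concats u j) < length (concats u (Suc j))" using assms(2) by simp
  have "concats u (Suc j) ! length (concats u j) = w (length (concats u j))"
    by (subst *) (use l in \<open>simp del: concats_Suc\<close>)
  then show ?thesis using assms(2) by (simp add: nth_append hd_conv_nth)
qed

lemma length_concats_unbounded:
  assumes "\<And>n. \<exists>m\<ge>n. u m \<noteq> []"
  shows "\<exists>j\<ge>n. u j \<noteq> [] \<and> k \<le> length (concats u j)"
proof (induction k)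
  case (Suc k)
  then obtain j where j: "j \<ge> n" "u j \<noteq> []" "k \<le> length (concats u j)" by blast
  obtain m where m: "m \<ge> Suc j" "u m \<noteq> []" using assms by blast
  obtain v where "concats u m = concats u (Suc j) @ v" using concats_le[OF m(1)] by blast
  then have "length (concats u m) \<ge> length (concats u j) + length (u j)" by simp
  moreover have "length (u j) \<ge> 1" using j(2) by (simp add: Suc_leI)
  ultimately have "Suc k \<le> length (concats u m)" using j(3) by linarith
  then show ?case using m j(1) by (intro exI[of _ m]) simp
qed (use assms in auto)

lemma aproj_hd: "path D C s \<rho> s' \<Longrightarrow> aproj D \<pi> p \<rho> \<noteq> [] \<Longrightarrow> fst (hd (aproj D \<pi> p \<rho>)) = \<pi> p (s p)"
proof (induction \<rho> arbitrary: s)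
  case (Cons x \<rho>)
  obtain t a t' where x: "x = (t, a, t')" by (cases x)
  show ?case
    using Cons.IH[of t'] Cons.prems gtrans_outside[of D C s a t' p] by (auto simp: x split: if_splits)
qed simp

lemma lpath_det:
  assumes "zielonka D C" "lpath D C p c v d" "lpath D C p c v d'"
  shows "d = d'"
  using assms(2,3)
proof (induction v arbitrary: c)
  case (Cons a v)
  then obtain e e' where e: "a \<in> loc_acts D p" "(tup1 p c, tup1 p e) \<in> delta C a" "lpath D C p e v d"
    "(tup1 p c, tup1 p e') \<in> delta C a" "lpath D C p e' v d'" by auto
  have "single_valued (delta C a)" using assms(1) e(1) by (auto simp: zielonka_def loc_acts_def)
  then have "tup1 p e = tup1 p e'" using e(2,4) by (blast dest: single_valuedD)
  then have "e = e'" by simp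
  then show ?case using Cons.IH e by blast
qed auto

section \<open>Recorded local moves of \<open>r\<close>\<close>

fun str_of :: "('a, 's) rstate \<Rightarrow> 'a strategy" where
  "str_of (QRF sq sr f) = f"
| "str_of (QARF sq a sr f) = f"
| "str_of _ = (\<lambda>_. None)"

text \<open>An annotated form of \<open>follows\<close> that also yields the residual strategy at
  the end. Entries are full transitions rather than letters, because the record later has to match a
  projection on \<open>r\<close>.\<close>

fun pending :: "('p, 'a) alphabet \<Rightarrow> ('p, 'a, 's) zautomaton \<Rightarrow> 'p \<Rightarrow> 's \<Rightarrow> 'a strategy \<Rightarrow>
    ('s \<times> 'a \<times> 's) list \<Rightarrow> 's \<Rightarrow> 'a strategy \<Rightarrow> bool" where
  "pending D A r s0 f0 [] s f \<longleftrightarrow> s = s0 \<and> f = f0"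
| "pending D A r s0 f0 ((s1, b, s2) # v) s f \<longleftrightarrow> s1 = s0 \<and> allowed D r f0 b \<and>
     (tup1 r s0, tup1 r s2) \<in> delta A b \<and> pending D A r s2 (residual f0 b) v s f"

abbreviation word_of :: "('s \<times> 'a \<times> 's) list \<Rightarrow> 'a list" where
  "word_of v \<equiv> map (\<lambda>(s, b, s'). b) v"

context reduction
begin

lemma pending_snoc:
  "pending D A r s0 f0 v s f \<Longrightarrow> allowed D r f b \<Longrightarrow> (tup1 r s, tup1 r s') \<in> delta A b \<Longrightarrow>
    pending D A r s0 f0 (v @ [(s, b, s')]) s' (residual f b)"
  by (induction v arbitrary: s0 f0) auto

lemma pending_follows: "pending D A r s0 f0 v s f \<Longrightarrow> follows D A r s0 f0 (word_of v) s"
  by (induction v arbitrary: s0 f0) auto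

text \<open>By determinism the sequence must pass through the state and the residual strategy at
  which the record ends, so its last letter is a step from there.\<close>

lemma pending_follows_snoc:
  "pending D A r s0 f0 v s f \<Longrightarrow> follows D A r s0 f0 (word_of v @ [b]) s' \<Longrightarrow>
    allowed D r f b \<and> (tup1 r s, tup1 r s') \<in> delta A b"
proof (induction v arbitrary: s0 f0)
  case (Cons x v)
  obtain s1 c s2 where x: "x = (s1, c, s2)" by (cases x)
  have "c \<in> loc_acts D r" using Cons.prems by (simp add: x allowed_def)
  then show ?case using Cons.IH[of s2 "residual f0 c"] Cons.prems loc_det[of c r s0 s2] by (auto simp: x)
qed auto

lemma pending_st:
  "pending D A r s0 f0 v s f \<Longrightarrow> s0 \<in> st A r \<Longrightarrow> local_strategy D A r s0 f0 \<Longrightarrow>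
    s \<in> st A r \<and> local_strategy D A r s f \<and> set v \<subseteq> st A r \<times> acts D \<times> st A r"
proof (induction v arbitrary: s0 f0)
  case (Cons x v)
  obtain s1 c s2 where x: "x = (s1, c, s2)" by (cases x)
  have c: "c \<in> loc_acts D r" "(tup1 r s0, tup1 r s2) \<in> delta A c" "s1 = s0"
    using Cons.prems by (auto simp: x allowed_def)
  show ?case
    using Cons.IH[of s2 "residual f0 c"] Cons.prems loc_st[OF c(1,2)] local_strategy_residual[OF _ c(1,2)] c(3)
      loc_actsD(1)[OF c(1)]
    by (auto simp: x)
qed auto

lemma pending_length:
  assumes "pending D A r s0 f0 v s f" "s0 \<in> st A r"
  shows "length v \<le> shortness"
  using lpath_short[OF assms(2) follows_lpath[OF pending_follows[OF assms(1)]]] by simp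

text \<open>Constructs the target that \<open>red_trans_Act_iff\<close> asks for: the kind of
  \<open>q\<close>-state depends on the domain of \<open>a\<close>, and the local states are taken
  from the transition of \<open>A\<close>.\<close>

lemma Ab_enabled:
  assumes a: "a \<in> acts D" and y: "y \<in> (\<Pi>\<^sub>E p\<in>adom Db (Act a). st Ab p)" and z: "(base a y, z) \<in> delta A a"
    and qs: "q \<in> adom Db (Act a) \<Longrightarrow> \<exists>sq an sr f. y q = QARF sq an sr f \<and> (a \<in> sys D \<and> q \<in> adom D a \<longrightarrow> a = an) \<and>
      (adom D a = {r} \<longrightarrow> allowed D r f a)"
  shows "y \<in> Domain (delta Ab (Act a))"
proof -
  have zS: "z \<in> (\<Pi>\<^sub>E p\<in>adom D a. st A p)" by (rule delta_st(2)[OF a z])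
  define tgt where "tgt x = (case x of QARF sq an sr f \<Rightarrow>
      if adom D a = {r} then QARF sq an (z r) (residual f a)
      else if r \<in> adom D a then QR (z q) (z r) else QRF (z q) sr f | _ \<Rightarrow> x)" for x
  define y' where "y' = (\<lambda>p\<in>adom Db (Act a). if p = q then tgt (y q) else Other (z p))"
  have q_st: "tgt (y q) \<in> red_qstates D A r q \<and> qstep a (y q) (tgt (y q)) \<and>
      (q \<in> adom D a \<longrightarrow> main_of (tgt (y q)) = z q) \<and> (r \<in> adom D a \<longrightarrow> r_of (tgt (y q)) = z r)"
    if qd: "q \<in> adom Db (Act a)"
  proof -
    obtain sq an sr f where x: "y q = QARF sq an sr f" "a \<in> sys D \<and> q \<in> adom D a \<longrightarrow> a = an"
      "adom D a = {r} \<longrightarrow> allowed D r f a" using qs[OF qd] by blast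
    have yq: "QARF sq an sr f \<in> red_qstates D A r q" using PiE_mem[OF y qd] x(1) by simp
    show ?thesis
    proof (cases "adom D a = {r}")
      case True
      then have "a \<in> loc_acts D r" using a by (simp add: loc_acts_def)
      moreover have "base a y = tup1 r sr" "z = tup1 r (z r)"
        using True x(1) PiE_restrict[OF zS] by (simp_all add: base_def restrict_singleton)
      then have "(tup1 r sr, tup1 r (z r)) \<in> delta A a" using z by simp
      ultimately have "z r \<in> st A r" "local_strategy D A r (z r) (residual f a)"
        using loc_st local_strategy_residual yq by auto
      then show ?thesis using True x yq q_ne_r by (auto simp: tgt_def qstep_def)
    next
      case False
      then have qa: "q \<in> adom D a" using qd adom_r[OF a] by (auto simp: in_adom_Db)
      show ?thesis
        using False x yq qa PiE_mem[OF zS qa] PiE_mem[OF zS, of r] by (auto simp: tgt_def qstep_def)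
    qed
  qed
  have y': "y' \<in> (\<Pi>\<^sub>E p\<in>adom Db (Act a). st Ab p)"
  proof (rule PiE_I)
    fix p assume p: "p \<in> adom Db (Act a)"
    show "y' p \<in> st Ab p"
    proof (cases "p = q")
      case False
      then have "z p \<in> st A p" using p PiE_mem[OF zS, of p] by (auto simp: in_adom_Db)
      then show ?thesis using False p by (simp add: y'_def)
    qed (use q_st p in \<open>simp add: y'_def\<close>)
  qed (simp add: y'_def)
  have "base a y' p = z p" for p
  proof (cases "p \<in> adom D a")
    case True
    show ?thesis
    proof (cases "p = r")
      case pr: True
      have "q \<in> adom Db (Act a)" using True pr q_ne_r by (auto simp: in_adom_Db)
      then show ?thesis using q_st True pr by (simp add: base_def y'_def)
    next
      case False
      then have "p \<in> adom Db (Act a)" using True by (simp add: in_adom_Db)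
      then show ?thesis using q_st True False by (auto simp: base_def y'_def)
    qed
  next
    case False
    then show ?thesis using PiE_arb[OF zS False] by (simp add: base_def)
  qed
  then have "base a y' = z" ..
  then have "red_trans D A r q (Act a) y y'"
    unfolding red_trans_Act_iff using a y y' z q_st by (simp add: y'_def del: st_Ab)
  then show ?thesis unfolding Domain_iff delta_Ab by blast
qed

end

text \<open>\<open>Main\<close> serves every process except \<open>r\<close>. There is no controller
  component for \<open>r\<close> to inherit, since the given controller keeps all its information on
  \<open>r\<close> inside \<open>q\<close>.\<close>

datatype ('c, 'a, 's) split = Main (un_main: 'c) | Late (cur: 's) (strt: "'a strategy") (pend: "('s \<times> 'a \<times> 's) list")

text \<open>
  The new \<open>q\<close> simulates the reduced process \<open>q\<close> as if \<open>r\<close> had not moved since their last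
  synchronisation; \<open>r\<close> records its moves and hands them over at the next synchronisation.
\<close>

locale reduction_backward = reduction D A K r q
  for D :: "('p, 'a) alphabet" and A :: "('p, 'a, 's) zautomaton" and K r q +
  fixes Cb :: "('p, 'a raction, 'c) zautomaton" and \<pi>b
  assumes correct: "correct_covering Db Ab Kb Cb \<pi>b"
begin

lemma cov: "covering Db Ab Cb \<pi>b" and Cb: "zielonka Db Cb"
  using correct by (auto simp: correct_covering_def covering_def)

lemma \<pi>b_st: "p \<in> procs Db \<Longrightarrow> c \<in> st Cb p \<Longrightarrow> \<pi>b p c \<in> st Ab p"
  and \<pi>b_init: "p \<in> procs Db \<Longrightarrow> \<pi>b p (init_st Cb p) = init_st Ab p"
  using cov unfolding covering_def by blast+

lemma Cb_hom:
  assumes "x \<in> acts Db" "(c, c') \<in> delta Cb x"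
  shows "((\<lambda>p\<in>adom Db x. \<pi>b p (c p)), (\<lambda>p\<in>adom Db x. \<pi>b p (c' p))) \<in> delta Ab x"
  using cov assms unfolding covering_def by blast

lemma Cb_env:
  assumes "x \<in> env Db" "c \<in> (\<Pi>\<^sub>E p\<in>adom Db x. st Cb p)" "(\<lambda>p\<in>adom Db x. \<pi>b p (c p)) \<in> Domain (delta Ab x)"
  shows "c \<in> Domain (delta Cb x)"
  using cov assms unfolding covering_def by blast

lemma Cb_st:
  assumes "a \<in> acts Db" "(x, x') \<in> delta Cb a"
  shows "x \<in> (\<Pi>\<^sub>E p\<in>adom Db a. st Cb p)" "x' \<in> (\<Pi>\<^sub>E p\<in>adom Db a. st Cb p)"
  using Cb assms unfolding zielonka_def by blast+

lemma Cb_det: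
  assumes "a \<in> acts Db" "(x, x') \<in> delta Cb a" "(x, x'') \<in> delta Cb a"
  shows "x' = x''"
  using Cb assms unfolding zielonka_def single_valued_def by blast

lemma q_Db: "q \<in> procs Db"
  using q_procs q_ne_r by simp

section \<open>Announcements and replay inside the given reduced controller\<close>

definition absA :: "('p \<Rightarrow> 'c) \<Rightarrow> 'p \<Rightarrow> 's" where
  "absA t p = (if p = r then r_of (\<pi>b q (t q)) else main_of (\<pi>b p (t p)))"

lemma base_absA: "base b (\<lambda>p\<in>adom Db (Act b). \<pi>b p (t p)) = restrict (absA t) (adom D b)"
  using q_ne_r by (auto simp: base_def absA_def in_adom_Db)

lemma step_Act:
  assumes g: "gtrans Db Cb t (Act b) t'"
  shows "b \<in> acts D" "(restrict (absA t) (adom D b), restrict (absA t') (adom D b)) \<in> delta A b"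
    "q \<in> adom Db (Act b) \<Longrightarrow> qstep b (\<pi>b q (t q)) (\<pi>b q (t' q))"
proof -
  show b: "b \<in> acts D" using g by (simp add: gtrans_def)
  let ?X = "adom Db (Act b)"
  have "(restrict t ?X, restrict t' ?X) \<in> delta Cb (Act b)" using g by (simp add: gtrans_def)
  from Cb_hom[OF _ this] b
  have "red_trans D A r q (Act b) (\<lambda>p\<in>?X. \<pi>b p (t p)) (\<lambda>p\<in>?X. \<pi>b p (t' p))"
    by (simp add: delta_Ab cong: restrict_cong)
  from this[unfolded red_trans_Act_iff base_absA]
  show "(restrict (absA t) (adom D b), restrict (absA t') (adom D b)) \<in> delta A b"
    "q \<in> ?X \<Longrightarrow> qstep b (\<pi>b q (t q)) (\<pi>b q (t' q))" by auto
qed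

lemma Ch_delta:
  assumes "(tup1 q c, tup1 q c') \<in> delta Cb x" "x \<in> acts Db" "\<And>b. x \<noteq> Act b"
  shows "(\<exists>sq sr f. \<pi>b q c = QR sq sr \<and> \<pi>b q c' = QRF sq sr f) \<or>
    (\<exists>sq sr f a. \<pi>b q c = QRF sq sr f \<and> \<pi>b q c' = QARF sq a sr f)"
proof -
  have ad: "adom Db x = {q}" using assms(3) by (cases x) (auto simp: adom_Db)
  from Cb_hom[OF assms(2,1)] have "(tup1 q (\<pi>b q c), tup1 q (\<pi>b q c')) \<in> delta Ab x"
    by (simp add: ad restrict_singleton)
  then show ?thesis
    using assms(3) by (cases x) (auto simp: delta_Ab red_trans_ChF_iff red_trans_ChA_iff)
qed

lemma gtrans_Ch:
  assumes "gtrans Db Cb t x t'" "\<And>b. x \<noteq> Act b"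
  shows "(tup1 q (t q), tup1 q (t' q)) \<in> delta Cb x" "x \<in> acts Db" "adom Db x = {q}"
proof -
  show ad: "adom Db x = {q}" using assms(2) by (cases x) (auto simp: adom_Db)
  then show "(tup1 q (t q), tup1 q (t' q)) \<in> delta Cb x" "x \<in> acts Db"
    using assms(1) by (auto simp: gtrans_def restrict_singleton)
qed

definition reach :: "('p \<Rightarrow> 'c) \<Rightarrow> bool" where
  "reach t \<longleftrightarrow> (\<exists>\<rho>. path Db Cb (init_st Cb) \<rho> t)"

lemma reach_path: "reach t \<Longrightarrow> path Db Cb t \<rho> t' \<Longrightarrow> reach t'"
  unfolding reach_def using path_append by metis

lemma reach_st: "reach t \<Longrightarrow> t \<in> (\<Pi>\<^sub>E p\<in>procs Db. st Cb p)"
  unfolding reach_def using reach_tuple[OF Db Cb] by blast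

lemma reach_q: "reach t \<Longrightarrow> t q \<in> st Cb q" "reach t \<Longrightarrow> \<pi>b q (t q) \<in> red_qstates D A r q"
proof -
  show 1: "reach t \<Longrightarrow> t q \<in> st Cb q" using PiE_mem[OF reach_st q_Db] .
  show "reach t \<Longrightarrow> \<pi>b q (t q) \<in> red_qstates D A r q" using \<pi>b_st[OF q_Db 1] by simp
qed

text \<open>
  Otherwise \<open>q\<close> would be blocked for ever in a state that is not final, in any maximal run.
\<close>

lemma not_stuck:
  assumes t: "reach t" and no: "\<And>sq a sr f. \<pi>b q (t q) \<noteq> QARF sq a sr f"
  shows "\<exists>x c. x \<in> acts Db \<and> (\<forall>b. x \<noteq> Act b) \<and> (tup1 q (t q), tup1 q c) \<in> delta Cb x"
proof (rule ccontr)
  assume stuck: "\<not> ?thesis"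
  obtain \<rho> where \<rho>: "path Db Cb (init_st Cb) \<rho> t" using t by (auto simp: reach_def)
  have "\<exists>t' u. block_run Db Cb t' u \<and> block_maximal Db Cb t' u \<and> t' 1 = t"
    using Db by (intro block_maximal_extension[OF Cb _ \<rho>]) (auto simp: dist_alphabet_def)
  then obtain t' u where r: "block_run Db Cb t' u" and m: "block_maximal Db Cb t' u" and t1: "t' 1 = t" by blast
  \<comment> \<open>In its present state \<open>q\<close> can take no original action, as these
    require \<open>QARF\<close>, and by assumption no announcement; so it keeps that state along
    every path.\<close>
  have path: "path Db Cb t1 \<rho> t2 \<Longrightarrow> t1 q = t q \<Longrightarrow> t2 q = t q \<and> \<not> touches Db \<rho> {q}" for t1 \<rho> t2
  proof (induction \<rho> arbitrary: t1)
    case (Cons y \<rho>)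
    obtain x t3 where y: "y = (t1, x, t3)" and g: "gtrans Db Cb t1 x t3" "path Db Cb t3 \<rho> t2"
      using Cons.prems by (cases y) auto
    have nq: "q \<notin> adom Db x"
    proof
      assume q: "q \<in> adom Db x"
      show False
      proof (cases "\<exists>b. x = Act b")
        case True
        then show ?thesis using step_Act(3)[of t1 _ t3] g(1) q Cons.prems(2) no by (auto simp: qstep_def)
      next
        case False
        then show ?thesis using gtrans_Ch[OF g(1)] Cons.prems(2) stuck by metis
      qed
    qed
    then have "t3 q = t q" using gtrans_outside[OF g(1)] Cons.prems(2) by simp
    then show ?case using Cons.IH[OF g(2)] nq by (auto simp: y)
  qed auto
  have "t' (Suc i) q = t q \<and> \<not> touches Db (u (Suc i)) {q}" for i
  proof (induction i)
    case 0
    then show ?case using path[OF block_run_path[OF r, of 1]] t1 by simp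
  next
    case (Suc i)
    then show ?case using path[OF block_run_path[OF r, of "Suc i"]] path[OF block_run_path[OF r, of "Suc (Suc i)"]] by simp
  qed
  then have "\<not> touches Db (u j) {q}" if "j \<ge> 1" for j using that by (cases j) auto
  then have "\<pi>b q (t' 1 q) \<in> fin_ok Kb q"
    using satisfies_corr_finite[where p = q and \<pi> = \<pi>b and n = 1, OF r \<pi>b_init[OF q_Db]]
      correct_coveringD[OF correct r m q_Db] by simp
  then show False using no t1 by (auto simp: red_condition_def)
qed

definition ch_step :: "'c \<Rightarrow> 'c" where
  "ch_step c = (if \<exists>x c'. x \<in> acts Db \<and> (\<forall>b. x \<noteq> Act b) \<and> (tup1 q c, tup1 q c') \<in> delta Cb x
     then SOME c'. \<exists>x. x \<in> acts Db \<and> (\<forall>b. x \<noteq> Act b) \<and> (tup1 q c, tup1 q c') \<in> delta Cb x else c)"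

text \<open>Two rounds cover the longest case, \<open>QR\<close> to \<open>QRF\<close> to
  \<open>QARF\<close>; in a state \<open>QARF\<close> no announcement exists and
  \<open>ch_step\<close> is the identity.\<close>

definition normalise :: "'c \<Rightarrow> 'c" where
  "normalise c = ch_step (ch_step c)"

definition silent :: "('p, 'a raction, 'c) gstep list \<Rightarrow> bool" where
  "silent \<rho> \<longleftrightarrow> (\<forall>(x, a, x')\<in>set \<rho>. (\<forall>b. a \<noteq> Act b) \<and> adom Db a = {q})"

lemma silent_append: "silent \<rho> \<Longrightarrow> silent \<rho>' \<Longrightarrow> silent (\<rho> @ \<rho>')"
  by (auto simp: silent_def)

lemma silent_proj: "silent \<rho> \<Longrightarrow> p \<noteq> q \<Longrightarrow> aproj Db \<pi> p \<rho> = []"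
  "silent \<rho> \<Longrightarrow> rproj D p' sel (aproj Db \<pi> q \<rho>) = []"
  by (induction \<rho>) (auto simp: silent_def)

lemma ch_step_path:
  assumes t: "reach t"
  shows "\<exists>\<rho>. path Db Cb t \<rho> (t(q := ch_step (t q))) \<and> silent \<rho> \<and>
    ((\<exists>sq a sr f. \<pi>b q (t q) = QARF sq a sr f \<and> ch_step (t q) = t q) \<or>
     (\<exists>sq sr f. \<pi>b q (t q) = QR sq sr \<and> \<pi>b q (ch_step (t q)) = QRF sq sr f) \<or>
     (\<exists>sq sr f a. \<pi>b q (t q) = QRF sq sr f \<and> \<pi>b q (ch_step (t q)) = QARF sq a sr f))"
proof (cases "\<exists>sq a sr f. \<pi>b q (t q) = QARF sq a sr f")
  case True
  then have "\<not> (\<exists>x c'. x \<in> acts Db \<and> (\<forall>b. x \<noteq> Act b) \<and> (tup1 q (t q), tup1 q c') \<in> delta Cb x)"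
    using Ch_delta by fastforce
  then have c: "ch_step (t q) = t q" unfolding ch_step_def by (rule if_not_P)
  then show ?thesis using True by (intro exI[of _ "[]"]) (auto simp: silent_def)
next
  case False
  then have ex: "\<exists>x c'. x \<in> acts Db \<and> (\<forall>b. x \<noteq> Act b) \<and> (tup1 q (t q), tup1 q c') \<in> delta Cb x"
    using not_stuck[OF t] by blast
  then have "\<exists>c' x. x \<in> acts Db \<and> (\<forall>b. x \<noteq> Act b) \<and> (tup1 q (t q), tup1 q c') \<in> delta Cb x" by blast
  from someI_ex[OF this] ex obtain x where x: "x \<in> acts Db" "\<And>b. x \<noteq> Act b"
    "(tup1 q (t q), tup1 q (ch_step (t q))) \<in> delta Cb x"
    unfolding ch_step_def by auto
  have ad: "adom Db x = {q}" using x(2) by (cases x) (auto simp: adom_Db)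
  have "gtrans Db Cb t x (t(q := ch_step (t q)))" using x ad by (simp add: gtrans_def restrict_singleton)
  then have "path Db Cb t [(t, x, t(q := ch_step (t q)))] (t(q := ch_step (t q)))" by simp
  moreover have "silent [(t, x, t(q := ch_step (t q)))]" using x(2) ad by (simp add: silent_def)
  ultimately show ?thesis using Ch_delta[OF x(3,1,2)] by blast
qed

text \<open>The last clause matters for steps of \<open>q\<close> without \<open>r\<close>: they end
  in \<open>QRF\<close>, and the strategy announced earlier must survive so that the record of
  \<open>r\<close> remains valid.\<close>

lemma normalise_path:
  assumes t: "reach t"
  shows "\<exists>\<rho> a f. path Db Cb t \<rho> (t(q := normalise (t q))) \<and> silent \<rho> \<and>
    \<pi>b q (normalise (t q)) = QARF (main_of (\<pi>b q (t q))) a (r_of (\<pi>b q (t q))) f \<and>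
    (\<forall>sq sr g. \<pi>b q (t q) = QRF sq sr g \<longrightarrow> f = g)"
proof -
  let ?t1 = "t(q := ch_step (t q))"
  obtain \<rho>1 where 1: "path Db Cb t \<rho>1 ?t1" "silent \<rho>1"
    "(\<exists>sq a sr f. \<pi>b q (t q) = QARF sq a sr f \<and> ch_step (t q) = t q) \<or>
     (\<exists>sq sr f. \<pi>b q (t q) = QR sq sr \<and> \<pi>b q (ch_step (t q)) = QRF sq sr f) \<or>
     (\<exists>sq sr f a. \<pi>b q (t q) = QRF sq sr f \<and> \<pi>b q (ch_step (t q)) = QARF sq a sr f)"
    using ch_step_path[OF t] by blast
  obtain \<rho>2 where 2: "path Db Cb ?t1 \<rho>2 (t(q := normalise (t q)))" "silent \<rho>2"
    "(\<exists>sq a sr f. \<pi>b q (ch_step (t q)) = QARF sq a sr f \<and> normalise (t q) = ch_step (t q)) \<or>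
     (\<exists>sq sr f. \<pi>b q (ch_step (t q)) = QR sq sr \<and> \<pi>b q (normalise (t q)) = QRF sq sr f) \<or>
     (\<exists>sq sr f a. \<pi>b q (ch_step (t q)) = QRF sq sr f \<and> \<pi>b q (normalise (t q)) = QARF sq a sr f)"
    using ch_step_path[OF reach_path[OF t 1(1)]] unfolding normalise_def fun_upd_same fun_upd_upd by blast
  have "path Db Cb t (\<rho>1 @ \<rho>2) (t(q := normalise (t q)))" using 1(1) 2(1) path_append by blast
  moreover have "silent (\<rho>1 @ \<rho>2)" using 1(2) 2(2) by (rule silent_append)
  moreover have "\<exists>a f. \<pi>b q (normalise (t q)) = QARF (main_of (\<pi>b q (t q))) a (r_of (\<pi>b q (t q))) f \<and>
    (\<forall>sq sr g. \<pi>b q (t q) = QRF sq sr g \<longrightarrow> f = g)"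
    using 1(3) 2(3) by (elim disjE exE conjE) simp_all
  ultimately show ?thesis by blast
qed

text \<open>In the reduced automaton a local action of \<open>r\<close> is uncontrollable; once
  allowed by the announced strategy it is enabled there, so the controller cannot refuse it.\<close>

lemma r_step:
  assumes c: "c \<in> st Cb q" "\<pi>b q c = QARF sq an s f" and b: "allowed D r f b" "(tup1 r s, tup1 r s') \<in> delta A b"
  shows "\<exists>c'. (tup1 q c, tup1 q c') \<in> delta Cb (Act b) \<and> c' \<in> st Cb q \<and> \<pi>b q c' = QARF sq an s' (residual f b)"
proof -
  have bl: "b \<in> loc_acts D r" using b(1) by (simp add: allowed_def)
  note bD = loc_actsD[OF bl]
  have ad: "adom Db (Act b) = {q}" using adom_Db_r[OF bD(1)] bD(2) by simp
  have "tup1 q (\<pi>b q c) \<in> Domain (delta Ab (Act b))"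
  proof (rule Ab_enabled[OF bD(1)])
    show "tup1 q (\<pi>b q c) \<in> (\<Pi>\<^sub>E p\<in>adom Db (Act b). st Ab p)"
      unfolding ad tup1_PiE_iff by (rule \<pi>b_st[OF q_Db c(1)])
    have "base b (tup1 q (\<pi>b q c)) = tup1 r s" by (simp add: base_def bD(2) restrict_singleton c(2))
    then show "(base b (tup1 q (\<pi>b q c)), tup1 r s') \<in> delta A b" using b(2) by simp
  qed (use c(2) b(1) bD(2) q_ne_r in auto)
  then have "tup1 q c \<in> Domain (delta Cb (Act b))"
    using c(1) bD by (intro Cb_env) (simp_all add: env_Db ad tup1_PiE_iff restrict_singleton del: PiE_iff)
  then obtain y where y: "(tup1 q c, y) \<in> delta Cb (Act b)" by blast
  have yS: "y \<in> (\<Pi>\<^sub>E p\<in>{q}. st Cb p)" using Cb_st(2)[OF _ y] bD(1) ad by simp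
  then have yq: "y = tup1 q (y q)" "y q \<in> st Cb q"
    using PiE_restrict[of y "{q}"] restrict_singleton[of y q] by auto
  have "(tup1 q (\<pi>b q c), tup1 q (\<pi>b q (y q))) \<in> delta Ab (Act b)"
    using Cb_hom[OF _ y] bD(1) by (simp add: ad restrict_singleton)
  then have "(base b (tup1 q (\<pi>b q c)), base b (tup1 q (\<pi>b q (y q)))) \<in> delta A b"
    "qstep b (\<pi>b q c) (\<pi>b q (y q))"
    unfolding delta_Ab red_trans_Act_iff ad by auto
  then have "(tup1 r s, tup1 r (r_of (\<pi>b q (y q)))) \<in> delta A b"
    "\<pi>b q (y q) = QARF sq an (r_of (\<pi>b q (y q))) (residual f b)"
    using c(2) bD(2) by (auto simp: base_def restrict_singleton qstep_def)
  moreover from this(1) have "r_of (\<pi>b q (y q)) = s'" using loc_det[OF bl _ b(2)] by blast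
  ultimately show ?thesis using y yq by metis
qed

text \<open>Replays the record by repeated use of \<open>r_step\<close>. Only \<open>q\<close>
  moves, the projection on \<open>r\<close> is the record itself, and the announced action of
  \<open>q\<close> stays in place.\<close>

lemma pending_path:
  "reach t \<Longrightarrow> \<pi>b q (t q) = QARF sq an s0 f0 \<Longrightarrow> pending D A r s0 f0 v s f \<Longrightarrow>
    \<exists>\<rho> c. path Db Cb t \<rho> (t(q := c)) \<and> lpath Db Cb q (t q) (map Act (word_of v)) c \<and>
      \<pi>b q c = QARF sq an s f \<and> (\<forall>(x, a, x')\<in>set \<rho>. adom Db a = {q}) \<and>
      rproj D r r_of (aproj Db \<pi>b q \<rho>) = v \<and> rproj D q q_of (aproj Db \<pi>b q \<rho>) = []"
proof (induction v arbitrary: t s0 f0)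
  case Nil
  then show ?case by (intro exI[of _ "[]"] exI[of _ "t q"]) simp
next
  case (Cons x v)
  obtain s1 b s2 where x: "x = (s1, b, s2)" by (cases x)
  have b: "s1 = s0" "allowed D r f0 b" "(tup1 r s0, tup1 r s2) \<in> delta A b" "pending D A r s2 (residual f0 b) v s f"
    using Cons.prems(3) by (auto simp: x)
  obtain c where c: "(tup1 q (t q), tup1 q c) \<in> delta Cb (Act b)" "\<pi>b q c = QARF sq an s2 (residual f0 b)"
    using r_step[OF reach_q(1)[OF Cons.prems(1)] Cons.prems(2) b(2,3)] by blast
  have bl: "b \<in> loc_acts D r" using b(2) by (simp add: allowed_def)
  note bD = loc_actsD[OF bl]
  have ad: "adom Db (Act b) = {q}" using adom_Db_r[OF bD(1)] bD(2) by simp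
  have g: "gtrans Db Cb t (Act b) (t(q := c))" using c(1) bD(1) by (simp add: gtrans_def ad restrict_singleton)
  then have "path Db Cb t [(t, Act b, t(q := c))] (t(q := c))" by simp
  then have rch: "reach (t(q := c))" by (rule reach_path[OF Cons.prems(1)])
  obtain \<rho> d where \<rho>: "path Db Cb (t(q := c)) \<rho> (t(q := d))" "lpath Db Cb q c (map Act (word_of v)) d"
    "\<pi>b q d = QARF sq an s f" "\<forall>(x, a, x')\<in>set \<rho>. adom Db a = {q}"
    "rproj D r r_of (aproj Db \<pi>b q \<rho>) = v" "rproj D q q_of (aproj Db \<pi>b q \<rho>) = []"
    using Cons.IH[OF rch _ b(4)] c(2) unfolding fun_upd_same fun_upd_upd by blast
  let ?\<rho> = "(t, Act b, t(q := c)) # \<rho>"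
  have "path Db Cb t ?\<rho> (t(q := d))" unfolding path.simps using g \<rho>(1) by blast
  moreover have "lpath Db Cb q (t q) (map Act (word_of (x # v))) d"
    using \<rho>(2) c(1) bD(1) ad by (auto simp: x loc_acts_def)
  moreover have "rproj D r r_of (aproj Db \<pi>b q ?\<rho>) = x # v"
    using \<rho>(5) bD by (auto simp: ad x b(1) Cons.prems(2) c(2) acts_of_def)
  moreover have "rproj D q q_of (aproj Db \<pi>b q ?\<rho>) = []"
    using \<rho>(6) bD q_ne_r by (auto simp: ad acts_of_def)
  moreover have "\<forall>(x, a, x')\<in>set ?\<rho>. adom Db a = {q}" using \<rho>(4) ad by simp
  ultimately show ?case using \<rho>(3) by blast
qed


section \<open>The split controller, with a delayed \<open>r\<close>\<close>

definition \<nu> :: "'p \<Rightarrow> ('c, 'a, 's) split \<Rightarrow> 's" where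
  "\<nu> p x = (case x of Main c \<Rightarrow> main_of (\<pi>b p c) | Late s f v \<Rightarrow> s)"

text \<open>The bound on the record makes the set finite; \<open>pending_length\<close> shows that
  it is never exceeded.\<close>

definition Sr :: "('c, 'a, 's) split set" where
  "Sr = {Late s f v | s f v. s \<in> st A r \<and> f \<in> strategies D A r \<and>
     set v \<subseteq> st A r \<times> acts D \<times> st A r \<and> length v \<le> shortness}"

definition SC :: "'p \<Rightarrow> ('c, 'a, 's) split set" where
  "SC p = (if p = r then Sr else Main ` st Cb p)"

text \<open>A local move of \<open>r\<close> only extends the record. In any other move the tuple
  \<open>y\<close> is where the given controller acts: for \<open>q\<close> it lies after the replay
  of the record when \<open>r\<close> takes part. Then \<open>q\<close> announces again, and in a
  synchronisation \<open>r\<close> receives the new strategy with an empty record.\<close>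

definition joint_move :: "'a \<Rightarrow> ('p \<Rightarrow> ('c, 'a, 's) split) \<Rightarrow> ('p \<Rightarrow> ('c, 'a, 's) split) \<Rightarrow> bool" where
  "joint_move a x x' \<longleftrightarrow> (if adom D a = {r}
     then allowed D r (strt (x r)) a \<and>
       x' r = Late (cur (x' r)) (residual (strt (x r)) a) (pend (x r) @ [(cur (x r), a, cur (x' r))])
     else \<exists>y y'. (y, y') \<in> delta Cb (Act a) \<and>
       (\<forall>p\<in>adom D a - {q, r}. y p = un_main (x p) \<and> x' p = Main (y' p)) \<and>
       (q \<in> adom D a \<longrightarrow> x' q = Main (normalise (y' q))) \<and>
       (q \<in> adom D a \<longrightarrow>
          lpath Db Cb q (un_main (x q)) (if r \<in> adom D a then map Act (word_of (pend (x r))) else []) (y q)) \<and>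
       (r \<in> adom D a \<longrightarrow> x' r = Late (r_of (\<pi>b q (normalise (y' q)))) (str_of (\<pi>b q (normalise (y' q)))) []))"

definition \<delta>C :: "'a \<Rightarrow> (('p \<Rightarrow> ('c, 'a, 's) split) \<times> ('p \<Rightarrow> ('c, 'a, 's) split)) set" where
  "\<delta>C a = {(x, x'). x \<in> (\<Pi>\<^sub>E p\<in>adom D a. SC p) \<and> x' \<in> (\<Pi>\<^sub>E p\<in>adom D a. SC p) \<and>
     ((\<lambda>p\<in>adom D a. \<nu> p (x p)), (\<lambda>p\<in>adom D a. \<nu> p (x' p))) \<in> delta A a \<and> joint_move a x x'}"

definition q0 :: 'c where "q0 = normalise (init_st Cb q)"

definition C :: "('p, 'a, ('c, 'a, 's) split) zautomaton" where
  "C = \<lparr>st = SC, init_st = (\<lambda>p\<in>procs D. if p = r then Late (r_of (\<pi>b q q0)) (str_of (\<pi>b q q0)) []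
      else if p = q then Main q0 else Main (init_st Cb p)), delta = \<delta>C\<rparr>"

lemma C_simps [simp]: "st C = SC" "delta C = \<delta>C"
  by (simp_all add: C_def)

lemma Sr_Late: "x \<in> Sr \<Longrightarrow> x = Late (cur x) (strt x) (pend x)"
  by (auto simp: Sr_def)

lemma SC_main: "p \<noteq> r \<Longrightarrow> x \<in> SC p \<Longrightarrow> x = Main (un_main x) \<and> un_main x \<in> st Cb p"
  by (auto simp: SC_def)

lemma SC_r: "x \<in> SC r \<longleftrightarrow> x \<in> Sr"
  by (simp add: SC_def)

lemma \<nu>_Late: "x \<in> Sr \<Longrightarrow> \<nu> p x = cur x"
  by (auto simp: Sr_def \<nu>_def)

lemma \<nu>_Main: "\<nu> p (Main c) = main_of (\<pi>b p c)"
  by (simp add: \<nu>_def)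

lemma reach_init: "reach (init_st Cb)"
  unfolding reach_def by (intro exI[of _ "[]"]) simp

lemma qstate_Late:
  assumes "reach t" "\<pi>b q (t q) = QARF sq an s f"
  shows "Late s f [] \<in> Sr"
proof -
  have "QARF sq an s f \<in> red_qstates D A r q" using reach_q(2)[OF assms(1)] assms(2) by simp
  then show ?thesis by (auto simp: Sr_def strategies_def)
qed

lemma normalise_Late:
  assumes "reach t"
  shows "Late (r_of (\<pi>b q (normalise (t q)))) (str_of (\<pi>b q (normalise (t q)))) [] \<in> Sr" "normalise (t q) \<in> st Cb q"
    "reach (t(q := normalise (t q)))"
proof -
  obtain \<rho> a f where n: "path Db Cb t \<rho> (t(q := normalise (t q)))"
    "\<pi>b q (normalise (t q)) = QARF (main_of (\<pi>b q (t q))) a (r_of (\<pi>b q (t q))) f"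
    using normalise_path[OF assms] by blast
  show rch: "reach (t(q := normalise (t q)))" by (rule reach_path[OF assms n(1)])
  from reach_q(1)[OF rch] show "normalise (t q) \<in> st Cb q" by simp
  show "Late (r_of (\<pi>b q (normalise (t q)))) (str_of (\<pi>b q (normalise (t q)))) [] \<in> Sr"
    using qstate_Late[OF rch] n(2) by simp
qed

lemma PiE_adom_Db:
  assumes "a \<in> acts D" "adom D a \<noteq> {r}"
  shows "adom Db (Act a) = adom D a - {r}" "r \<in> adom D a \<Longrightarrow> q \<in> adom D a"
  using adom_r[OF assms(1)] assms(2) q_ne_r by (auto simp: in_adom_Db)

lemma C: "zielonka D C"
  unfolding zielonka_def
proof (intro conjI ballI)
  fix p assume p: "p \<in> procs D"
  have "finite {v. set v \<subseteq> st A r \<times> acts D \<times> st A r \<and> length v \<le> shortness}"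
    using finite_st[OF r_procs] finite_acts by (intro finite_lists_length_le) simp
  moreover have "Sr \<subseteq> (\<lambda>(s, f, v). Late s f v) ` (st A r \<times> strategies D A r \<times>
      {v. set v \<subseteq> st A r \<times> acts D \<times> st A r \<and> length v \<le> shortness})"
    by (auto simp: Sr_def image_iff)
  ultimately have "finite Sr"
    using finite_st[OF r_procs] finite_strategies by (auto intro: finite_subset)
  moreover have "p \<noteq> r \<Longrightarrow> finite (st Cb p)" using Cb p by (simp add: zielonka_def)
  ultimately show "finite (st C p)" by (simp add: SC_def)
next
  have i: "init_st Cb p \<in> st Cb p" if "p \<in> procs D" "p \<noteq> r" for p
    using PiE_mem[OF reach_st[OF reach_init]] that by simp
  show "init_st C \<in> (\<Pi>\<^sub>E p\<in>procs D. st C p)"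
    using normalise_Late[OF reach_init] i by (auto simp: C_def SC_def q0_def)
next
  fix a assume a: "a \<in> acts D"
  show "delta C a \<subseteq> (\<Pi>\<^sub>E p\<in>adom D a. st C p) \<times> (\<Pi>\<^sub>E p\<in>adom D a. st C p)"
    by (auto simp: \<delta>C_def simp del: PiE_iff)
  show "single_valued (delta C a)"
  proof (rule single_valuedI)
    fix x x1 x2 assume 1: "(x, x1) \<in> delta C a" and 2: "(x, x2) \<in> delta C a"
    have xs: "x1 \<in> (\<Pi>\<^sub>E p\<in>adom D a. SC p)" "x2 \<in> (\<Pi>\<^sub>E p\<in>adom D a. SC p)" and x: "x \<in> (\<Pi>\<^sub>E p\<in>adom D a. SC p)"
      and eq: "(\<lambda>p\<in>adom D a. \<nu> p (x1 p)) = (\<lambda>p\<in>adom D a. \<nu> p (x2 p))"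
      and rl: "joint_move a x x1" "joint_move a x x2"
      using 1 2 delta_det[OF a] unfolding \<delta>C_def C_simps by blast+
    show "x1 = x2"
    proof (cases "adom D a = {r}")
      case True
      have "x1 r \<in> Sr" "x2 r \<in> Sr" using PiE_mem[OF xs(1)] PiE_mem[OF xs(2)] True SC_r by blast+
      then have "cur (x1 r) = cur (x2 r)" using fun_cong[OF eq, of r] True by (simp add: \<nu>_Late)
      then have "x1 r = x2 r" using rl True unfolding joint_move_def by auto
      then show ?thesis using PiE_ext[OF xs] True by simp
    next
      case False
      note X = PiE_adom_Db[OF a False]
      obtain y1 z1 where 1: "(y1, z1) \<in> delta Cb (Act a)"
        "\<forall>p\<in>adom D a - {q, r}. y1 p = un_main (x p) \<and> x1 p = Main (z1 p)"
        "q \<in> adom D a \<longrightarrow> x1 q = Main (normalise (z1 q))"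
        "q \<in> adom D a \<longrightarrow> lpath Db Cb q (un_main (x q)) (if r \<in> adom D a then map Act (word_of (pend (x r))) else []) (y1 q)"
        "r \<in> adom D a \<longrightarrow> x1 r = Late (r_of (\<pi>b q (normalise (z1 q)))) (str_of (\<pi>b q (normalise (z1 q)))) []"
        using rl(1) False unfolding joint_move_def by auto
      obtain y2 z2 where 2: "(y2, z2) \<in> delta Cb (Act a)"
        "\<forall>p\<in>adom D a - {q, r}. y2 p = un_main (x p) \<and> x2 p = Main (z2 p)"
        "q \<in> adom D a \<longrightarrow> x2 q = Main (normalise (z2 q))"
        "q \<in> adom D a \<longrightarrow> lpath Db Cb q (un_main (x q)) (if r \<in> adom D a then map Act (word_of (pend (x r))) else []) (y2 q)"
        "r \<in> adom D a \<longrightarrow> x2 r = Late (r_of (\<pi>b q (normalise (z2 q)))) (str_of (\<pi>b q (normalise (z2 q)))) []"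
        using rl(2) False unfolding joint_move_def by auto
      have aDb: "Act a \<in> acts Db" using a by simp
      \<comment> \<open>The replay of a record is deterministic by \<open>lpath_det\<close>; the
        other components of the source are given directly.\<close>
      have "y1 = y2"
      proof (rule PiE_ext[OF Cb_st(1)[OF aDb 1(1)] Cb_st(1)[OF aDb 2(1)]])
        fix p assume "p \<in> adom Db (Act a)"
        then have "p \<in> adom D a" "p \<noteq> r" using X by auto
        then show "y1 p = y2 p" using 1(2,4) 2(2,4) lpath_det[OF Cb] by (cases "p = q") auto
      qed
      then have z: "z1 = z2" using Cb_det[OF aDb 1(1)] 2(1) by simp
      show ?thesis
      proof (rule PiE_ext[OF xs])
        fix p assume "p \<in> adom D a"
        then show "x1 p = x2 p" using 1(2-5) 2(2-5) z by (cases "p = q"; cases "p = r") auto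
      qed
    qed
  qed
qed

section \<open>The simulation invariant and its preservation\<close>

definition tr :: "('p \<Rightarrow> ('c, 'a, 's) split) \<Rightarrow> 'p \<Rightarrow> 'c" where
  "tr s = (\<lambda>p\<in>procs D - {r}. un_main (s p))"

text \<open>In the simulated \<open>q\<close>-state, \<open>s0\<close> and \<open>f0\<close> are the
  state and strategy of \<open>r\<close> as of the last synchronisation; the record leads from them
  to the actual state and residual strategy of \<open>r\<close>.\<close>

definition sim_inv :: "('p \<Rightarrow> ('c, 'a, 's) split) \<Rightarrow> bool" where
  "sim_inv s \<longleftrightarrow> s \<in> (\<Pi>\<^sub>E p\<in>procs D. SC p) \<and> reach (tr s) \<and>
     (\<exists>sq an s0 f0. \<pi>b q (tr s q) = QARF sq an s0 f0 \<and>
        pending D A r s0 f0 (pend (s r)) (cur (s r)) (strt (s r)))"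

lemma sim_invD:
  assumes "sim_inv s"
  shows "s r = Late (cur (s r)) (strt (s r)) (pend (s r))" "s r \<in> Sr"
    "p \<in> procs D \<Longrightarrow> p \<noteq> r \<Longrightarrow> s p = Main (tr s p)"
    "p \<in> procs D \<Longrightarrow> p \<noteq> r \<Longrightarrow> \<nu> p (s p) = main_of (\<pi>b p (tr s p))" "\<nu> r (s r) = cur (s r)"
    "reach (tr s)"
proof -
  have s: "s \<in> (\<Pi>\<^sub>E p\<in>procs D. SC p)" using assms by (simp add: sim_inv_def)
  show sr: "s r \<in> Sr" using PiE_mem[OF s r_procs] SC_r by simp
  then show "s r = Late (cur (s r)) (strt (s r)) (pend (s r))" "\<nu> r (s r) = cur (s r)"
    using Sr_Late \<nu>_Late by auto
  show m: "s p = Main (tr s p)" if "p \<in> procs D" "p \<noteq> r" for p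
    using SC_main[OF that(2) PiE_mem[OF s that(1)]] that by (simp add: tr_def)
  show "p \<in> procs D \<Longrightarrow> p \<noteq> r \<Longrightarrow> \<nu> p (s p) = main_of (\<pi>b p (tr s p))"
    using m \<nu>_Main by metis
  show "reach (tr s)" using assms by (simp add: sim_inv_def)
qed

lemma tr_q: "tr s q = un_main (s q)"
  using q_Db by (simp add: tr_def)

lemma local_q_proj: "(\<forall>(x, a, x')\<in>set \<rho>. adom Db a = {q}) \<Longrightarrow> p \<noteq> q \<Longrightarrow> aproj Db \<pi> p \<rho> = []"
  by (induction \<rho>) auto

text \<open>The part of a simulated step that hands over the recorded moves of \<open>r\<close>.\<close>

lemma catch_up:
  assumes i: "sim_inv s" and a: "a \<in> acts D" "adom D a \<noteq> {r}"
  obtains t \<rho> sq an s0 f0 where "path Db Cb (tr s) \<rho> t" "reach t" "\<And>p. p \<noteq> q \<Longrightarrow> t p = tr s p"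
    "r \<notin> adom D a \<Longrightarrow> t = tr s \<and> \<rho> = []"
    "lpath Db Cb q (tr s q) (if r \<in> adom D a then map Act (word_of (pend (s r))) else []) (t q)"
    "\<pi>b q (tr s q) = QARF sq an s0 f0" "pending D A r s0 f0 (pend (s r)) (cur (s r)) (strt (s r))"
    "\<pi>b q (t q) = (if r \<in> adom D a then QARF sq an (cur (s r)) (strt (s r)) else QARF sq an s0 f0)"
    "rproj D r r_of (aproj Db \<pi>b q \<rho>) = (if r \<in> adom D a then pend (s r) else [])"
    "rproj D q q_of (aproj Db \<pi>b q \<rho>) = []" "\<And>p. p \<noteq> q \<Longrightarrow> aproj Db \<pi>b p \<rho> = []"
    "restrict (absA t) (adom D a) = (\<lambda>p\<in>adom D a. \<nu> p (s p))"
proof -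
  from i obtain sq an s0 f0 where Q: "\<pi>b q (tr s q) = QARF sq an s0 f0"
    "pending D A r s0 f0 (pend (s r)) (cur (s r)) (strt (s r))" by (auto simp: sim_inv_def)
  note rch = sim_invD(6)[OF i]
  have abs: "restrict (absA t) (adom D a) = (\<lambda>p\<in>adom D a. \<nu> p (s p))"
    if "\<And>p. p \<noteq> q \<Longrightarrow> t p = tr s p" "main_of (\<pi>b q (t q)) = sq" "r \<in> adom D a \<Longrightarrow> r_of (\<pi>b q (t q)) = cur (s r)"
    for t
  proof (rule restrict_ext)
    fix p assume p: "p \<in> adom D a"
    then have "p \<in> procs D" using a adom_procs by blast
    then show "absA t p = \<nu> p (s p)"
      using that p sim_invD(4)[OF i, of p] sim_invD(5)[OF i] Q(1) by (cases "p = q") (auto simp: absA_def q_ne_r)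
  qed
  show ?thesis
  proof (cases "r \<in> adom D a")
    case True
    obtain \<rho> c where \<rho>: "path Db Cb (tr s) \<rho> ((tr s)(q := c))"
      "lpath Db Cb q (tr s q) (map Act (word_of (pend (s r)))) c"
      "\<pi>b q c = QARF sq an (cur (s r)) (strt (s r))" "\<forall>(x, a, x')\<in>set \<rho>. adom Db a = {q}"
      "rproj D r r_of (aproj Db \<pi>b q \<rho>) = pend (s r)" "rproj D q q_of (aproj Db \<pi>b q \<rho>) = []"
      using pending_path[OF rch Q] by blast
    show ?thesis
    proof (rule that[OF \<rho>(1) reach_path[OF rch \<rho>(1)] _ _ _ Q])
      show "restrict (absA ((tr s)(q := c))) (adom D a) = (\<lambda>p\<in>adom D a. \<nu> p (s p))"
        by (rule abs) (simp_all add: \<rho>(3))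
    qed (use \<rho> True local_q_proj in auto)
  next
    case False
    show ?thesis
    proof (rule that[of "[]" "tr s", OF _ rch _ _ _ Q])
      show "restrict (absA (tr s)) (adom D a) = (\<lambda>p\<in>adom D a. \<nu> p (s p))"
        by (rule abs) (use False Q(1) in auto)
    qed (use False Q(1) in auto)
  qed
qed

lemma \<delta>C_gtrans:
  assumes "gtrans D C s a s'"
  shows "a \<in> acts D" "joint_move a (restrict s (adom D a)) (restrict s' (adom D a))"
    "((\<lambda>p\<in>adom D a. \<nu> p (s p)), (\<lambda>p\<in>adom D a. \<nu> p (s' p))) \<in> delta A a"
proof -
  show "a \<in> acts D" using assms by (simp add: gtrans_def)
  have "(restrict s (adom D a), restrict s' (adom D a)) \<in> \<delta>C a" using assms by (simp add: gtrans_def)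
  then show "joint_move a (restrict s (adom D a)) (restrict s' (adom D a))"
    "((\<lambda>p\<in>adom D a. \<nu> p (s p)), (\<lambda>p\<in>adom D a. \<nu> p (s' p))) \<in> delta A a"
    unfolding \<delta>C_def by (auto cong: restrict_cong)
qed

lemma step_sim_r:
  assumes i: "sim_inv s" and g: "gtrans D C s a s'" and ad: "adom D a = {r}"
  shows "sim_inv s'" "tr s' = tr s" "pend (s' r) = pend (s r) @ aproj D \<nu> r [(s, a, s')]"
proof -
  note st = \<delta>C_gtrans[OF g]
  have s': "s' \<in> (\<Pi>\<^sub>E p\<in>procs D. SC p)"
    using path_tuple[OF D C, of s "[(s, a, s')]" s'] g i by (simp add: sim_inv_def)
  have out: "s' p = s p" if "p \<noteq> r" for p using gtrans_outside[OF g, of p] ad that by simp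
  then show tr: "tr s' = tr s" by (auto simp: tr_def)
  have sr': "s' r \<in> Sr" using PiE_mem[OF s' r_procs] SC_r by simp
  have rl: "allowed D r (strt (s r)) a"
    "s' r = Late (cur (s' r)) (residual (strt (s r)) a) (pend (s r) @ [(cur (s r), a, cur (s' r))])"
    using st(2) ad by (auto simp: joint_move_def)
  have d: "(tup1 r (cur (s r)), tup1 r (cur (s' r))) \<in> delta A a"
    using st(3) \<nu>_Late[OF sr'] sim_invD(5)[OF i] by (simp add: ad restrict_singleton)
  have p': "pend (s' r) = pend (s r) @ [(cur (s r), a, cur (s' r))]" "strt (s' r) = residual (strt (s r)) a"
    using arg_cong[OF rl(2), of pend] arg_cong[OF rl(2), of strt] by simp_all
  then show "pend (s' r) = pend (s r) @ aproj D \<nu> r [(s, a, s')]"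
    using \<nu>_Late[OF sr'] sim_invD(5)[OF i] ad by simp
  show "sim_inv s'"
    using i s' tr p' pending_snoc[OF _ rl(1) d] unfolding sim_inv_def by metis
qed

text \<open>The simulating path consists of the replay of the record if \<open>r\<close> takes part,
  the action itself, and new announcements if \<open>q\<close> takes part. The equation for
  \<open>r\<close> says that simulated moves followed by the remaining record equal the old record
  followed by the actual moves.\<close>

lemma step_sim:
  assumes i: "sim_inv s" and g: "gtrans D C s a s'" and ad: "adom D a \<noteq> {r}"
  shows "sim_inv s' \<and> (r \<in> adom D a \<longrightarrow> pend (s' r) = []) \<and> (\<exists>\<rho>. path Db Cb (tr s) \<rho> (tr s') \<and>
    (\<forall>p\<in>procs D - {q, r}. aproj Db \<pi>b p \<rho> = map lift_step (aproj D \<nu> p [(s, a, s')])) \<and>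
    rproj D q q_of (aproj Db \<pi>b q \<rho>) = aproj D \<nu> q [(s, a, s')] \<and>
    rproj D r r_of (aproj Db \<pi>b q \<rho>) @ pend (s' r) = pend (s r) @ aproj D \<nu> r [(s, a, s')] \<and>
    (q \<notin> adom D a \<longrightarrow> \<not> touches Db \<rho> {q}))"
proof -
  note st = \<delta>C_gtrans[OF g]
  note X = PiE_adom_Db[OF st(1) ad]
  have aDb: "Act a \<in> acts Db" using st(1) by simp
  have s': "s' \<in> (\<Pi>\<^sub>E p\<in>procs D. SC p)"
    using path_tuple[OF D C, of s "[(s, a, s')]" s'] g i by (simp add: sim_inv_def)
  obtain t1 \<rho>1 sq an s0 f0 where c: "path Db Cb (tr s) \<rho>1 t1" "reach t1" "\<And>p. p \<noteq> q \<Longrightarrow> t1 p = tr s p"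
    "r \<notin> adom D a \<Longrightarrow> t1 = tr s \<and> \<rho>1 = []"
    "lpath Db Cb q (tr s q) (if r \<in> adom D a then map Act (word_of (pend (s r))) else []) (t1 q)"
    "\<pi>b q (tr s q) = QARF sq an s0 f0" "pending D A r s0 f0 (pend (s r)) (cur (s r)) (strt (s r))"
    "\<pi>b q (t1 q) = (if r \<in> adom D a then QARF sq an (cur (s r)) (strt (s r)) else QARF sq an s0 f0)"
    "rproj D r r_of (aproj Db \<pi>b q \<rho>1) = (if r \<in> adom D a then pend (s r) else [])"
    "rproj D q q_of (aproj Db \<pi>b q \<rho>1) = []" "\<And>p. p \<noteq> q \<Longrightarrow> aproj Db \<pi>b p \<rho>1 = []"
    "restrict (absA t1) (adom D a) = (\<lambda>p\<in>adom D a. \<nu> p (s p))"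
    by (rule catch_up[OF i st(1) ad], rule that)
  obtain y y' where y: "(y, y') \<in> delta Cb (Act a)"
    "\<And>p. p \<in> adom D a - {q, r} \<Longrightarrow> y p = un_main (s p) \<and> s' p = Main (y' p)"
    "q \<in> adom D a \<Longrightarrow> s' q = Main (normalise (y' q))"
    "q \<in> adom D a \<Longrightarrow> lpath Db Cb q (un_main (s q)) (if r \<in> adom D a then map Act (word_of (pend (s r))) else []) (y q)"
    "r \<in> adom D a \<Longrightarrow> s' r = Late (r_of (\<pi>b q (normalise (y' q)))) (str_of (\<pi>b q (normalise (y' q)))) []"
    using st(2) ad unfolding joint_move_def by (auto split: if_splits)
  have yS: "y \<in> (\<Pi>\<^sub>E p\<in>adom Db (Act a). st Cb p)" "y' \<in> (\<Pi>\<^sub>E p\<in>adom Db (Act a). st Cb p)"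
    by (rule Cb_st[OF aDb y(1)])+
  \<comment> \<open>The witness hidden in \<open>joint_move\<close> is the state after the replay:
    the replay determines its \<open>q\<close>-component, and the others did not change.\<close>
  have yt: "y = restrict t1 (adom Db (Act a))"
  proof
    fix p
    show "y p = restrict t1 (adom Db (Act a)) p"
    proof (cases "p \<in> adom Db (Act a)")
      case True
      then have p: "p \<in> adom D a" "p \<noteq> r" using X by auto
      show ?thesis
      proof (cases "p = q")
        case pq: True
        have "y q = t1 q" using lpath_det[OF Cb y(4)] c(5) p pq by (simp add: tr_q)
        then show ?thesis using True pq by simp
      next
        case False
        then show ?thesis using True p y(2)[of p] c(3) adom_procs[OF st(1) p(1)] by (simp add: tr_def)
      qed
    qed (use PiE_arb[OF yS(1)] in simp)
  qed
  define t2 where "t2 = override_on t1 y' (adom Db (Act a))"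
  have "restrict t2 (adom Db (Act a)) = y'" using yS(2) unfolding t2_def by (auto simp: PiE_def extensional_def)
  then have g2: "gtrans Db Cb t1 (Act a) t2" using y(1) yt aDb by (simp add: gtrans_def t2_def)
  have gg: "path Db Cb t1 [(t1, Act a, t2)] t2" using g2 by simp
  have rch2: "reach t2" by (rule reach_path[OF c(2) gg])
  have t2y: "t2 p = y' p" if "p \<in> adom D a" "p \<noteq> r" for p using that X by (simp add: t2_def)
  have t2o: "t2 p = t1 p" if "p \<notin> adom D a" for p using that X by (simp add: t2_def)
  have out: "s' p = s p" if "p \<notin> adom D a" for p using gtrans_outside[OF g that] .
  have trs': "tr s' = (if q \<in> adom D a then t2(q := normalise (t2 q)) else t2)"
  proof
    fix p
    consider "p = q" "q \<in> adom D a" | "p \<noteq> q" "p \<in> adom D a" "p \<noteq> r" | "p \<notin> adom D a" "p \<in> procs D - {r}"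
      | "p \<notin> procs D - {r}" using adom_procs[OF st(1)] by blast
    then show "tr s' p = (if q \<in> adom D a then t2(q := normalise (t2 q)) else t2) p"
    proof cases
      case 1
      then show ?thesis using y(3) t2y[of q] q_ne_r by (simp add: tr_q)
    next
      case 2
      then show ?thesis using y(2)[of p] t2y[of p] adom_procs[OF st(1)] by (simp add: tr_def)
    next
      case 3
      have "t1 p = tr s p"
      proof (cases "p = q")
        case True
        then have "r \<notin> adom D a" using 3(1) X(2) by blast
        then show ?thesis using c(4) by simp
      qed (use c(3) in simp)
      then have "t2 p = tr s' p" using 3 t2o[of p] out[of p] by (simp add: tr_def)
      then show ?thesis using 3(1) by auto
    next
      case 4
      then have nq: "p \<noteq> q" "p \<notin> adom Db (Act a)"
        using q_procs q_ne_r X adom_procs[OF st(1)] by auto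
      then show ?thesis using 4 c(3)[of p] by (auto simp: tr_def t2_def)
    qed
  qed
  have absd: "\<nu> p (s p) = absA t1 p" if "p \<in> adom D a" for p using fun_cong[OF c(12), of p] that by simp
  note A2 = step_Act[OF g2]
  show ?thesis
  proof (cases "q \<in> adom D a")
    case qa: True
    have qDb: "q \<in> adom Db (Act a)" using qa X q_ne_r by simp
    obtain \<rho>3 an' f' where n: "path Db Cb t2 \<rho>3 (t2(q := normalise (t2 q)))" "silent \<rho>3"
      "\<pi>b q (normalise (t2 q)) = QARF (main_of (\<pi>b q (t2 q))) an' (r_of (\<pi>b q (t2 q))) f'"
      "\<And>sq sr g. \<pi>b q (t2 q) = QRF sq sr g \<Longrightarrow> f' = g"
      using normalise_path[OF rch2] by blast
    let ?\<rho> = "\<rho>1 @ [(t1, Act a, t2)] @ \<rho>3"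
    have path: "path Db Cb (tr s) ?\<rho> (tr s')"
      using c(1) gg n(1) trs' qa unfolding path_append by auto
    have qs: "qstep a (\<pi>b q (t1 q)) (\<pi>b q (t2 q))" by (rule A2(3)[OF qDb])
    have trq: "tr s' q = normalise (t2 q)" using trs' qa by simp
    have rs': "reach (tr s')" using normalise_Late(3)[OF rch2] trs' qa by simp
    have pend': "\<exists>s1 f1. (\<exists>sq an. \<pi>b q (tr s' q) = QARF sq an s1 f1) \<and>
        pending D A r s1 f1 (pend (s' r)) (cur (s' r)) (strt (s' r))"
    proof (cases "r \<in> adom D a")
      case True
      then show ?thesis using y(5) n(3) trq t2y[OF qa q_ne_r(1)] by simp
    next
      case False
      then have "\<pi>b q (t2 q) = QRF (main_of (\<pi>b q (t2 q))) s0 f0"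
        using qs ad c(8) by (auto simp: qstep_def)
      \<comment> \<open>Without \<open>r\<close> neither its simulated state nor the strategy
        changes, so the old record still starts at the right place.\<close>
      then have "f' = f0" "r_of (\<pi>b q (t2 q)) = s0" using n(4) by (metis, metis rstate.sel)
      then show ?thesis using n(3) trq c(7) out[OF False] by simp
    qed
    have sim_inv': "sim_inv s'" unfolding sim_inv_def using s' rs' pend' by blast
    have newp: "r \<in> adom D a \<longrightarrow> pend (s' r) = []" using y(5) by simp
    have mq: "\<nu> p (s' p) = main_of (\<pi>b p (t2 p))" if "p \<in> adom D a" "p \<noteq> r" for p
      using sim_invD(4)[OF sim_inv', of p] adom_procs[OF st(1)] that trs' qa n(3) by auto
    have pr1: "aproj Db \<pi>b p ?\<rho> = map lift_step (aproj D \<nu> p [(s, a, s')])" if p: "p \<in> procs D - {q, r}" for p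
    proof (cases "p \<in> adom D a")
      case True
      have "\<pi>b p (z p) = Other (main_of (\<pi>b p (z p)))" if "reach z" for z
        using \<pi>b_st[of p "z p"] PiE_mem[OF reach_st[OF that], of p] p by auto
      then have "\<pi>b p (t1 p) = Other (\<nu> p (s p))" "\<pi>b p (t2 p) = Other (\<nu> p (s' p))"
        using c(2) rch2 absd[OF True] mq[OF True] p by (auto simp: absA_def)
      then show ?thesis using True p X c(11)[of p] silent_proj(1)[OF n(2), of p \<pi>b] by (simp add: lift_step_def)
    next
      case False
      then show ?thesis using p X c(11)[of p] silent_proj(1)[OF n(2), of p \<pi>b] by simp
    qed
    have qst: "\<pi>b q (t1 q) \<in> red_qstates D A r q" "\<pi>b q (t2 q) \<in> red_qstates D A r q"
      using reach_q(2) c(2) rch2 by auto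
    have pr2: "rproj D q q_of (aproj Db \<pi>b q ?\<rho>) = aproj D \<nu> q [(s, a, s')]"
      using qa qDb st(1) c(10) silent_proj(2)[OF n(2), of q q_of \<pi>b] absd[OF qa] mq[OF qa q_ne_r(1)] qst q_ne_r
      by (simp add: acts_of_def absA_def)
    have pr3: "rproj D r r_of (aproj Db \<pi>b q ?\<rho>) @ pend (s' r) = pend (s r) @ aproj D \<nu> r [(s, a, s')]"
    proof (cases "r \<in> adom D a")
      case True
      have "\<nu> r (s' r) = r_of (\<pi>b q (t2 q))" using y(5)[OF True] n(3) t2y[OF qa q_ne_r(1)] by (simp add: \<nu>_def)
      moreover have "\<nu> r (s r) = r_of (\<pi>b q (t1 q))" using absd[OF True] by (simp add: absA_def)
      ultimately show ?thesis
        using True qDb st(1) c(9) silent_proj(2)[OF n(2), of r r_of \<pi>b] newp by (simp add: acts_of_def)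
    next
      case False
      then show ?thesis
        using qDb st(1) c(9) silent_proj(2)[OF n(2), of r r_of \<pi>b] out[OF False] by (simp add: acts_of_def)
    qed
    show ?thesis using sim_inv' newp path pr1 pr2 pr3 qa by blast
  next
    case qa: False
    then have ra: "r \<notin> adom D a" using X(2) by blast
    have c4: "t1 = tr s" using c(4)[OF ra] by simp
    have nDb: "q \<notin> adom Db (Act a)" using qa X by simp
    have tr2: "tr s' = t2" using trs' qa by simp
    have path: "path Db Cb (tr s) [(t1, Act a, t2)] (tr s')" using gg c4 tr2 by simp
    have sim_inv': "sim_inv s'"
      unfolding sim_inv_def using s' rch2 tr2 c(6,7) out[OF ra] t2o[OF qa] c4 by auto
    have "aproj Db \<pi>b p [(t1, Act a, t2)] = map lift_step (aproj D \<nu> p [(s, a, s')])"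
      if p: "p \<in> procs D - {q, r}" for p
    proof (cases "p \<in> adom D a")
      case True
      have "\<pi>b p (z p) = Other (main_of (\<pi>b p (z p)))" if "reach z" for z
        using \<pi>b_st[of p "z p"] PiE_mem[OF reach_st[OF that], of p] p by auto
      then have "\<pi>b p (t1 p) = Other (\<nu> p (s p))" "\<pi>b p (t2 p) = Other (\<nu> p (s' p))"
        using c(2) rch2 absd[OF True] sim_invD(4)[OF sim_inv', of p] tr2 p by (auto simp: absA_def)
      then show ?thesis using True p X by (simp add: lift_step_def)
    next
      case False
      then show ?thesis using X by simp
    qed
    moreover have "rproj D q q_of (aproj Db \<pi>b q [(t1, Act a, t2)]) = aproj D \<nu> q [(s, a, s')]"
      using nDb qa by simp
    moreover have "rproj D r r_of (aproj Db \<pi>b q [(t1, Act a, t2)]) @ pend (s' r) = pend (s r) @ aproj D \<nu> r [(s, a, s')]"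
      using nDb ra out[OF ra] by simp
    moreover have "\<not> touches Db [(t1, Act a, t2)] {q}" using nDb by simp
    ultimately show ?thesis using sim_inv' path ra by blast
  qed
qed

text \<open>The alternatives in \<open>h\<close> list why the given controller must admit
  \<open>a\<close>: it is uncontrollable, allowed by the current strategy, announced by
  \<open>q\<close>, or already enabled there without \<open>q\<close> and \<open>r\<close>.\<close>

lemma C_enabled:
  assumes i: "sim_inv s" and a: "a \<in> acts D" and d: "((\<lambda>p\<in>adom D a. \<nu> p (s p)), z) \<in> delta A a"
    and h: "a \<in> env D \<or> (adom D a = {r} \<and> allowed D r (strt (s r)) a) \<or>
      (q \<in> adom D a \<and> (\<exists>sq sr f. \<pi>b q (tr s q) = QARF sq a sr f)) \<or>
      (q \<notin> adom D a \<and> r \<notin> adom D a \<and> enabled Db Cb (tr s) (Act a))"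
  shows "enabled D C s a"
proof -
  have zS: "z \<in> (\<Pi>\<^sub>E p\<in>adom D a. st A p)" by (rule delta_st(2)[OF a d])
  have sPi: "s \<in> (\<Pi>\<^sub>E p\<in>procs D. SC p)" using i by (simp add: sim_inv_def)
  then have xs: "restrict s (adom D a) \<in> (\<Pi>\<^sub>E p\<in>adom D a. SC p)" using adom_procs[OF a] by auto
  have "\<exists>x'. (restrict s (adom D a), x') \<in> \<delta>C a"
  proof (cases "adom D a = {r}")
    case True
    have al: "allowed D r (strt (s r)) a" using h True q_ne_r a by (auto simp: allowed_def loc_acts_def)
    have zr: "z = tup1 r (z r)" using PiE_restrict[OF zS] by (simp add: True restrict_singleton)
    have dl: "(tup1 r (cur (s r)), tup1 r (z r)) \<in> delta A a"
      using d zr sim_invD(5)[OF i] by (simp add: True restrict_singleton)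
    from i obtain sq an s0 f0 where Q: "\<pi>b q (tr s q) = QARF sq an s0 f0"
      "pending D A r s0 f0 (pend (s r)) (cur (s r)) (strt (s r))" by (auto simp: sim_inv_def)
    let ?n = "Late (z r) (residual (strt (s r)) a) (pend (s r) @ [(cur (s r), a, z r)])"
    note P = pending_snoc[OF Q(2) al dl]
    have s0: "s0 \<in> st A r" "local_strategy D A r s0 f0"
      using reach_q(2)[OF sim_invD(6)[OF i]] Q(1) by auto
    have "?n \<in> Sr"
      using pending_st[OF P s0] pending_length[OF P s0(1)] unfolding Sr_def strategies_def by blast
    then have "(restrict s (adom D a), tup1 r ?n) \<in> \<delta>C a"
      using xs al dl sim_invD(5)[OF i]
      by (simp add: \<delta>C_def True tup1_PiE_iff SC_r restrict_singleton joint_move_def \<nu>_def del: PiE_iff)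
    then show ?thesis by blast
  next
    case False
    note X = PiE_adom_Db[OF a False]
    have aDb: "Act a \<in> acts Db" using a by simp
    obtain t1 \<rho>1 sq an s0 f0 where c: "path Db Cb (tr s) \<rho>1 t1" "reach t1" "\<And>p. p \<noteq> q \<Longrightarrow> t1 p = tr s p"
      "r \<notin> adom D a \<Longrightarrow> t1 = tr s \<and> \<rho>1 = []"
      "lpath Db Cb q (tr s q) (if r \<in> adom D a then map Act (word_of (pend (s r))) else []) (t1 q)"
      "\<pi>b q (tr s q) = QARF sq an s0 f0" "pending D A r s0 f0 (pend (s r)) (cur (s r)) (strt (s r))"
      "\<pi>b q (t1 q) = (if r \<in> adom D a then QARF sq an (cur (s r)) (strt (s r)) else QARF sq an s0 f0)"
      "rproj D r r_of (aproj Db \<pi>b q \<rho>1) = (if r \<in> adom D a then pend (s r) else [])"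
      "rproj D q q_of (aproj Db \<pi>b q \<rho>1) = []" "\<And>p. p \<noteq> q \<Longrightarrow> aproj Db \<pi>b p \<rho>1 = []"
      "restrict (absA t1) (adom D a) = (\<lambda>p\<in>adom D a. \<nu> p (s p))"
      by (rule catch_up[OF i a False], rule that)
    let ?X = "adom Db (Act a)"
    have sub: "?X \<subseteq> procs Db" using Db aDb unfolding dist_alphabet_def by blast
    have tX: "restrict t1 ?X \<in> (\<Pi>\<^sub>E p\<in>?X. st Cb p)" using reach_st[OF c(2)] sub by auto
    have "enabled Db Cb t1 (Act a)"
    \<comment> \<open>In this case \<open>Act a\<close> is uncontrollable in the reduced alphabet,
      so it suffices to enable it in the reduced automaton after the replay.\<close>
    proof (cases "a \<in> env D \<or> q \<in> adom D a")
      case True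
      then have "Act a \<in> env Db" using a by (auto simp: env_Db)
      moreover have "(\<lambda>p\<in>?X. \<pi>b p (t1 p)) \<in> Domain (delta Ab (Act a))"
      proof (rule Ab_enabled[OF a])
        show "(\<lambda>p\<in>?X. \<pi>b p (t1 p)) \<in> (\<Pi>\<^sub>E p\<in>?X. st Ab p)"
        proof (rule PiE_I)
          fix p assume p: "p \<in> ?X"
          then show "(\<lambda>p\<in>?X. \<pi>b p (t1 p)) p \<in> st Ab p"
            using \<pi>b_st[of p "t1 p"] PiE_mem[OF reach_st[OF c(2)], of p] sub by (auto simp del: st_Ab)
        qed simp
        show "(base a (\<lambda>p\<in>?X. \<pi>b p (t1 p)), z) \<in> delta A a" using d c(12) by (simp add: base_absA)
      next
        assume q: "q \<in> ?X"
        have "a = an" if "a \<in> sys D" "q \<in> adom D a"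
        proof -
          have "\<exists>sq sr f. \<pi>b q (tr s q) = QARF sq a sr f"
            using h False that by (auto simp: env_def)
          then show ?thesis using c(6) by auto
        qed
        then show "\<exists>sq an sr f. (\<lambda>p\<in>?X. \<pi>b p (t1 p)) q = QARF sq an sr f \<and>
            (a \<in> sys D \<and> q \<in> adom D a \<longrightarrow> a = an) \<and> (adom D a = {r} \<longrightarrow> allowed D r f a)"
          using q c(8) False by auto
      qed
      then have "(\<lambda>p\<in>?X. \<pi>b p (restrict t1 ?X p)) \<in> Domain (delta Ab (Act a))" by (simp cong: restrict_cong)
      ultimately have "restrict t1 ?X \<in> Domain (delta Cb (Act a))" using Cb_env[OF _ tX] by blast
      then show ?thesis using enabled_iff[OF Cb aDb] by simp
    next
      case nT: False
      then show ?thesis using h False c(4) X(2) by auto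
    qed
    then obtain t2 where g2: "gtrans Db Cb t1 (Act a) t2" by (auto simp: enabled_def)
    have "path Db Cb t1 [(t1, Act a, t2)] t2" using g2 by simp
    then have rch2: "reach t2" by (rule reach_path[OF c(2)])
    define x' where "x' = (\<lambda>p\<in>adom D a. if p = r then Late (r_of (\<pi>b q (normalise (t2 q)))) (str_of (\<pi>b q (normalise (t2 q)))) []
      else if p = q then Main (normalise (t2 q)) else Main (t2 p))"
    have x'S: "x' \<in> (\<Pi>\<^sub>E p\<in>adom D a. SC p)"
    proof (rule PiE_I)
      fix p assume p: "p \<in> adom D a"
      then have "p \<noteq> r \<Longrightarrow> t2 p \<in> st Cb p" using PiE_mem[OF reach_st[OF rch2], of p] adom_procs[OF a] by simp
      then show "x' p \<in> SC p" using p normalise_Late[OF rch2] by (auto simp: x'_def SC_def)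
    qed (simp add: x'_def)
    obtain an' f' where n: "\<pi>b q (normalise (t2 q)) = QARF (main_of (\<pi>b q (t2 q))) an' (r_of (\<pi>b q (t2 q))) f'"
      using normalise_path[OF rch2] by blast
    have "restrict (absA t2) (adom D a) = (\<lambda>p\<in>adom D a. \<nu> p (x' p))"
      using n q_ne_r by (intro restrict_ext) (auto simp: absA_def x'_def \<nu>_def)
    then have m: "((\<lambda>p\<in>adom D a. \<nu> p (s p)), (\<lambda>p\<in>adom D a. \<nu> p (x' p))) \<in> delta A a"
      using step_Act(2)[OF g2] c(12) by simp
    have "joint_move a (restrict s (adom D a)) x'"
      unfolding joint_move_def if_not_P[OF False]
    proof (intro exI conjI)
      show "(restrict t1 ?X, restrict t2 ?X) \<in> delta Cb (Act a)" using g2 by (simp add: gtrans_def)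
      show "\<forall>p\<in>adom D a - {q, r}. restrict t1 ?X p = un_main (restrict s (adom D a) p) \<and> x' p = Main (restrict t2 ?X p)"
        using X(1) c(3) adom_procs[OF a] by (auto simp: x'_def tr_def)
      show "q \<in> adom D a \<longrightarrow> x' q = Main (normalise (restrict t2 ?X q))"
        using X(1) q_ne_r by (simp add: x'_def)
      show "q \<in> adom D a \<longrightarrow> lpath Db Cb q (un_main (restrict s (adom D a) q))
          (if r \<in> adom D a then map Act (word_of (pend (restrict s (adom D a) r))) else []) (restrict t1 ?X q)"
        using X(1) q_ne_r c(5) by (cases "r \<in> adom D a") (simp_all add: tr_q)
      show "r \<in> adom D a \<longrightarrow> x' r = Late (r_of (\<pi>b q (normalise (restrict t2 ?X q))))
          (str_of (\<pi>b q (normalise (restrict t2 ?X q)))) []"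
        using X q_ne_r by (simp add: x'_def)
    qed
    then have "(restrict s (adom D a), x') \<in> \<delta>C a"
      using xs x'S m unfolding \<delta>C_def by (simp cong: restrict_cong del: PiE_iff)
    then show ?thesis by blast
  qed
  then show ?thesis using enabled_iff[OF C a] by auto
qed


lemma init_path:
  "\<exists>\<rho>. path Db Cb (init_st Cb) \<rho> (tr (init_st C)) \<and> silent \<rho> \<and> sim_inv (init_st C) \<and> pend (init_st C r) = []"
proof -
  obtain \<rho> a f where n: "path Db Cb (init_st Cb) \<rho> ((init_st Cb)(q := q0))" "silent \<rho>"
    "\<pi>b q q0 = QARF (main_of (\<pi>b q (init_st Cb q))) a (r_of (\<pi>b q (init_st Cb q))) f"
    using normalise_path[OF reach_init] unfolding q0_def by blast
  have "tr (init_st C) = (init_st Cb)(q := q0)"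
  proof
    fix p
    have "init_st Cb \<in> (\<Pi>\<^sub>E p\<in>procs Db. st Cb p)" by (rule reach_st[OF reach_init])
    from PiE_arb[OF this, of p] show "tr (init_st C) p = ((init_st Cb)(q := q0)) p"
      using q_procs q_ne_r by (auto simp: tr_def C_def)
  qed
  moreover from this have "sim_inv (init_st C)"
    using C n(3) reach_path[OF reach_init n(1)] r_procs unfolding sim_inv_def zielonka_def by (auto simp: C_def)
  moreover have "pend (init_st C r) = []" using r_procs by (simp add: C_def)
  ultimately show ?thesis using n by auto
qed

lemma \<nu>_init: "p \<in> procs D \<Longrightarrow> \<nu> p (init_st C p) = init_st A p"
proof -
  assume p: "p \<in> procs D"
  have i: "\<pi>b q (init_st Cb q) = QR (init_st A q) (init_st A r)"
    using \<pi>b_init[OF q_Db] q_procs q_ne_r by (simp add: init_Ab)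
  obtain a f where n: "\<pi>b q q0 = QARF (main_of (\<pi>b q (init_st Cb q))) a (r_of (\<pi>b q (init_st Cb q))) f"
    using normalise_path[OF reach_init] unfolding q0_def by blast
  show ?thesis
    using p n i \<pi>b_init[of p] by (auto simp: C_def \<nu>_def init_Ab)
qed

lemma sim_inv_step: "sim_inv s \<Longrightarrow> gtrans D C s a s' \<Longrightarrow> sim_inv s'"
  using step_sim_r(1) step_sim by blast

lemma sim_inv_path: "sim_inv s \<Longrightarrow> path D C s \<rho> s' \<Longrightarrow> sim_inv s'"
proof (induction \<rho> arbitrary: s)
  case (Cons x \<rho>)
  then show ?case using sim_inv_step by (cases x) auto
qed simp

lemma \<nu>_st:
  assumes "p \<in> procs D" "c \<in> SC p"
  shows "\<nu> p c \<in> st A p"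
proof (cases "p = r")
  case True
  then show ?thesis using assms SC_r by (auto simp: Sr_def \<nu>_def)
next
  case False
  then obtain d where d: "c = Main d" "d \<in> st Cb p" using assms(2) by (auto simp: SC_def)
  then have "\<pi>b p d \<in> st Ab p" using \<pi>b_st[of p d] assms(1) False by simp
  then show ?thesis using d(1) by (cases "p = q") (auto simp: \<nu>_def red_qstates_def)
qed

end

section \<open>Correctness of maximal runs of the split controller\<close>

locale backward_run = reduction_backward D A K r q Cb \<pi>b
  for D :: "('p, 'a) alphabet" and A :: "('p, 'a, 's) zautomaton" and K r q
    and Cb :: "('p, 'a raction, 'c) zautomaton" and \<pi>b +
  fixes s w
  assumes run: "block_run D C s w" and mx: "block_maximal D C s w" and len: "\<And>i. length (w i) \<le> 1"
begin

lemma block: "(w i = [] \<and> s (Suc i) = s i) \<or> (\<exists>a. w i = [(s i, a, s (Suc i))] \<and> gtrans D C (s i) a (s (Suc i)))"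
  by (rule block_run_touch_step[OF run len])

lemma s_0: "s 0 = init_st C"
  by (rule block_run_init[OF run])

lemma sim_inv_s: "sim_inv (s i)"
proof (induction i)
  case 0
  then show ?case using init_path by (auto simp: s_0)
next
  case (Suc i)
  from block[of i] show ?case
  proof (elim disjE exE conjE)
    fix a assume "gtrans D C (s i) a (s (Suc i))"
    then show ?thesis by (rule sim_inv_step[OF Suc])
  qed (use Suc in simp)
qed

text \<open>What a block of the simulated run must satisfy. A local move of \<open>r\<close> may be
  matched by an empty block, which is why activity of \<open>r\<close> is preserved only up to the
  record.\<close>

definition sim :: "nat \<Rightarrow> ('p, 'a raction, 'c) gstep list \<Rightarrow> bool" where
  "sim i \<rho> \<longleftrightarrow> path Db Cb (tr (s i)) \<rho> (tr (s (Suc i))) \<and>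
    (\<forall>p\<in>procs D - {q, r}. aproj Db \<pi>b p \<rho> = map lift_step (aproj D \<nu> p (w i))) \<and>
    rproj D q q_of (aproj Db \<pi>b q \<rho>) = aproj D \<nu> q (w i) \<and>
    rproj D r r_of (aproj Db \<pi>b q \<rho>) @ pend (s (Suc i) r) = pend (s i r) @ aproj D \<nu> r (w i) \<and>
    (\<not> touches D (w i) {q} \<longrightarrow> \<not> touches Db \<rho> {q})"

lemma ex_sim: "\<exists>\<rho>. sim i \<rho>"
  using block[of i]
proof (elim disjE exE conjE)
  assume "w i = []" "s (Suc i) = s i"
  then show ?thesis unfolding sim_def by (intro exI[of _ "[]"]) simp
next
  fix a assume w: "w i = [(s i, a, s (Suc i))]" and g: "gtrans D C (s i) a (s (Suc i))"
  show ?thesis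
  proof (cases "adom D a = {r}")
    case True
    then show ?thesis
      using step_sim_r[OF sim_inv_s g True] q_ne_r unfolding sim_def w by (intro exI[of _ "[]"]) auto
  next
    case False
    have "(\<not> touches D (w i) {q}) = (q \<notin> adom D a)" by (auto simp: w)
    then show ?thesis using step_sim[OF sim_inv_s g False] unfolding sim_def w by auto
  qed
qed

definition R :: "nat \<Rightarrow> ('p, 'a raction, 'c) gstep list" where
  "R i = (SOME \<rho>. sim i \<rho>)"

lemma sim: "sim i (R i)"
  unfolding R_def by (rule someI_ex[OF ex_sim])

text \<open>Block 0 is spent on the initial announcements, so boundary \<open>j + 1\<close> of the
  simulated run corresponds to boundary \<open>j\<close> of the given one.\<close>

definition T :: "nat \<Rightarrow> 'p \<Rightarrow> 'c" where
  "T i = (case i of 0 \<Rightarrow> init_st Cb | Suc j \<Rightarrow> tr (s j))"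

definition U :: "nat \<Rightarrow> ('p, 'a raction, 'c) gstep list" where
  "U i = (case i of 0 \<Rightarrow> (SOME \<rho>. path Db Cb (init_st Cb) \<rho> (tr (s 0)) \<and> silent \<rho>) | Suc j \<Rightarrow> R j)"

lemma TU_simps [simp]: "T 0 = init_st Cb" "T (Suc i) = tr (s i)" "U (Suc i) = R i"
  by (simp_all add: T_def U_def)

lemma U_0: "path Db Cb (init_st Cb) (U 0) (tr (s 0))" "silent (U 0)"
  using someI_ex[of "\<lambda>\<rho>. path Db Cb (init_st Cb) \<rho> (tr (s 0)) \<and> silent \<rho>"] init_path by (auto simp: U_def s_0)

lemma crun: "block_run Db Cb T U"
  unfolding block_run_def
proof (intro conjI allI)
  fix i show "path Db Cb (T i) (U i) (T (Suc i))"
    using U_0(1) sim by (cases i) (auto simp: sim_def)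
qed simp

lemma R_touches:
  assumes "p \<in> procs D" "p \<noteq> q" "p \<noteq> r"
  shows "touches Db (R i) {p} \<longleftrightarrow> touches D (w i) {p}"
proof -
  have "aproj Db \<pi>b p (R i) = map lift_step (aproj D \<nu> p (w i))" using sim[of i] assms by (simp add: sim_def)
  then have "aproj Db \<pi>b p (R i) = [] \<longleftrightarrow> aproj D \<nu> p (w i) = []" by simp
  then show ?thesis unfolding aproj_empty_iff by blast
qed

text \<open>A replay occurs only within a step involving \<open>q\<close>, and each real move of
  \<open>q\<close> shows up in the projection on \<open>q\<close>; hence both runs have the same
  active blocks for \<open>q\<close>.\<close>

lemma R_touches_q: "touches Db (R i) {q} \<longleftrightarrow> touches D (w i) {q}"
proof
  assume "touches D (w i) {q}"
  then have "rproj D q q_of (aproj Db \<pi>b q (R i)) \<noteq> []"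
    using sim[of i] aproj_empty_iff[of D \<nu> q "w i"] by (auto simp: sim_def)
  then have "aproj Db \<pi>b q (R i) \<noteq> []" by auto
  then show "touches Db (R i) {q}" by (simp add: aproj_empty_iff)
qed (use sim[of i] in \<open>auto simp: sim_def\<close>)

lemma other_enabled:
  assumes e: "enabled Db Cb (tr (s k)) x" and q: "q \<notin> adom Db x"
  shows "\<exists>a. x = Act a \<and> adom D a = adom Db x \<and> q \<notin> adom D a \<and> r \<notin> adom D a \<and> enabled D C (s k) a"
proof -
  obtain a where x: "x = Act a" using q by (cases x) (auto simp: adom_Db)
  have na: "q \<notin> adom D a" "r \<notin> adom D a" using q q_ne_r by (auto simp: x in_adom_Db)
  obtain t' where g: "gtrans Db Cb (tr (s k)) (Act a) t'" using e x by (auto simp: enabled_def)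
  note S = step_Act[OF g]
  have "restrict (absA (tr (s k))) (adom D a) = (\<lambda>p\<in>adom D a. \<nu> p (s k p))"
  proof (rule restrict_ext)
    fix p assume p: "p \<in> adom D a"
    then have "p \<in> procs D" "p \<noteq> r" using adom_procs[OF S(1)] na by auto
    then show "absA (tr (s k)) p = \<nu> p (s k p)" using sim_invD(4)[OF sim_inv_s] by (simp add: absA_def)
  qed
  then have "enabled D C (s k) a"
    using C_enabled[OF sim_inv_s S(1)] S(2) e na x by auto
  then show ?thesis using x na adom_Db_other[OF na(2)] by auto
qed

lemma other_touch:
  assumes "enabled D C (s k) a" "q \<notin> adom D a" "r \<notin> adom D a"
  shows "\<exists>j\<ge>Suc k. touches Db (U j) (adom D a)"
proof -
  obtain j where j: "j \<ge> k" "touches D (w j) (adom D a)" using mx assms(1) by (auto simp: block_maximal_def)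
  then obtain p where p: "p \<in> adom D a" "touches D (w j) {p}" by (auto simp: touches_def)
  have "p \<in> procs D" using p(1) adom_procs[OF enabled_acts[OF assms(1)]] by blast
  then have "touches Db (U (Suc j)) {p}" using R_touches p assms(2,3) by auto
  then have "touches Db (U (Suc j)) (adom D a)" using p(1) touches_subset[of Db "U (Suc j)" "{p}"] by blast
  then show ?thesis using j(1) by blast
qed

lemma corr_transfer:
  assumes "p \<in> procs D" "p \<noteq> q" "p \<noteq> r" "satisfies_corr Ab Kb p (iconcat (\<lambda>i. aproj Db \<pi>b p (U i)))"
  shows "satisfies_corr A K p (iconcat (\<lambda>i. aproj D \<nu> p (w i)))"
proof -
  have "aproj Db \<pi>b p (U 0) = []" using silent_proj(1)[OF U_0(2) assms(2)] .
  then have "iconcat (\<lambda>i. aproj Db \<pi>b p (U i)) = iconcat (\<lambda>i. aproj Db \<pi>b p (R i))"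
    using iconcat_shift[of "\<lambda>i. aproj Db \<pi>b p (U i)"] by simp
  also have "\<dots> = iconcat (\<lambda>i. map lift_step (aproj D \<nu> p (w i)))"
    using sim assms by (simp add: sim_def)
  finally show ?thesis using corr_other[OF assms(1-3)] assms(4) by simp
qed

lemma sync_pend:
  assumes "touches D (w i) {r}" "touches D (w i) {q}"
  shows "pend (s (Suc i) r) = []"
  using block[of i]
proof (elim disjE exE conjE)
  fix a assume w: "w i = [(s i, a, s (Suc i))]" and g: "gtrans D C (s i) a (s (Suc i))"
  then have "r \<in> adom D a" "adom D a \<noteq> {r}" using assms q_ne_r by auto
  then show ?thesis using step_sim[OF sim_inv_s g] by blast
qed (use assms in simp)

lemma no_sync_pend:
  assumes "\<not> (touches D (w i) {r} \<and> touches D (w i) {q})"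
  shows "pend (s (Suc i) r) = pend (s i r) @ aproj D \<nu> r (w i)"
  using block[of i]
proof (elim disjE exE conjE)
  fix a assume w: "w i = [(s i, a, s (Suc i))]" and g: "gtrans D C (s i) a (s (Suc i))"
  have a: "a \<in> acts D" using g by (simp add: gtrans_def)
  show ?thesis
  proof (cases "r \<in> adom D a")
    case True
    then have "adom D a = {r}" using adom_r[OF a True] assms by (auto simp: w)
    then show ?thesis using step_sim_r(3)[OF sim_inv_s g] w by simp
  next
    case False
    then show ?thesis using gtrans_outside[OF g False] w by simp
  qed
qed simp

text \<open>Between two synchronisations the record of \<open>r\<close> grows with every move, but its length is bounded.\<close>

lemma r_stops:
  assumes "\<And>j. j \<ge> n \<Longrightarrow> \<not> (touches D (w j) {r} \<and> touches D (w j) {q})"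
  shows "\<exists>m\<ge>n. \<forall>j\<ge>m. \<not> touches D (w j) {r}"
proof -
  define f where "f j = length (pend (s (j + n) r))" for j
  have step: "f (Suc j) = f j + length (aproj D \<nu> r (w (j + n)))" for j
    using no_sync_pend[of "j + n"] assms[of "j + n"] by (auto simp: f_def)
  have "f j \<le> shortness" for j
    using sim_invD(2)[OF sim_inv_s[of "j + n"]] by (auto simp: f_def Sr_def)
  moreover have "mono f" using step by (simp add: mono_iff_le_Suc)
  ultimately obtain m where m: "\<And>j. j \<ge> m \<Longrightarrow> f j = f m" using eventually_const_nat by blast
  have "\<not> touches D (w j) {r}" if "j \<ge> m + n" for j
  proof -
    have "f (Suc (j - n)) = f (j - n)" using m[of "j - n"] m[of "Suc (j - n)"] that by simp
    then show ?thesis using step[of "j - n"] that aproj_empty_iff[of D \<nu> r "w j"] by simp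
  qed
  then show ?thesis by (intro exI[of _ "m + n"]) simp
qed

text \<open>The simulated moves of \<open>r\<close> lag behind the actual ones by exactly the
  record. The index \<open>Suc n\<close> accounts for the initial block of announcements.\<close>

lemma rproj_concats:
  "concats (\<lambda>i. rproj D r r_of (aproj Db \<pi>b q (U i))) (Suc n) @ pend (s n r) = concats (\<lambda>i. aproj D \<nu> r (w i)) n"
proof (induction n)
  case 0
  have "rproj D r r_of (aproj Db \<pi>b q (U 0)) = []" using silent_proj(2)[OF U_0(2)] .
  moreover have "pend (s 0 r) = []" using init_path by (auto simp: s_0)
  ultimately show ?case by simp
next
  case (Suc n)
  have "rproj D r r_of (aproj Db \<pi>b q (R n)) @ pend (s (Suc n) r) = pend (s n r) @ aproj D \<nu> r (w n)"
    using sim[of n] by (simp add: sim_def)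
  then have "concats (\<lambda>i. rproj D r r_of (aproj Db \<pi>b q (U i))) (Suc (Suc n)) @ pend (s (Suc n) r) =
      concats (\<lambda>i. rproj D r r_of (aproj Db \<pi>b q (U i))) (Suc n) @ pend (s n r) @ aproj D \<nu> r (w n)"
    by simp
  then show ?case unfolding append_assoc[symmetric] Suc by simp
qed

lemma untouched_const: "(\<And>j. j \<ge> m \<Longrightarrow> \<not> touches D (w j) {p}) \<Longrightarrow> k \<ge> m \<Longrightarrow> s k p = s m p"
  by (rotate_tac 1, induction rule: dec_induct)
    (use path_outside[OF block_run_path[OF run], of _ "{p}" p] in auto)

text \<open>Once \<open>q\<close> has stopped, so does \<open>r\<close> by \<open>r_stops\<close>.
  The remaining record is inserted, which brings the simulated \<open>q\<close>-state up to date;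
  its acceptance then covers the actual states of both \<open>q\<close> and
  \<open>r\<close>.\<close>

lemma finite_case:
  assumes no: "\<And>j. j \<ge> n \<Longrightarrow> \<not> touches D (w j) {q}" and p: "p \<in> procs D"
  shows "satisfies_corr A K p (iconcat (\<lambda>i. aproj D \<nu> p (w i)))"
proof -
  obtain m where m: "m \<ge> n" "\<And>j. j \<ge> m \<Longrightarrow> \<not> touches D (w j) {r}" using r_stops[of n] no by blast
  have mq: "\<not> touches D (w j) {q}" if "j \<ge> m" for j using no that m(1) by simp
  obtain sq an s0 f0 where Q: "\<pi>b q (tr (s m) q) = QARF sq an s0 f0"
    "pending D A r s0 f0 (pend (s m r)) (cur (s m r)) (strt (s m r))"
    using sim_inv_s[of m] by (auto simp: sim_inv_def)
  obtain \<rho> c where \<rho>: "path Db Cb (tr (s m)) \<rho> ((tr (s m))(q := c))"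
    "\<pi>b q c = QARF sq an (cur (s m r)) (strt (s m r))" "\<forall>(x, a, x')\<in>set \<rho>. adom Db a = {q}"
    using pending_path[OF sim_invD(6)[OF sim_inv_s] Q] by blast
  let ?z = "(tr (s m))(q := c)"
  let ?T = "insert_st (Suc m) {q} ?z T" and ?U = "insert_block (Suc m) {q} ?z \<rho> U"
  have rho: "adom Db a \<subseteq> {q}" if "(x, a, x') \<in> set \<rho>" for x a x' using \<rho>(3) that by auto
  have noU: "\<not> touches Db (U j) {q}" if "j \<ge> Suc m" for j
    using that mq R_touches_q by (cases j) auto
  \<comment> \<open>Boundary \<open>Suc m\<close> of the simulated run is the one with state
    \<open>tr (s m)\<close>, from which the record is replayed.\<close>
  have run': "block_run Db Cb ?T ?U"
    by (rule block_run_insert[OF crun _ rho noU]) (use \<rho>(1) in simp_all)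
  have tch: "touches Db (?U i) X \<longleftrightarrow> touches Db (U i) X" if "i > Suc m" for i X
    using that by (simp add: insert_block_def touches_ovstep)
  have "block_maximal Db Cb ?T ?U"
  proof (rule block_maximalI_late[OF Cb run', of "Suc (Suc m)"])
    fix i x assume i: "i \<ge> Suc (Suc m)" and e: "enabled Db Cb (?T i) x"
    then obtain k where k: "i = Suc k" "k > m" by (cases i) auto
    have Ti: "?T i = override_on (tr (s k)) ?z {q}" using k by (simp add: insert_st_def)
    have sk: "s k q = s m q" "s k r = s m r" using untouched_const[of m q k, OF mq] untouched_const[of m r k, OF m(2)] k(2) by simp_all
    have "\<exists>j\<ge>i. touches Db (U j) (adom Db x)"
    proof (cases "q \<in> adom Db x")
      case False
      have "enabled Db Cb (tr (s k)) x"
      proof (rule enabled_cong[OF Cb, THEN iffD1, OF _ e])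
        fix p assume "p \<in> adom Db x"
        then have "p \<noteq> q" using False by blast
        then show "?T i p = tr (s k) p" unfolding Ti by (simp add: override_on_def)
      qed
      then show ?thesis using other_enabled[OF _ False] other_touch k(1) by metis
    next
      case True
      obtain t' where g: "gtrans Db Cb (?T i) x t'" using e by (auto simp: enabled_def)
      have Tq: "\<pi>b q (?T i q) = QARF sq an (cur (s k r)) (strt (s k r))" using \<rho>(2) sk unfolding Ti by simp
      \<comment> \<open>After the replay \<open>q\<close> is in a state \<open>QARF\<close>, where
        no announcement is possible.\<close>
      obtain a where x: "x = Act a"
      proof (rule ccontr)
        assume "\<not> thesis"
        then have "\<And>b. x \<noteq> Act b" using that by blast
        from Ch_delta[OF gtrans_Ch(1,2)[OF g this] this] Tq show False by simp
      qed
      note S = step_Act[OF g[unfolded x]]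
      have qs: "(a \<in> sys D \<and> q \<in> adom D a \<longrightarrow> a = an) \<and> (adom D a = {r} \<longrightarrow> allowed D r (strt (s k r)) a)"
        using S(3) True x Tq by (auto simp: qstep_def)
      have trk: "\<pi>b q (tr (s k) q) = QARF sq an s0 f0" using Q(1) sk by (simp add: tr_q)
      have "restrict (absA (?T i)) (adom D a) = (\<lambda>p\<in>adom D a. \<nu> p (s k p))"
      proof (rule restrict_ext)
        fix p assume "p \<in> adom D a"
        then have "p \<in> procs D" using adom_procs[OF S(1)] by blast
        then show "absA (?T i) p = \<nu> p (s k p)"
          using sim_invD(4)[OF sim_inv_s[of k], of p] sim_invD(5)[OF sim_inv_s[of k]] trk Tq unfolding absA_def Ti
          by (cases "p = q") (auto simp: q_ne_r)
      qed
      then have d: "((\<lambda>p\<in>adom D a. \<nu> p (s k p)), restrict (absA t') (adom D a)) \<in> delta A a" using S(2) by simp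
      have "a \<in> env D \<or> (adom D a = {r} \<and> allowed D r (strt (s k r)) a) \<or>
        (q \<in> adom D a \<and> (\<exists>sq sr f. \<pi>b q (tr (s k) q) = QARF sq a sr f))"
      proof (cases "a \<in> sys D")
        case sys: True
        have "q \<in> adom D a \<or> r \<in> adom D a" using True x by (auto simp: in_adom_Db)
        then show ?thesis using qs sys trk sys_local[OF sys, of r] by auto
      qed (use S(1) in \<open>simp add: env_def\<close>)
      then have "enabled D C (s k) a" using C_enabled[OF sim_inv_s S(1) d] by blast
      then obtain j where j: "j \<ge> k" "touches D (w j) (adom D a)" using mx by (auto simp: block_maximal_def)
      then obtain p where p: "p \<in> adom D a" "touches D (w j) {p}" by (auto simp: touches_def)
      have pqr: "p \<noteq> q" "p \<noteq> r" using p(2) mq[of j] m(2)[of j] j(1) k(2) by auto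
      then have "touches Db (U (Suc j)) {p}" using R_touches p adom_procs[OF S(1) p(1)] by simp
      moreover have "p \<in> adom Db x" using p(1) pqr x by (simp add: in_adom_Db)
      ultimately have "touches Db (U (Suc j)) (adom Db x)" using touches_subset[of Db "U (Suc j)" "{p}"] by blast
      then show ?thesis using j(1) k(1) by blast
    qed
    then show "\<exists>j\<ge>i. touches Db (?U j) (adom Db x)" using tch i by (meson Suc_le_lessD order_trans)
  qed
  note ok = correct_coveringD[OF correct run' this]
  consider "p = q \<or> p = r" | "p \<noteq> q" "p \<noteq> r" by blast
  then show ?thesis
  proof cases
    case 1
    have "\<not> touches Db (?U i) {q}" if "i \<ge> Suc (Suc m)" for i using tch noU that by simp
    then have "\<pi>b q (?T (Suc (Suc m)) q) \<in> fin_ok Kb q"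
      using satisfies_corr_finite[where p = q and \<pi> = \<pi>b, OF run' \<pi>b_init[OF q_Db]] ok[OF q_Db] by blast
    then have fin: "sq \<in> fin_ok K q" "cur (s m r) \<in> fin_ok K r"
      using \<rho>(2) by (auto simp: insert_st_def red_condition_def)
    have "\<nu> q (s m q) = sq" using sim_invD(4)[OF sim_inv_s q_procs q_ne_r(1)] Q(1) by simp
    then show ?thesis
      using 1 fin sim_invD(5)[OF sim_inv_s] satisfies_corr_finite[where p = q and \<pi> = \<nu> and n = m, OF run \<nu>_init[OF q_procs] mq]
        satisfies_corr_finite[where p = r and \<pi> = \<nu> and n = m, OF run \<nu>_init[OF r_procs] m(2)]
      by auto
  next
    case 2
    have "aproj Db \<pi>b p (?U i) = aproj Db \<pi>b p (U i)" for i
      by (rule aproj_insert) (use 2 rho in auto)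
    then show ?thesis using corr_transfer[OF p 2] ok[of p] p 2 by simp
  qed
qed

text \<open>Since \<open>q\<close> acts for ever, nothing has to be inserted: the simulated run is
  fair as it stands. The work lies in the condition for \<open>r\<close>, split by whether
  \<open>r\<close> moves infinitely often.\<close>

lemma infinite_case:
  assumes inf: "\<And>n. \<exists>j\<ge>n. touches D (w j) {q}" and p: "p \<in> procs D"
  shows "satisfies_corr A K p (iconcat (\<lambda>i. aproj D \<nu> p (w i)))"
proof -
  have infU: "\<exists>j\<ge>n. touches Db (U j) {q}" for n
  proof -
    obtain j where "j \<ge> n" "touches D (w j) {q}" using inf by blast
    then show ?thesis using R_touches_q by (intro exI[of _ "Suc j"]) simp
  qed
  have "block_maximal Db Cb T U"
  proof (rule block_maximalI_late[OF Cb crun, of 1])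
    fix i x assume i: "i \<ge> 1" and e: "enabled Db Cb (T i) x"
    then obtain k where k: "i = Suc k" by (cases i) auto
    show "\<exists>j\<ge>i. touches Db (U j) (adom Db x)"
    proof (cases "q \<in> adom Db x")
      case True
      then show ?thesis using infU[of i] touches_subset[of Db _ "{q}" "adom Db x"] by blast
    next
      case False
      then show ?thesis using other_enabled[of k x] other_touch e unfolding k TU_simps by metis
    qed
  qed
  note ok = correct_coveringD[OF correct crun this]
  let ?v = "\<lambda>i. aproj Db \<pi>b q (U i)"
  obtain W where W: "iconcat ?v = Inf W" using iconcat_Inf_iff[of ?v] infU by (auto simp: aproj_empty_iff)
  have om: "W \<in> red_qomega D A K r q" using ok[OF q_Db] W by (simp add: red_condition_def)
  have "rproj D q q_of (aproj Db \<pi>b q (U 0)) = []" using silent_proj(2)[OF U_0(2)] .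
  then have "iconcat (\<lambda>i. rproj D q q_of (?v i)) = iconcat (\<lambda>i. rproj D q q_of (aproj Db \<pi>b q (R i)))"
    using iconcat_shift[of "\<lambda>i. rproj D q q_of (?v i)"] by simp
  also have "\<dots> = iconcat (\<lambda>i. aproj D \<nu> q (w i))" using sim by (simp add: sim_def)
  finally have okq: "satisfies_corr A K q (iconcat (\<lambda>i. aproj D \<nu> q (w i)))"
    using om red_proj_iconcat[OF W, of D q q_of] by (simp add: red_qomega_def)
  have pr: "red_proj D r r_of W = iconcat (\<lambda>i. rproj D r r_of (?v i))" by (rule red_proj_iconcat[OF W])
  have okr: "satisfies_corr A K r (iconcat (\<lambda>i. aproj D \<nu> r (w i)))"
  proof (cases "\<exists>m. \<forall>j\<ge>m. \<not> touches D (w j) {r}")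
    case False
    \<comment> \<open>If \<open>r\<close> keeps moving, \<open>r_stops\<close> forces infinitely
      many synchronisations. Each empties the record, so the two projections on \<open>r\<close>
      coincide at these boundaries and have the same limit.\<close>
    have sync: "\<exists>j\<ge>n. pend (s j r) = []" for n
    proof -
      obtain j where "j \<ge> n" "touches D (w j) {r}" "touches D (w j) {q}" using r_stops[of n] False by blast
      then show ?thesis using sync_pend[of j] by (intro exI[of _ "Suc j"]) simp
    qed
    have "iconcat (\<lambda>i. rproj D r r_of (?v i)) = iconcat (\<lambda>i. aproj D \<nu> r (w i))"
    proof (rule iconcat_eqI)
      fix n
      show "\<exists>m v. concats (\<lambda>i. aproj D \<nu> r (w i)) m = concats (\<lambda>i. rproj D r r_of (?v i)) n @ v"
      proof (cases n)
        case (Suc k)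
        then show ?thesis using rproj_concats[of k] by metis
      qed auto
      obtain m where m: "m \<ge> n" "pend (s m r) = []" using sync by blast
      obtain v where "concats (\<lambda>i. aproj D \<nu> r (w i)) m = concats (\<lambda>i. aproj D \<nu> r (w i)) n @ v"
        using concats_le[OF m(1)] by blast
      then show "\<exists>m v. concats (\<lambda>i. rproj D r r_of (?v i)) m = concats (\<lambda>i. aproj D \<nu> r (w i)) n @ v"
        using rproj_concats[of m] m(2) by (metis append_Nil2)
    qed
    moreover obtain v where v: "iconcat (\<lambda>i. aproj D \<nu> r (w i)) = Inf v"
      using iconcat_Inf_iff[of "\<lambda>i. aproj D \<nu> r (w i)"] False by (auto simp: aproj_empty_iff)
    ultimately show ?thesis using om pr by (simp add: red_qomega_def)
  next
    case True
    then obtain m where m: "\<And>j. j \<ge> m \<Longrightarrow> \<not> touches D (w j) {r}" by blast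
    have sj: "s j r = s m r" if "j \<ge> m" for j using untouched_const[OF m that] .
    have "rproj D r r_of (?v j) = []" if j: "j \<ge> Suc m" for j
    proof -
      obtain k where k: "j = Suc k" "k \<ge> m" using j by (cases j) auto
      have "aproj D \<nu> r (w k) = []" using m[OF k(2)] by (simp add: aproj_empty_iff)
      then show ?thesis using sim[of k] sj[OF k(2)] sj[of "Suc k"] k by (simp add: sim_def)
    qed
    then obtain x where "red_proj D r r_of W = Fin x" unfolding pr by (auto simp: iconcat_Fin_iff)
    then obtain sr f where al: "\<forall>\<^sub>\<infinity>i. \<exists>sq. fst (W i) = QRF sq sr f \<or> (\<exists>a. fst (W i) = QARF sq a sr f)"
      and mr: "\<And>v s'. maximal_respecting D A r sr f v s' \<Longrightarrow> s' \<in> fin_ok K r"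
      using om by (auto simp: red_qomega_def)
    obtain N where N: "\<And>i. i \<ge> N \<Longrightarrow> \<exists>sq. fst (W i) = QRF sq sr f \<or> (\<exists>a. fst (W i) = QARF sq a sr f)"
      using al unfolding MOST_nat_le by blast
    \<comment> \<open>A nonempty block that starts at a position beyond \<open>N\<close>: there the
      pair \<open>sr\<close>, \<open>f\<close> from the acceptance condition can be identified with
      the pair stored in \<open>q\<close>.\<close>
    obtain j where j: "j \<ge> Suc m" "?v j \<noteq> []" "N \<le> length (concats ?v j)"
      using length_concats_unbounded[of ?v "Suc m" N] infU by (auto simp: aproj_empty_iff)
    obtain k where k: "j = Suc k" "k \<ge> m" using j(1) by (cases j) auto
    have "fst (W (length (concats ?v j))) = \<pi>b q (T j q)"
      using iconcat_hd[OF W j(2)] aproj_hd[OF block_run_path[OF crun] j(2)] by simp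
    moreover obtain sq an s0 f0 where Q: "\<pi>b q (tr (s k) q) = QARF sq an s0 f0"
      "pending D A r s0 f0 (pend (s k r)) (cur (s k r)) (strt (s k r))"
      using sim_inv_s[of k] by (auto simp: sim_inv_def)
    ultimately have eq: "s0 = sr" "f0 = f" using N[OF j(3)] k(1) by auto
    \<comment> \<open>If the record could be prolonged, the prolonging action would be enabled for
      the real \<open>r\<close>, and fairness would make \<open>r\<close> move again.\<close>
    have "maximal_respecting D A r sr f (word_of (pend (s k r))) (cur (s k r))"
      unfolding maximal_respecting_def
    proof (intro conjI notI)
      show "follows D A r sr f (word_of (pend (s k r))) (cur (s k r))"
        using pending_follows[OF Q(2)] eq by simp
      assume "\<exists>a s''. follows D A r sr f (word_of (pend (s k r)) @ [a]) s''"
      then obtain a s'' where "follows D A r s0 f0 (word_of (pend (s k r)) @ [a]) s''" using eq by blast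
      from pending_follows_snoc[OF Q(2) this]
      have a: "allowed D r (strt (s k r)) a" "(tup1 r (cur (s k r)), tup1 r s'') \<in> delta A a" by auto
      have aD: "a \<in> acts D" "adom D a = {r}" using a(1) loc_actsD unfolding allowed_def by blast+
      have "((\<lambda>p\<in>adom D a. \<nu> p (s k p)), tup1 r s'') \<in> delta A a"
        using a(2) sim_invD(5)[OF sim_inv_s] by (simp add: aD(2) restrict_singleton)
      then have "enabled D C (s k) a" using C_enabled[OF sim_inv_s aD(1)] a(1) aD(2) by blast
      then obtain i where "i \<ge> k" "touches D (w i) {r}" using mx aD(2) unfolding block_maximal_def by metis
      then show False using m k(2) by simp
    qed
    then have "cur (s k r) \<in> fin_ok K r" by (rule mr)
    then have "\<nu> r (s m r) \<in> fin_ok K r" using sj[OF k(2)] sim_invD(5)[OF sim_inv_s[of m]] by simp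
    then show ?thesis
      using satisfies_corr_finite[where p = r and \<pi> = \<nu> and n = m, OF run \<nu>_init[OF r_procs] m] by blast
  qed
  show ?thesis
    using okq okr corr_transfer[OF p] ok[of p] p by (cases "p = q"; cases "p = r") auto
qed

lemma correct_run:
  assumes "p \<in> procs D"
  shows "satisfies_corr A K p (iconcat (\<lambda>i. aproj D \<nu> p (w i)))"
proof (cases "\<exists>n. \<forall>j\<ge>n. \<not> touches D (w j) {q}")
  case True
  then show ?thesis using finite_case assms by blast
next
  case False
  then show ?thesis using infinite_case assms by blast
qed

end

context reduction_backward
begin

lemma controllable_original: "controllable D A K"
proof (rule controllableI[of D A C \<nu>])
  fix p c assume "p \<in> procs D" "c \<in> st C p"
  then show "\<nu> p c \<in> st A p" using \<nu>_st by simp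
next
  fix a s \<rho> assume g: "path D C (init_st C) \<rho> s" and a: "a \<in> env D"
    and d: "(\<lambda>p\<in>adom D a. \<nu> p (s p)) \<in> Domain (delta A a)"
  have "sim_inv s" using sim_inv_path[OF _ g] init_path by blast
  moreover have "a \<in> acts D" using a by (simp add: env_def)
  ultimately show "enabled D C s a" using C_enabled a d by blast
next
  fix t u p assume "block_run D C t u" "block_maximal D C t u" "\<And>i. length (u i) \<le> 1" and p: "p \<in> procs D"
  then interpret backward_run D A K r q Cb \<pi>b t u by unfold_locales
  show "satisfies_corr A K p (iconcat (\<lambda>i. aproj D \<nu> p (u i)))" by (rule correct_run[OF p])
next
  fix a c c' assume "a \<in> acts D" "(c, c') \<in> delta C a"
  then show "((\<lambda>p\<in>adom D a. \<nu> p (c p)), (\<lambda>p\<in>adom D a. \<nu> p (c' p))) \<in> delta A a"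
    by (simp add: \<delta>C_def del: PiE_iff)
qed (use D A C \<nu>_init in simp_all)

end

section \<open>The size of the reduced component\<close>

lemma sum_power_le: "(\<Sum>i\<le>n. c ^ i) \<le> (c + 1 :: nat) ^ n"
proof (induction n)
  case (Suc n)
  have "c ^ Suc n \<le> c * (c + 1) ^ n" by (simp add: power_mono)
  from add_mono[OF Suc this] show ?case by simp
qed simp

context reduction
begin

text \<open>A local run is given by a start state and a word of length at most \<open>N\<close>;
  \<open>sum_power_le\<close> bounds the number of these words.\<close>

lemma card_local_runs:
  assumes "short_by N D A r"
  shows "card (local_runs D A r) \<le> comp_size D A r * (comp_size D A r + 1) ^ N"
proof -
  let ?L = "{u. set u \<subseteq> acts_of D r \<and> length u \<le> N}"
  have fin: "finite (acts_of D r)" using finite_acts by (simp add: acts_of_def)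
  have "local_runs D A r \<subseteq> st A r \<times> ?L"
    using assms lpath_lists by (fastforce simp: local_runs_def short_by_def loc_acts_def acts_of_def)
  then have "card (local_runs D A r) \<le> card (st A r \<times> ?L)"
    using finite_st[OF r_procs] finite_lists_length_le[OF fin] by (intro card_mono) auto
  also have "\<dots> = card (st A r) * (\<Sum>i\<le>N. card (acts_of D r) ^ i)"
    by (simp add: card_cartesian_product card_lists_length_le[OF fin])
  also have "\<dots> \<le> card (st A r) * (card (acts_of D r) + 1) ^ N"
    by (intro mult_le_mono2 sum_power_le)
  also have "\<dots> \<le> comp_size D A r * (comp_size D A r + 1) ^ N"
    by (intro mult_le_mono power_mono) (simp_all add: comp_size_def)
  finally show ?thesis .
qed

text \<open>The factor 43 is 3 + 4 + 36 for states, actions and transitions. Transitions are bounded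
  by state, action and state, whence 36 = 3 * 4 * 3, degree 5 = 2 + 1 + 2 and the third power of the
  exponential.\<close>

lemma comp_size_reduced:
  "comp_size Db Ab q \<le> 43 * (comp_size D A q + 1) ^ 5 * 2 ^ (3 * (comp_size D A r + card (local_runs D A r)))"
proof -
  \<comment> \<open>The summand 1 ensures that \<open>m\<close> is positive, so that lower powers of
    \<open>m\<close> are absorbed by higher ones.\<close>
  define m where "m = comp_size D A q + 1"
  define k where "k = comp_size D A r"
  define M where "M = card (local_runs D A r)"
  \<comment> \<open>With this exponent \<open>E\<close> dominates the number of
    \<open>r\<close>-states, the number of strategies and also their product.\<close>
  define E :: nat where "E = 2 ^ (k + M)"
  let ?F = "strategies D A r"
  note fin = finite_strategies finite_st[OF q_procs] finite_st[OF r_procs]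
  have fa: "finite (acts_of D p)" for p using finite_acts by (simp add: acts_of_def)
  have m1: "m \<ge> 1" "card (st A q) \<le> m" "card (acts_of D q) \<le> m" by (simp_all add: m_def comp_size_def)
  have k1: "card (st A r) \<le> k" "card (acts_of D r) \<le> k" by (simp_all add: k_def comp_size_def)
  have F: "card ?F \<le> 2 ^ M" using card_strategies by (simp add: M_def)
  have k2: "k \<le> 2 ^ k" by (simp add: less_imp_le)
  have "(2 :: nat) ^ k \<le> E" "2 ^ M \<le> E" by (simp_all add: E_def)
  with k2 F have kE: "k \<le> E" and FE: "card ?F \<le> E" by linarith+
  have kFE: "card (st A r) * card ?F \<le> E"
    using mult_le_mono[OF order.trans[OF k1(1) k2] F] by (simp add: E_def power_add)
  have E1: "E \<ge> 1" by (simp add: E_def)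
  have S: "card (red_qstates D A r q) \<le> 3 * m\<^sup>2 * E"
  proof -
    have "red_qstates D A r q \<subseteq> (\<lambda>(x, y). QR x y) ` (st A q \<times> st A r) \<union>
        (\<lambda>(x, y, f). QRF x y f) ` (st A q \<times> st A r \<times> ?F) \<union>
        (\<lambda>(x, a, y, f). QARF x a y f) ` (st A q \<times> acts_of D q \<times> st A r \<times> ?F)"
      (is "_ \<subseteq> ?f1 ` ?A1 \<union> ?f2 ` ?A2 \<union> ?f3 ` ?A3")
      by (auto simp: red_qstates_def strategies_def image_iff)
    moreover have f: "finite ?A1" "finite ?A2" "finite ?A3" using fin fa by auto
    ultimately have "card (red_qstates D A r q) \<le> card (?f1 ` ?A1 \<union> ?f2 ` ?A2 \<union> ?f3 ` ?A3)"
      by (intro card_mono) auto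
    also have "\<dots> \<le> card (?f1 ` ?A1) + card (?f2 ` ?A2) + card (?f3 ` ?A3)"
      by (intro order.trans[OF card_Un_le] add_mono card_Un_le order.refl)
    also have "\<dots> \<le> card ?A1 + card ?A2 + card ?A3" using f by (intro add_mono card_image_le)
    also have "\<dots> = card (st A q) * card (st A r) + card (st A q) * (card (st A r) * card ?F) +
        card (st A q) * (card (acts_of D q) * (card (st A r) * card ?F))"
      by (simp add: card_cartesian_product)
    also have "\<dots> \<le> m * E + m * E + m * (m * E)"
      using m1 k1 kE kFE by (intro add_mono mult_le_mono) auto
    also have "\<dots> \<le> (m * m) * E + (m * m) * E + (m * m) * E"
      using m1(1) by (intro add_mono mult_le_mono1) auto
    finally show ?thesis by (simp add: power2_eq_square)
  qed
  have T: "card (acts_of Db q) \<le> 4 * m * E"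
  proof -
    have "acts_of Db q \<subseteq> Act ` (acts_of D q \<union> acts_of D r) \<union> ChF ` ?F \<union> ChA ` acts_of D q"
    proof
      fix x assume "x \<in> acts_of Db q"
      then show "x \<in> Act ` (acts_of D q \<union> acts_of D r) \<union> ChF ` ?F \<union> ChA ` acts_of D q"
        by (cases x) (auto simp: acts_of_def in_adom_Db)
    qed
    then have "card (acts_of Db q) \<le> card (Act ` (acts_of D q \<union> acts_of D r) \<union> ChF ` ?F \<union> ChA ` acts_of D q)"
      using fin fa by (intro card_mono) auto
    also have "\<dots> \<le> card (Act ` (acts_of D q \<union> acts_of D r)) + card (ChF ` ?F) + card (ChA ` acts_of D q :: 'a raction set)"
      by (intro order.trans[OF card_Un_le] add_mono card_Un_le order.refl)
    also have "\<dots> \<le> card (acts_of D q \<union> acts_of D r) + card ?F + card (acts_of D q)"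
      using fin fa by (intro add_mono card_image_le) auto
    also have "\<dots> \<le> (m + k) + E + m"
      using card_Un_le[of "acts_of D q" "acts_of D r"] m1(3) k1(2) FE by linarith
    also have "\<dots> \<le> 2 * m + 2 * E" using kE by simp
    also have "\<dots> \<le> 2 * (m * E) + 2 * (m * E)" using m1(1) E1 by (intro add_mono mult_le_mono2) auto
    finally show ?thesis by (simp add: algebra_simps)
  qed
  let ?D = "{(t q, x, t' q) | t x t'. x \<in> acts_of Db q \<and> (t, t') \<in> delta Ab x}"
  have "?D \<subseteq> red_qstates D A r q \<times> acts_of Db q \<times> red_qstates D A r q"
  proof
    fix y assume "y \<in> ?D"
    then obtain t x t' where y: "y = (t q, x, t' q)" and x: "x \<in> acts_of Db q" and d: "(t, t') \<in> delta Ab x"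
      by blast
    have tt: "t \<in> (\<Pi>\<^sub>E p\<in>adom Db x. st Ab p)" "t' \<in> (\<Pi>\<^sub>E p\<in>adom Db x. st Ab p)"
      using Ab x d unfolding zielonka_def acts_of_def by blast+
    have q: "q \<in> adom Db x" using x by (simp add: acts_of_def)
    show "y \<in> red_qstates D A r q \<times> acts_of Db q \<times> red_qstates D A r q"
      using x PiE_mem[OF tt(1) q] PiE_mem[OF tt(2) q] y by simp
  qed
  moreover have "finite (acts_of Db q)" using Db by (simp add: dist_alphabet_def acts_of_def)
  ultimately have "card ?D \<le> card (red_qstates D A r q \<times> acts_of Db q \<times> red_qstates D A r q)"
    using finite_qstates by (intro card_mono) auto
  then have "card ?D \<le> card (red_qstates D A r q) * (card (acts_of Db q) * card (red_qstates D A r q))"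
    by (simp add: card_cartesian_product)
  also have "\<dots> \<le> (3 * m\<^sup>2 * E) * ((4 * m * E) * (3 * m\<^sup>2 * E))"
    using S T by (intro mult_le_mono)
  finally have "card ?D \<le> 36 * (m ^ 5 * E ^ 3)"
    by (simp add: power2_eq_square power3_eq_cube power_numeral_reduce algebra_simps)
  moreover have "m\<^sup>2 * E ^ 1 \<le> m ^ 5 * E ^ 3" "m ^ 1 * E ^ 1 \<le> m ^ 5 * E ^ 3"
    using m1(1) E1 by (intro mult_le_mono power_increasing; simp)+
  moreover have "comp_size Db Ab q = card (red_qstates D A r q) + card (acts_of Db q) + card ?D"
    by (simp add: comp_size_def)
  ultimately have "comp_size Db Ab q \<le> 43 * (m ^ 5 * E ^ 3)" using S T by simp
  also have "E ^ 3 = 2 ^ (3 * (k + M))" by (simp add: E_def mult.commute flip: power_mult)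
  finally show ?thesis by (simp add: m_def k_def M_def)
qed

end

text \<open>Two readings of the size of the \<open>r\<close>-component appear. Strategies are
  defined on local runs, so one bound includes their number in the exponent; for a fixed bound
  \<open>N\<close> on the length of local runs, that number is polynomial in
  \<open>comp_size\<close>, with a degree depending on \<open>N\<close>.\<close>

theorem theorem3:
  shows
   "(\<forall>(D :: ('p, 'a) alphabet) (A :: ('p, 'a, 's) zautomaton) K r q.
       reduction_setting D A K r q \<longrightarrow>
         (can_idle D A q \<longrightarrow>
            (controllable D A K \<longleftrightarrow>
             controllable (red_alphabet D A r q) (red_automaton D A r q) (red_condition D A K r q))) \<and>
         (controllable (red_alphabet D A r q) (red_automaton D A r q) (red_condition D A K r q) \<longrightarrow>
          controllable D A K)) \<and>
    (\<exists>P :: nat poly.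
       (\<exists>Q :: nat poly.
          \<forall>(D :: ('p, 'a) alphabet) (A :: ('p, 'a, 's) zautomaton) K r q.
            reduction_setting D A K r q \<longrightarrow>
              comp_size (red_alphabet D A r q) (red_automaton D A r q) q
                \<le> poly P (comp_size D A q) * 2 ^ poly Q (comp_size D A r + card (local_runs D A r))) \<and>
       (\<forall>N. \<exists>Q :: nat poly.
          \<forall>(D :: ('p, 'a) alphabet) (A :: ('p, 'a, 's) zautomaton) K r q.
            reduction_setting D A K r q \<and> short_by N D A r \<longrightarrow>
              comp_size (red_alphabet D A r q) (red_automaton D A r q) q
                \<le> poly P (comp_size D A q) * 2 ^ poly Q (comp_size D A r)))"
proof -
  have backward: "controllable D A K"
    if set: "reduction_setting D A K r q" and
      ctl: "controllable (red_alphabet D A r q) (red_automaton D A r q) (red_condition D A K r q)"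
    for D :: "('p, 'a) alphabet" and A :: "('p, 'a, 's) zautomaton" and K r q
  proof -
    obtain C :: "('p, 'a raction, nat) zautomaton" and \<pi> where
      "correct_covering (red_alphabet D A r q) (red_automaton D A r q) (red_condition D A K r q) C \<pi>"
      using ctl unfolding controllable_def by blast
    then interpret reduction_backward D A K r q C \<pi> using set by unfold_locales
    show ?thesis by (rule controllable_original)
  qed
  have forward: "controllable (red_alphabet D A r q) (red_automaton D A r q) (red_condition D A K r q)"
    if set: "reduction_setting D A K r q" "can_idle D A q" and ctl: "controllable D A K"
    for D :: "('p, 'a) alphabet" and A :: "('p, 'a, 's) zautomaton" and K r q
  proof -
    obtain C :: "('p, 'a, nat) zautomaton" and \<pi> where "correct_covering D A K C \<pi>"
      using ctl unfolding controllable_def by blast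
    then interpret reduction_forward D A K r q C \<pi> using set by unfold_locales
    show ?thesis by (rule controllable_reduced)
  qed
  define P :: "nat poly" where "P = smult 43 ([:1, 1:] ^ 5)"
  \<comment> \<open>The polynomial \<open>x * (x + 1) ^ N\<close> is the bound of
    \<open>card_local_runs\<close>, and the factor 3 is that of the exponent in
    \<open>comp_size_reduced\<close>.\<close>
  define Q :: "nat \<Rightarrow> nat poly" where "Q N = smult 3 ([:0, 1:] + [:0, 1:] * [:1, 1:] ^ N)" for N
  have P: "poly P x = 43 * (x + 1) ^ 5" and Q: "poly (Q N) x = 3 * (x + x * (x + 1) ^ N)" for x N
    by (simp_all add: P_def Q_def algebra_simps)
  have size1: "comp_size (red_alphabet D A r q) (red_automaton D A r q) q
      \<le> poly P (comp_size D A q) * 2 ^ poly [:0, 3:] (comp_size D A r + card (local_runs D A r))"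
    if "reduction_setting D A K r q"
    for D :: "('p, 'a) alphabet" and A :: "('p, 'a, 's) zautomaton" and K r q
  proof -
    interpret reduction D A K r q using that by unfold_locales
    show ?thesis using comp_size_reduced by (simp add: P algebra_simps)
  qed
  have size2: "comp_size (red_alphabet D A r q) (red_automaton D A r q) q
      \<le> poly P (comp_size D A q) * 2 ^ poly (Q N) (comp_size D A r)"
    if "reduction_setting D A K r q" "short_by N D A r"
    for D :: "('p, 'a) alphabet" and A :: "('p, 'a, 's) zautomaton" and K r q N
  proof -
    interpret reduction D A K r q using that(1) by unfold_locales
    have "poly [:0, 3:] (comp_size D A r + card (local_runs D A r)) \<le> poly (Q N) (comp_size D A r)"
      using card_local_runs[OF that(2)] by (simp add: Q)
    then have "(2 :: nat) ^ poly [:0, 3:] (comp_size D A r + card (local_runs D A r)) \<le>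
        2 ^ poly (Q N) (comp_size D A r)"
      by (intro power_increasing) auto
    with size1[OF that(1)] show ?thesis by (meson mult_le_mono2 order.trans)
  qed
  show ?thesis
  proof (intro conjI allI impI)
    show "\<exists>P :: nat poly.
       (\<exists>Q :: nat poly.
          \<forall>(D :: ('p, 'a) alphabet) (A :: ('p, 'a, 's) zautomaton) K r q.
            reduction_setting D A K r q \<longrightarrow>
              comp_size (red_alphabet D A r q) (red_automaton D A r q) q
                \<le> poly P (comp_size D A q) * 2 ^ poly Q (comp_size D A r + card (local_runs D A r))) \<and>
       (\<forall>N. \<exists>Q :: nat poly.
          \<forall>(D :: ('p, 'a) alphabet) (A :: ('p, 'a, 's) zautomaton) K r q.
            reduction_setting D A K r q \<and> short_by N D A r \<longrightarrow>
              comp_size (red_alphabet D A r q) (red_automaton D A r q) q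
                \<le> poly P (comp_size D A q) * 2 ^ poly Q (comp_size D A r))"
    proof (rule exI[of _ P], intro conjI allI)
      show "\<exists>Q :: nat poly. \<forall>(D :: ('p, 'a) alphabet) (A :: ('p, 'a, 's) zautomaton) K r q.
          reduction_setting D A K r q \<longrightarrow> comp_size (red_alphabet D A r q) (red_automaton D A r q) q
            \<le> poly P (comp_size D A q) * 2 ^ poly Q (comp_size D A r + card (local_runs D A r))"
        using size1 by (intro exI[of _ "[:0, 3:]"] allI impI)
      show "\<exists>Q :: nat poly. \<forall>(D :: ('p, 'a) alphabet) (A :: ('p, 'a, 's) zautomaton) K r q.
          reduction_setting D A K r q \<and> short_by N D A r \<longrightarrow>
            comp_size (red_alphabet D A r q) (red_automaton D A r q) q
              \<le> poly P (comp_size D A q) * 2 ^ poly Q (comp_size D A r)" for N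
        using size2 by (intro exI[of _ "Q N"] allI impI) blast
    qed
  qed (use forward backward in blast)+
qed


end
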